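(* No infinite Moufang hexagon admits an exceptional domestic automorphism.
   Context: A generalised hexagon is a nonempty point-line geometry $\Gamma=(\mathcal{P},\mathcal{L},\mathbf{I})$ containing no ordinary $k$-gon (as a subgeometry) for $2\leq k<6$ and such that any two elements of $\mathcal{P}\cup\mathcal{L}$ are contained in some ordinary hexagon in $\Gamma$. It is thick if each point is on at least $3$ lines and each line contains at least $3$ points. A Moufang hexagon is a thick generalised hexagon satisfying the Moufang condition: for every geodesic path $x_0\,\mathbf{I}\,x_1\,\mathbf{I}\cdots\mathbf{I}\,x_6$ of length $6$ in the incidence graph, the group of collineations fixing every element incident with at least one of $x_1,\ldots,x_5$ acts transitively on the set of ordinary hexagons of $\Gamma$ containing $x_0,\ldots,x_6$. An automorphism is a bijection of $\mathcal{P}\cup\mathcal{L}$ preserving incidence and non-incidence, which either preserves $\mathcal{P}$ and $\mathcal{L}$ (collineation) or interchanges them (duality). Two elements are opposite if they are at distance $6$ in the incidence graph. A chamber is an incident point-line pair; chambers $\{p,L\}$ and $\{p',L'\}$ are opposite if $p,p'$ are opposite and $L,L'$ are opposite. An automorphism is domestic if it maps no chamber to an opposite chamber, and exceptional domestic if moreover it maps at least one point to an opposite point and at least one line to an opposite line. *)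

theory Defs
  imports Main "HOL-Library.Extended_Nat"
begin

text \<open>Points and lines live in a common type, so that dualities are ordinary functions on
  \<open>points G \<union> lines G\<close>. Incidence is a symmetric relation between points and lines.\<close>

record 'a geometry =
  points :: "'a set"
  lines :: "'a set"
  inc :: "'a \<Rightarrow> 'a \<Rightarrow> bool"

definition elements :: "'a geometry \<Rightarrow> 'a set" where
  "elements G = points G \<union> lines G"

definition point_line_geometry :: "'a geometry \<Rightarrow> bool" where
  "point_line_geometry G \<longleftrightarrow>
     points G \<inter> lines G = {} \<and>
     (\<forall>x y. inc G x y \<longrightarrow> inc G y x) \<and>
     (\<forall>x y. inc G x y \<longrightarrow>
        (x \<in> points G \<and> y \<in> lines G) \<or> (x \<in> lines G \<and> y \<in> points G))"

text \<open>A \<open>k\<close>-gon (\<open>k \<ge> 2\<close>) is given by its set of \<open>k\<close> points and \<open>k\<close> lines; as a subgeometry it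
  carries the induced incidence, which is required to be that of a cycle of length \<open>2 * k\<close>.\<close>

definition ordinary_gon :: "'a geometry \<Rightarrow> nat \<Rightarrow> 'a set \<Rightarrow> bool" where
  "ordinary_gon G k H \<longleftrightarrow>
     (\<exists>x :: nat \<Rightarrow> 'a. inj_on x {..<2 * k} \<and> H = x ` {..<2 * k} \<and> H \<subseteq> elements G \<and>
        (\<forall>i<2 * k. \<forall>j<2 * k. inc G (x i) (x j) \<longleftrightarrow>
           j = (i + 1) mod (2 * k) \<or> i = (j + 1) mod (2 * k)))"

definition generalised_hexagon :: "'a geometry \<Rightarrow> bool" where
  "generalised_hexagon G \<longleftrightarrow>
     point_line_geometry G \<and> elements G \<noteq> {} \<and>
     (\<forall>k. 2 \<le> k \<and> k < 6 \<longrightarrow> \<not> (\<exists>H. ordinary_gon G k H)) \<and>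
     (\<forall>x\<in>elements G. \<forall>y\<in>elements G. \<exists>H. ordinary_gon G 6 H \<and> x \<in> H \<and> y \<in> H)"

text \<open>The sets of incident elements may be infinite, hence no bound on their \<open>card\<close>.\<close>

definition thick :: "'a geometry \<Rightarrow> bool" where
  "thick G \<longleftrightarrow>
     (\<forall>p\<in>points G. \<exists>S \<subseteq> {l \<in> lines G. inc G p l}. card S = 3) \<and>
     (\<forall>l\<in>lines G. \<exists>S \<subseteq> {p \<in> points G. inc G p l}. card S = 3)"

definition incidence_dist :: "'a geometry \<Rightarrow> 'a \<Rightarrow> 'a \<Rightarrow> enat" where
  "incidence_dist G x y = (INF n \<in> {n. (inc G ^^ n) x y}. enat n)"

text \<open>Only the values on \<open>elements G\<close> of the functions representing automorphisms matter.\<close>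

definition preserves_incidence :: "'a geometry \<Rightarrow> ('a \<Rightarrow> 'a) \<Rightarrow> bool" where
  "preserves_incidence G \<theta> \<longleftrightarrow>
     bij_betw \<theta> (elements G) (elements G) \<and>
     (\<forall>x\<in>elements G. \<forall>y\<in>elements G. inc G (\<theta> x) (\<theta> y) \<longleftrightarrow> inc G x y)"

definition collineation :: "'a geometry \<Rightarrow> ('a \<Rightarrow> 'a) \<Rightarrow> bool" where
  "collineation G \<theta> \<longleftrightarrow>
     preserves_incidence G \<theta> \<and> \<theta> ` points G = points G \<and> \<theta> ` lines G = lines G"

definition duality :: "'a geometry \<Rightarrow> ('a \<Rightarrow> 'a) \<Rightarrow> bool" where
  "duality G \<theta> \<longleftrightarrow>
     preserves_incidence G \<theta> \<and> \<theta> ` points G = lines G \<and> \<theta> ` lines G = points G"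

definition automorphism :: "'a geometry \<Rightarrow> ('a \<Rightarrow> 'a) \<Rightarrow> bool" where
  "automorphism G \<theta> \<longleftrightarrow> collineation G \<theta> \<or> duality G \<theta>"

definition geodesic_path :: "'a geometry \<Rightarrow> nat \<Rightarrow> (nat \<Rightarrow> 'a) \<Rightarrow> bool" where
  "geodesic_path G n x \<longleftrightarrow>
     (\<forall>i<n. inc G (x i) (x (Suc i))) \<and> incidence_dist G (x 0) (x n) = enat n"

definition root_elations :: "'a geometry \<Rightarrow> (nat \<Rightarrow> 'a) \<Rightarrow> ('a \<Rightarrow> 'a) set" where
  "root_elations G x =
     {g. collineation G g \<and>
         (\<forall>y\<in>elements G. (\<exists>i\<in>{1..5}. inc G y (x i)) \<longrightarrow> g y = y)}"

definition Moufang_condition :: "'a geometry \<Rightarrow> bool" where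
  "Moufang_condition G \<longleftrightarrow>
     (\<forall>x. geodesic_path G 6 x \<longrightarrow>
        (\<forall>H H'. ordinary_gon G 6 H \<and> x ` {..6} \<subseteq> H \<and>
                ordinary_gon G 6 H' \<and> x ` {..6} \<subseteq> H' \<longrightarrow>
           (\<exists>g\<in>root_elations G x. g ` H = H')))"

definition Moufang_hexagon :: "'a geometry \<Rightarrow> bool" where
  "Moufang_hexagon G \<longleftrightarrow> generalised_hexagon G \<and> thick G \<and> Moufang_condition G"

definition opposite :: "'a geometry \<Rightarrow> 'a \<Rightarrow> 'a \<Rightarrow> bool" where
  "opposite G x y \<longleftrightarrow> incidence_dist G x y = 6"

definition chamber :: "'a geometry \<Rightarrow> 'a set \<Rightarrow> bool" where
  "chamber G C \<longleftrightarrow> (\<exists>p\<in>points G. \<exists>l\<in>lines G. inc G p l \<and> C = {p, l})"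

definition opposite_chambers :: "'a geometry \<Rightarrow> 'a set \<Rightarrow> 'a set \<Rightarrow> bool" where
  "opposite_chambers G C C' \<longleftrightarrow>
     chamber G C \<and> chamber G C' \<and>
     (\<exists>p\<in>points G. \<exists>l\<in>lines G. \<exists>p'\<in>points G. \<exists>l'\<in>lines G.
        C = {p, l} \<and> C' = {p', l'} \<and> opposite G p p' \<and> opposite G l l')"

definition domestic :: "'a geometry \<Rightarrow> ('a \<Rightarrow> 'a) \<Rightarrow> bool" where
  "domestic G \<theta> \<longleftrightarrow>
     automorphism G \<theta> \<and> (\<forall>C. chamber G C \<longrightarrow> \<not> opposite_chambers G C (\<theta> ` C))"

definition exceptional_domestic :: "'a geometry \<Rightarrow> ('a \<Rightarrow> 'a) \<Rightarrow> bool" where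
  "exceptional_domestic G \<theta> \<longleftrightarrow>
     domestic G \<theta> \<and>
     (\<exists>p\<in>points G. \<theta> p \<in> points G \<and> opposite G p (\<theta> p)) \<and>
     (\<exists>l\<in>lines G. \<theta> l \<in> lines G \<and> opposite G l (\<theta> l))"

end

theory Submission imports Defs begin

text \<open>
  Write \<open>\<theta>\<close> for an exceptional domestic collineation (a duality maps no point to an opposite
  point) and call an element good if \<open>\<theta>\<close> maps it to an opposite element; no good point is on a
  good line. If \<open>p\<close> is good, then every line through \<open>p\<close> is mapped to its projection onto \<open>\<theta> p\<close>, so it
  has at most two points that are not good, and these are collinear with \<open>p\<close> and at distance 4 from
  \<open>\<theta> p\<close> or from \<open>\<theta>\<inverse> p\<close>; dually for good lines.

  Commutator calculus with root elations shows that, up to duality, every root elation whose root has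
  a line in the middle fixes all elements at distance at most 3 from that line. It follows that the
  points are distance-2 regular: two traces \<open>{c. d(a, c) = 2 \<and> d(c, u) = 4}\<close> sharing two points
  are equal. A degree argument (polynomial maps from an infinite group to a finite one have nontrivial
  zeros) shows that all elements are incident with infinitely many others.

  Now let \<open>p\<close> be a good point and \<open>N\<close> a good line with \<open>d(p, N) = 3\<close>, and let \<open>y\<close> be the point of \<open>N\<close>
  collinear with \<open>p\<close>. Take three good points \<open>a\<^sub>1, a\<^sub>2, a\<^sub>3\<close> on a trace of \<open>p\<close> through \<open>y\<close>, then \<open>u\<close> on \<open>N\<close>
  and a good line \<open>M\<close> through \<open>u\<close> in general position. By regularity some point \<open>w\<close> of \<open>M\<close> is at
  distance 4 from all \<open>a\<^sub>i\<close>. General position makes the middle points between \<open>a\<^sub>i\<close> and \<open>w\<close> good, so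
  that \<open>w\<close> is on three lines that are not good, which is impossible as \<open>w\<close> is on the good line \<open>M\<close>.
\<close>

section \<open>Walks and apartments\<close>

text \<open>No classification or coordinates of Moufang hexagons are used, only the rigidity of the
  action on an apartment. It is not known in advance which type of element carries the central
  elations. Therefore everything takes place in the bipartite incidence graph, with a predicate
  \<open>pt\<close> and a truth value \<open>t\<close> for the types, and the final argument applies
  to a hexagon and to its dual. Regularity is needed for the following reason. Among the elements at
  distance 2 from a good point, those that are not good lie in two traces. A third trace could a
  priori have infinitely many elements in common with these; regularity leaves at most one with
  each. Thus every condition of general position excludes only finitely many choices. Choices are
  made both of points on a line and of lines through a point, whereas infinity of the hexagon
  directly yields just one element with infinitely many neighbours. This gap is the purpose of the
  degree argument.\<close>

fun walk :: "('a \<Rightarrow> 'a \<Rightarrow> bool) \<Rightarrow> 'a list \<Rightarrow> bool" where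
  "walk E [] \<longleftrightarrow> False"
| "walk E [x] \<longleftrightarrow> True"
| "walk E [x, y] \<longleftrightarrow> E x y"
| "walk E (x # y # z # xs) \<longleftrightarrow> E x y \<and> x \<noteq> z \<and> walk E (y # z # xs)"

lemma walk_append:
  "walk E (xs @ a # ys) \<longleftrightarrow> walk E (xs @ [a]) \<and> walk E (a # ys) \<and>
     (xs \<noteq> [] \<longrightarrow> ys \<noteq> [] \<longrightarrow> last xs \<noteq> hd ys)"
proof (induction xs rule: induct_list012)
  case 1
  then show ?case by (cases ys) auto
next
  case (2 x)
  then show ?case by (cases ys) auto
next
  case (3 x y zs)
  then show ?case by (cases zs; cases ys) auto
qed

lemma walk_rev:
  assumes "\<And>x y. E x y \<Longrightarrow> E y x"
  shows "walk E (rev xs) \<longleftrightarrow> walk E xs"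
proof (induction xs rule: induct_list012)
  case (3 x y zs)
  show ?case
  proof (cases zs)
    case Nil
    then show ?thesis using assms by auto
  next
    case (Cons z us)
    have "walk E (rev (x # y # zs)) \<longleftrightarrow> walk E ((rev us @ [z]) @ y # [x])"
      by (simp add: Cons)
    also have "\<dots> \<longleftrightarrow> walk E (rev (y # zs)) \<and> E y x \<and> z \<noteq> x"
      by (subst walk_append) (simp add: Cons)
    finally show ?thesis using 3 assms Cons by auto
  qed
qed auto

lemma walk_take: "walk E xs \<Longrightarrow> 0 < n \<Longrightarrow> walk E (take n xs)"
proof -
  assume w: "walk E xs" and n: "0 < n"
  show ?thesis
  proof (cases "n < length xs")
    case True
    then have "xs = take (n - 1) xs @ xs ! (n - 1) # drop n xs"
      using n by (metis Suc_diff_1 Suc_lessD id_take_nth_drop)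
    then have "walk E (take (n - 1) xs @ [xs ! (n - 1)])"
      using w walk_append by metis
    then show ?thesis using n True
      by (metis Suc_diff_1 Suc_lessD take_Suc_conv_app_nth)
  qed (use w in auto)
qed

lemma walk_drop: "walk E xs \<Longrightarrow> n < length xs \<Longrightarrow> walk E (drop n xs)"
  by (metis id_take_nth_drop walk_append Cons_nth_drop_Suc)

lemma walk_nth: "walk E xs \<Longrightarrow> Suc i < length xs \<Longrightarrow> E (xs ! i) (xs ! Suc i)"
proof -
  assume "walk E xs" "Suc i < length xs"
  then have "walk E (drop i xs)" using walk_drop by (metis Suc_lessD)
  moreover have "drop i xs = xs ! i # xs ! Suc i # drop (Suc (Suc i)) xs"
    using \<open>Suc i < length xs\<close> by (metis Cons_nth_drop_Suc Suc_lessD)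
  ultimately show ?thesis by (metis neq_Nil_conv walk.simps(3,4))
qed

text \<open>The axioms speak of adjacent pairs because the type may contain elements outside the
  geometry, which are isolated vertices. Lengths count vertices: \<open>girth\<close> excludes
  closed walks with up to 11 steps, and \<open>diameter\<close> provides walks with at most
  6.\<close>

locale hexagon =
  fixes adj :: "'a \<Rightarrow> 'a \<Rightarrow> bool" and pt :: "'a \<Rightarrow> bool"
  assumes adj_sym: "adj x y \<Longrightarrow> adj y x"
    and adj_pt: "adj x y \<Longrightarrow> pt x \<longleftrightarrow> \<not> pt y"
    and girth: "walk adj xs \<Longrightarrow> hd xs = last xs \<Longrightarrow> length xs \<le> 12 \<Longrightarrow> length xs = 1"
    and diameter: "adj x x' \<Longrightarrow> adj y y' \<Longrightarrow>
          \<exists>xs. walk adj xs \<and> hd xs = x \<and> last xs = y \<and> length xs \<le> 7"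
    and thick_adj: "adj x y \<Longrightarrow> \<exists>z1 z2. adj x z1 \<and> adj x z2 \<and> z1 \<noteq> y \<and> z2 \<noteq> y \<and> z1 \<noteq> z2"
begin

abbreviation path :: "'a list \<Rightarrow> bool" where "path \<equiv> walk adj"

lemma path_rev [simp]: "path (rev xs) \<longleftrightarrow> path xs"
  using walk_rev adj_sym by metis

lemma adj_irrefl [simp]: "\<not> adj x x"
  using adj_pt by blast

lemma adj_neq: "adj x y \<Longrightarrow> x \<noteq> y"
  by auto

lemma adj_comm: "adj x y \<longleftrightarrow> adj y x"
  using adj_sym by blast

text \<open>Once the common beginning is stripped, the reversed first list glued to the second is a
  closed walk. The gluing vertex is shared, so a total of 13 vertices becomes the 12 of
  \<open>girth\<close>.\<close>

lemma path_unique: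
  "path xs \<Longrightarrow> path ys \<Longrightarrow> hd xs = hd ys \<Longrightarrow> last xs = last ys \<Longrightarrow>
   length xs + length ys \<le> 13 \<Longrightarrow> xs = ys"
proof (induction xs arbitrary: ys)
  case (Cons a xs)
  from Cons.prems obtain ys' where ys: "ys = a # ys'" by (cases ys) auto
  show ?case
  proof (cases "xs = [] \<or> ys' = []")
    case True
    then consider "xs = []" | "ys' = []" by blast
    then show ?thesis
    proof cases
      case 1
      then have "length ys = 1" using Cons.prems by (intro girth) auto
      then show ?thesis using 1 ys by auto
    next
      case 2
      then have "length (a # xs) = 1" using Cons.prems ys by (intro girth) auto
      then show ?thesis using 2 ys by auto
    qed
  next
    case False
    then obtain b us c vs where u: "xs = b # us" and v: "ys' = c # vs"
      by (meson neq_Nil_conv)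
    show ?thesis
    proof (cases "b = c")
      case True
      have "path (b # us)" "path (c # vs)"
        using Cons.prems u v ys by (cases us; cases vs; auto)+
      then have "xs = ys'" using Cons.IH[of ys'] Cons.prems u v ys True by auto
      then show ?thesis using ys by simp
    next
      case bc: False
      have "path (rev xs @ [a])" using Cons.prems path_rev[of "a # xs"] by simp
      then have "path (rev xs @ a # ys')"
        using Cons.prems(2) ys bc u v by (subst walk_append) auto
      then have "length (rev xs @ a # ys') = 1"
        using Cons.prems ys u v by (intro girth) (auto simp: last_rev hd_append hd_rev)
      then show ?thesis using u by simp
    qed
  qed
qed simp

text \<open>For \<open>n\<close> at most 6 this is distance \<open>n\<close> in the graph, by
  \<open>dst_unique\<close>. For larger \<open>n\<close> it asserts only a walk without
  backtracking; the value 7 occurs when apartments are closed up.\<close>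

definition dst :: "nat \<Rightarrow> 'a \<Rightarrow> 'a \<Rightarrow> bool" where
  "dst n x y \<longleftrightarrow> (\<exists>xs. path xs \<and> length xs = Suc n \<and> hd xs = x \<and> last xs = y)"

lemma dstI: "path xs \<Longrightarrow> length xs = Suc n \<Longrightarrow> hd xs = x \<Longrightarrow> last xs = y \<Longrightarrow> dst n x y"
  unfolding dst_def by blast

lemma dst_sym: "dst n x y \<Longrightarrow> dst n y x"
  unfolding dst_def
  by (metis hd_rev last_rev length_rev path_rev)

lemma dst_unique: "dst m x y \<Longrightarrow> dst n x y \<Longrightarrow> m + n \<le> 11 \<Longrightarrow> m = n"
proof -
  assume "dst m x y" "dst n x y" and mn: "m + n \<le> 11"
  then obtain xs ys where "path xs" "length xs = Suc m" "hd xs = x" "last xs = y"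
    "path ys" "length ys = Suc n" "hd ys = x" "last ys = y"
    unfolding dst_def by blast
  with path_unique[of xs ys] mn show ?thesis by auto
qed

lemma dst_exists: "adj x x' \<Longrightarrow> adj y y' \<Longrightarrow> \<exists>n\<le>6. dst n x y"
proof -
  assume "adj x x'" "adj y y'"
  then obtain xs where xs: "path xs" "hd xs = x" "last xs = y" "length xs \<le> 7"
    using diameter by blast
  then have "xs \<noteq> []" by auto
  then have "dst (length xs - 1) x y" unfolding dst_def using xs
    by (intro exI[of _ xs]) auto
  then show ?thesis using xs by (intro exI[of _ "length xs - 1"]) auto
qed

lemma dst_pt: "dst n x y \<Longrightarrow> (pt x \<longleftrightarrow> pt y) \<longleftrightarrow> even n"
proof -
  have "path xs \<Longrightarrow> (pt (hd xs) \<longleftrightarrow> pt (last xs)) \<longleftrightarrow> odd (length xs)" for xs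
  proof (induction xs rule: induct_list012)
    case (3 x y zs)
    have "adj x y" "path (y # zs)" using 3(3) by (cases zs; auto)+
    then show ?case using 3(2) adj_pt[of x y] by auto
  qed auto
  then show "dst n x y \<Longrightarrow> ?thesis" unfolding dst_def by fastforce
qed

lemma dst_0 [simp]: "dst 0 x y \<longleftrightarrow> x = y"
  unfolding dst_def by (auto simp: length_Suc_conv intro!: exI[of _ "[y]"])

lemma dst_1: "dst 1 x y \<longleftrightarrow> adj x y"
proof
  assume "dst 1 x y"
  then show "adj x y" by (auto simp: dst_def length_Suc_conv)
next
  assume "adj x y"
  then show "dst 1 x y" unfolding dst_def by (intro exI[of _ "[x, y]"]) auto
qed

lemma dst_2: "dst 2 x y \<longleftrightarrow> (\<exists>a. path [x, a, y])"
proof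
  assume "dst 2 x y"
  then show "\<exists>a. path [x, a, y]"
    by (auto simp: dst_def length_Suc_conv numeral_eq_Suc)
qed (elim exE, rule dstI, assumption, simp_all)

lemma dst_3: "dst 3 x y \<longleftrightarrow> (\<exists>a b. path [x, a, b, y])"
proof
  assume "dst 3 x y"
  then obtain xs where xs: "path xs" "length xs = Suc 3" "hd xs = x" "last xs = y"
    unfolding dst_def by blast
  then obtain a b c d where "xs = [a, b, c, d]"
    by (auto simp: length_Suc_conv numeral_eq_Suc)
  with xs show "\<exists>a b. path [x, a, b, y]" by auto
qed (elim exE, rule dstI, assumption, simp_all)

lemma dst_4: "dst 4 x y \<longleftrightarrow> (\<exists>a b c. path [x, a, b, c, y])"
proof
  assume "dst 4 x y"
  then obtain xs where xs: "path xs" "length xs = Suc 4" "hd xs = x" "last xs = y"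
    unfolding dst_def by blast
  then obtain a b c d e where "xs = [a, b, c, d, e]"
    by (auto simp: length_Suc_conv numeral_eq_Suc)
  with xs show "\<exists>a b c. path [x, a, b, c, y]" by auto
qed (elim exE, rule dstI, assumption, simp_all)

lemma dst_5: "dst 5 x y \<longleftrightarrow> (\<exists>a b c d. path [x, a, b, c, d, y])"
proof
  assume "dst 5 x y"
  then obtain xs where xs: "path xs" "length xs = Suc 5" "hd xs = x" "last xs = y"
    unfolding dst_def by blast
  then obtain a b c d e f where "xs = [a, b, c, d, e, f]"
    by (auto simp: length_Suc_conv numeral_eq_Suc)
  with xs show "\<exists>a b c d. path [x, a, b, c, d, y]" by auto
qed (elim exE, rule dstI, assumption, simp_all)

lemma dst_6: "dst 6 x y \<longleftrightarrow> (\<exists>a b c d e. path [x, a, b, c, d, e, y])"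
proof
  assume "dst 6 x y"
  then obtain xs where xs: "path xs" "length xs = Suc 6" "hd xs = x" "last xs = y"
    unfolding dst_def by blast
  then obtain a b c d e f g where "xs = [a, b, c, d, e, f, g]"
    by (auto simp: length_Suc_conv numeral_eq_Suc)
  with xs show "\<exists>a b c d e. path [x, a, b, c, d, e, y]"
    by (intro exI[of _ b] exI[of _ c] exI[of _ d] exI[of _ e] exI[of _ f]) auto
qed (elim exE, rule dstI, assumption, simp_all)

section \<open>Apartments: ordinary hexagons as walks of period 12 without backtracking\<close>

definition apt :: "(int \<Rightarrow> 'a) \<Rightarrow> bool" where
  "apt v \<longleftrightarrow> (\<forall>i. adj (v i) (v (i + 1)) \<and> v i \<noteq> v (i + 2) \<and> v (i + 12) = v i)"

lemma apt_adj:
  assumes "apt v"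
  shows "j = i + 1 \<Longrightarrow> adj (v i) (v j)" "i = j + 1 \<Longrightarrow> adj (v i) (v j)"
    "j = i + 2 \<Longrightarrow> v i \<noteq> v j" "i = j + 2 \<Longrightarrow> v i \<noteq> v j"
  using assms adj_sym unfolding apt_def by metis+

lemma apt_period: "apt v \<Longrightarrow> j = i + 12 \<Longrightarrow> v j = v i"
  unfolding apt_def by blast

lemma apt_shift: "apt v \<Longrightarrow> apt (\<lambda>i. v (i + k))"
  unfolding apt_def by (metis add.assoc add.commute)

lemma apt_reflect: "apt v \<Longrightarrow> apt (\<lambda>i. v (k - i))"
proof -
  assume v: "apt v"
  have "adj (v (k - i)) (v (k - (i + 1)))" "v (k - i) \<noteq> v (k - (i + 2))"
    "v (k - (i + 12)) = v (k - i)" for i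
    using apt_adj(2)[OF v, of "k - i" "k - (i + 1)"] apt_adj(4)[OF v, of "k - i" "k - (i + 2)"]
      apt_period[OF v, of "k - i" "k - (i + 12)"] by simp_all
  then show "apt (\<lambda>i. v (k - i))"
    unfolding apt_def by blast
qed

text \<open>The ends have odd distance, and distance 1 or 3 would contradict uniqueness against the
  seven given steps. So five more steps close the cycle. Backtracking at a junction would bring two
  opposite elements to distance 4.\<close>

lemma apt_exists_7:
  assumes p: "path [x0, x1, x2, x3, x4, x5, x6, x7]"
  shows "\<exists>v. apt v \<and> v 0 = x0 \<and> v 1 = x1 \<and> v 2 = x2 \<and> v 3 = x3 \<and> v 4 = x4 \<and> v 5 = x5
    \<and> v 6 = x6 \<and> v 7 = x7"
proof -
  have "adj x0 x1" "adj x7 x6" using p adj_sym by auto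
  then obtain n where n: "n \<le> 6" "dst n x7 x0" using dst_exists by blast
  have "dst 7 x0 x7" unfolding dst_def
    by (rule exI[of _ "[x0, x1, x2, x3, x4, x5, x6, x7]"]) (use p in simp)
  then have d7: "dst 7 x7 x0" by (rule dst_sym)
  have "odd n" using dst_pt[OF d7] dst_pt[OF n(2)] by simp
  moreover have "n \<noteq> 1" "n \<noteq> 3" using dst_unique[OF n(2) d7] by auto
  moreover have "n = 1 \<or> n = 3 \<or> n = 5 \<or> even n" using n(1) by presburger
  ultimately have "n = 5" by blast
  then obtain a b c d where q: "path [x7, a, b, c, d, x0]" using n(2) dst_5 by blast
  have "path [x1, x2, x3, x4, x5, x6, x7]" "path [x0, x1, x2, x3, x4, x5, x6]"
    using p by simp_all
  then have d6: "dst 6 x7 x1" "dst 6 x6 x0"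
    using dst_6 dst_sym by blast+
  have "a \<noteq> x6"
  proof
    assume "a = x6"
    then have "path [x6, b, c, d, x0]" using q by simp
    then have "dst 4 x6 x0" using dst_4 by blast
    then show False using dst_unique[OF _ d6(2), of 4] by simp
  qed
  moreover have "d \<noteq> x1"
  proof
    assume "d = x1"
    then have "path [x7, a, b, c, x1]" using q by simp
    then have "dst 4 x7 x1" using dst_4 by blast
    then show False using dst_unique[OF _ d6(1), of 4] by simp
  qed
  ultimately have n2: "a \<noteq> x6" "d \<noteq> x1" by auto
  define l where "l = [x0, x1, x2, x3, x4, x5, x6, x7, a, b, c, d]"
  define v where "v = (\<lambda>i::int. l ! nat (i mod 12))"
  have l: "\<forall>k\<in>{0,1,2,3,4,5,6,7,8,9,10,11}. adj (l ! k) (l ! ((k + 1) mod 12)) \<and>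
      l ! k \<noteq> l ! ((k + 2) mod 12)"
    using p q n2(2) n2(1)[symmetric] by (simp add: l_def)
  have "adj (v i) (v (i + 1)) \<and> v i \<noteq> v (i + 2) \<and> v (i + 12) = v i" for i
  proof -
    have "(i + 1) mod 12 = (i mod 12 + 1) mod 12" "(i + 2) mod 12 = (i mod 12 + 2) mod 12"
      by presburger+
    then have n: "nat ((i + 1) mod 12) = (nat (i mod 12) + 1) mod 12"
      "nat ((i + 2) mod 12) = (nat (i mod 12) + 2) mod 12"
      by (simp_all add: nat_mod_distrib nat_add_distrib)
    have small: "k \<in> {0,1,2,3,4,5,6,7,8,9,10,11}" if "k < 12" for k :: nat
      using that unfolding insert_iff empty_iff by presburger
    have "nat (i mod 12) \<in> {0,1,2,3,4,5,6,7,8,9,10,11}"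
      by (rule small) (simp add: nat_less_iff)
    from bspec[OF l this] show ?thesis unfolding v_def n by simp
  qed
  then have "apt v" unfolding apt_def by blast
  moreover have "v 0 = x0 \<and> v 1 = x1 \<and> v 2 = x2 \<and> v 3 = x3 \<and> v 4 = x4 \<and> v 5 = x5
    \<and> v 6 = x6 \<and> v 7 = x7" by (simp add: v_def l_def)
  ultimately show ?thesis by blast
qed

lemma path_extend: "adj x y \<Longrightarrow> \<exists>z. adj y z \<and> x \<noteq> z"
  using thick_adj[of y x] adj_sym by metis

lemma apt_exists_6:
  assumes p: "path [x0, x1, x2, x3, x4, x5, x6]"
  shows "\<exists>v. apt v \<and> v 0 = x0 \<and> v 1 = x1 \<and> v 2 = x2 \<and> v 3 = x3 \<and> v 4 = x4 \<and> v 5 = x5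
    \<and> v 6 = x6"
proof -
  obtain x7 where "path [x0, x1, x2, x3, x4, x5, x6, x7]"
    using p path_extend[of x5 x6] by auto
  from apt_exists_7[OF this] show ?thesis by blast
qed

lemma apt_exists_4:
  assumes p: "path [x0, x1, x2, x3, x4]"
  shows "\<exists>v. apt v \<and> v 0 = x0 \<and> v 1 = x1 \<and> v 2 = x2 \<and> v 3 = x3 \<and> v 4 = x4"
proof -
  obtain x5 where a: "adj x4 x5" "x3 \<noteq> x5" using p path_extend[of x3 x4] by auto
  obtain x6 where b: "adj x5 x6" "x4 \<noteq> x6" using path_extend[OF a(1)] by auto
  from p a b have "path [x0, x1, x2, x3, x4, x5, x6]" by simp
  from apt_exists_6[OF this] show ?thesis by blast
qed

lemma apt_exists_1:
  assumes "adj x0 x1"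
  shows "\<exists>v. apt v \<and> v 0 = x0 \<and> v 1 = x1"
proof -
  obtain x2 where a: "adj x1 x2" "x0 \<noteq> x2" using assms path_extend by auto
  obtain x3 where b: "adj x2 x3" "x1 \<noteq> x3" using path_extend[OF a(1)] by auto
  obtain x4 where c: "adj x3 x4" "x2 \<noteq> x4" using path_extend[OF b(1)] by auto
  from assms a b c have "path [x0, x1, x2, x3, x4]" by simp
  from apt_exists_4[OF this] show ?thesis by blast
qed

lemma int_0_7: "i \<in> {0..7} \<Longrightarrow> i = 0 \<or> i = 1 \<or> i = 2 \<or> i = 3 \<or> i = 4 \<or> i = 5 \<or> i = 6 \<or> i = (7::int)"
  by auto

text \<open>The indices 0 to 7 leave a gap of five steps, from \<open>v 7\<close> to
  \<open>v 12 = v 0\<close>, which only one path can fill.\<close>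

lemma apt_unique:
  assumes v: "apt v" and w: "apt w" and e: "\<And>i. i \<in> {0..7} \<Longrightarrow> v i = w i"
  shows "v = w"
proof -
  note a = apt_adj[OF v] apt_adj[OF w]
  have p: "path [v 7, v 8, v 9, v 10, v 11, v 12]" "path [w 7, w 8, w 9, w 10, w 11, w 12]"
    by (simp_all add: a)
  have "v 12 = v 0" "w 12 = w 0"
    using apt_period[OF v, of 12 0] apt_period[OF w, of 12 0] by simp_all
  then have eq: "[v 7, v 8, v 9, v 10, v 11, v 12] = [w 7, w 8, w 9, w 10, w 11, w 12]"
    using e by (intro path_unique[OF p]) auto
  have "v i = w i" if "i \<in> {0..11}" for i
  proof -
    have "i \<in> {0..7} \<or> i = 8 \<or> i = 9 \<or> i = 10 \<or> i = 11" using that by auto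
    then show ?thesis using e eq by auto
  qed
  moreover have "u (i mod 12) = u i" if u: "apt u" for u i
  proof -
    have pos: "u (j + 12 * int n) = u j" for j n
    proof (induction n)
      case (Suc n)
      have "u (j + 12 * int (Suc n)) = u (j + 12 * int n)"
        by (intro apt_period[OF u]) simp
      then show ?case using Suc by simp
    qed simp
    show ?thesis
    proof (cases "i \<ge> 0")
      case True
      then have "u i = u (i mod 12 + 12 * int (nat (i div 12)))"
        by (simp add: pos_imp_zdiv_nonneg_iff)
      then show ?thesis using pos by metis
    next
      case False
      then have "i div 12 < 0" by (simp add: neg_imp_zdiv_neg_iff)
      then have "i mod 12 = i + 12 * int (nat (- (i div 12)))"
        by (simp add: minus_mult_div_eq_mod[symmetric])
      then show ?thesis using pos by metis
    qed
  qed
  ultimately have "v i = w i" if "i mod 12 \<in> {0..11}" for i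
    using that v w by metis
  then show ?thesis by (intro ext) simp
qed

end

section \<open>Collineations as a group\<close>

text \<open>The class \<open>group_add\<close> is not commutative, so bijections can be written
  additively: \<open>+\<close> is composition, \<open>0\<close> the identity and
  \<open>g + h - g\<close> a conjugate.\<close>

typedef 'a bijection = "{f :: 'a \<Rightarrow> 'a. bij f}"
  morphisms ap Bijection
  by (rule exI[of _ id]) simp

notation ap (infixr "\<cdot>" 75)

lemma bij_ap [simp]: "bij (ap g)"
  using ap by auto

lemma bijection_eqI: "(\<And>x. g \<cdot> x = h \<cdot> x) \<Longrightarrow> g = h"
  by (simp add: ap_inject[symmetric] ext)

instantiation bijection :: (type) group_add
begin

definition "0 = Bijection id"
definition "g + h = Bijection (ap g \<circ> ap h)"
definition "- g = Bijection (inv (ap g))"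
definition "g - h = g + - (h :: 'a bijection)"

instance
proof
  have plus: "ap (g + h) = ap g \<circ> ap h" for g h :: "'a bijection"
    by (simp add: plus_bijection_def Bijection_inverse bij_comp)
  have zero: "ap 0 = (id :: 'a \<Rightarrow> 'a)"
    by (simp add: zero_bijection_def Bijection_inverse)
  have neg: "ap (- g) = inv (ap g)" for g :: "'a bijection"
    by (simp add: uminus_bijection_def Bijection_inverse bij_imp_bij_inv)
  fix a b c :: "'a bijection"
  show "a + b + c = a + (b + c)" by (rule bijection_eqI) (simp add: plus)
  show "0 + a = a" "a + 0 = a" by (rule bijection_eqI, simp add: plus zero)+
  show "- a + a = 0"
    by (rule bijection_eqI) (simp add: plus zero neg bij_is_inj)
  show "a + - b = a - b" by (simp add: minus_bijection_def)
qed

end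

lemma ap_0 [simp]: "0 \<cdot> x = x"
  by (simp add: zero_bijection_def Bijection_inverse)

lemma ap_add [simp]: "(g + h) \<cdot> x = g \<cdot> h \<cdot> x"
  by (simp add: plus_bijection_def Bijection_inverse bij_comp)

lemma ap_minus [simp]: "(- g) \<cdot> g \<cdot> x = x" "g \<cdot> (- g) \<cdot> x = x"
  using ap_add[of "- g" g x] ap_add[of g "- g" x] by simp_all

lemma ap_diff [simp]: "(g - h) \<cdot> x = g \<cdot> (- h) \<cdot> x"
  by (simp only: diff_conv_add_uminus ap_add)

lemma ap_eq_iff [simp]: "g \<cdot> x = g \<cdot> y \<longleftrightarrow> x = y"
  by (metis ap_minus(1))

lemma ap_minus_eq: "(- g) \<cdot> x = y \<longleftrightarrow> x = g \<cdot> y"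
  by (metis ap_minus)

section \<open>Commutators in additive notation\<close>

definition cm :: "'b::group_add \<Rightarrow> 'b \<Rightarrow> 'b" where "cm g h = g + h - g - h"

text \<open>Rewriting words to reduced form proves identities that hold in every group.\<close>

lemmas group_simps = diff_conv_add_uminus minus_add minus_minus add.assoc add_minus_cancel
  minus_add_cancel left_minus right_minus add_0_left add_0_right minus_zero

lemma cm_eq_0: "cm g h = 0 \<longleftrightarrow> g + h = h + (g::'b::group_add)"
proof
  assume "cm g h = 0"
  then have "(g + h - g - h) + h + g = h + g" by (simp add: cm_def)
  then show "g + h = h + g" by (simp only: diff_add_cancel)
next
  assume "g + h = h + g"
  then have "g + h - g = h" by (metis add_diff_cancel)
  then show "cm g h = 0" by (simp add: cm_def)
qed

lemma cm_swap: "cm h g = - cm g (h::'b::group_add)"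
  by (simp only: cm_def group_simps)

lemma cm_conj: "k + cm g h - k = cm (k + g - k) (k + h - (k::'b::group_add))"
  by (simp only: cm_def group_simps)

lemma cm_add_left: "cm (g + h) k = g + cm h k - g + cm g (k::'b::group_add)"
  by (simp only: cm_def group_simps)

lemma cm_add_right: "cm g (h + k) = cm g h + (h + cm g k - (h::'b::group_add))"
  by (simp only: cm_def group_simps)

lemma conj_eq_cm: "g + h - g = cm g h + (h::'b::group_add)"
  by (simp only: cm_def group_simps)

lemma commute_minus: "g + h = h + g \<Longrightarrow> g + - h = - h + (g::'b::group_add)"
proof -
  assume "g + h = h + g"
  then have "- h + (g + h) + - h = - h + (h + g) + - h" by (simp only:)
  then show ?thesis by (simp only: group_simps)
qed

lemma conj_commute: "g + h = h + g \<Longrightarrow> g + h - g = (h::'b::group_add)"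
  by (metis add_diff_cancel)

section \<open>Type-preserving automorphisms and pointwise stabilisers of neighbourhoods\<close>

context hexagon
begin

text \<open>The last clause fixes the isolated vertices, so that an automorphism acting trivially on
  the geometry equals \<open>0\<close>.\<close>

definition aut :: "'a bijection set" where
  "aut = {g. (\<forall>x y. adj (g \<cdot> x) (g \<cdot> y) \<longleftrightarrow> adj x y) \<and>
             (\<forall>x y. adj x y \<longrightarrow> (pt (g \<cdot> x) \<longleftrightarrow> pt x)) \<and>
             (\<forall>x. (\<forall>y. \<not> adj x y) \<longrightarrow> g \<cdot> x = x)}"

lemma aut_adj [simp]: "g \<in> aut \<Longrightarrow> adj (g \<cdot> x) (g \<cdot> y) \<longleftrightarrow> adj x y"
  unfolding aut_def by blast

lemma aut_pt: "g \<in> aut \<Longrightarrow> adj x y \<Longrightarrow> pt (g \<cdot> x) \<longleftrightarrow> pt x"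
  unfolding aut_def by blast

lemma aut_isolated: "g \<in> aut \<Longrightarrow> \<forall>y. \<not> adj x y \<Longrightarrow> g \<cdot> x = x"
  unfolding aut_def by blast

lemma autI:
  "(\<And>x y. adj (g \<cdot> x) (g \<cdot> y) \<longleftrightarrow> adj x y) \<Longrightarrow> (\<And>x y. adj x y \<Longrightarrow> pt (g \<cdot> x) \<longleftrightarrow> pt x) \<Longrightarrow>
   (\<And>x. \<forall>y. \<not> adj x y \<Longrightarrow> g \<cdot> x = x) \<Longrightarrow> g \<in> aut"
  unfolding aut_def by blast

lemma aut_0 [simp]: "0 \<in> aut"
  by (rule autI) simp_all

lemma aut_add [simp]: "g \<in> aut \<Longrightarrow> h \<in> aut \<Longrightarrow> g + h \<in> aut"
proof -
  assume g: "g \<in> aut" and h: "h \<in> aut"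
  have "pt (g \<cdot> h \<cdot> x) \<longleftrightarrow> pt x" if "adj x y" for x y
    using aut_pt[OF g, of "h \<cdot> x" "h \<cdot> y"] aut_pt[OF h that] h that by simp
  moreover have "g \<cdot> h \<cdot> x = x" if "\<forall>y. \<not> adj x y" for x
    using aut_isolated[OF g that] aut_isolated[OF h that] by simp
  ultimately show ?thesis using g h by (intro autI) simp_all
qed

lemma aut_minus [simp]: "g \<in> aut \<Longrightarrow> - g \<in> aut"
proof -
  assume g: "g \<in> aut"
  have a: "adj ((- g) \<cdot> x) ((- g) \<cdot> y) \<longleftrightarrow> adj x y" for x y
    using aut_adj[OF g, of "(- g) \<cdot> x" "(- g) \<cdot> y"] by simp
  have "pt ((- g) \<cdot> x) \<longleftrightarrow> pt x" if "adj x y" for x y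
    using aut_pt[OF g, of "(- g) \<cdot> x" "(- g) \<cdot> y"] that a by simp
  moreover have "(- g) \<cdot> x = x" if "\<forall>y. \<not> adj x y" for x
    using aut_isolated[OF g that] by (simp add: ap_minus_eq)
  ultimately show ?thesis using a by (intro autI) blast+
qed

lemma aut_diff [simp]: "g \<in> aut \<Longrightarrow> h \<in> aut \<Longrightarrow> g - h \<in> aut"
  by (simp only: diff_conv_add_uminus aut_add aut_minus)

lemma aut_adj_minus: "g \<in> aut \<Longrightarrow> adj ((- g) \<cdot> x) y \<longleftrightarrow> adj x (g \<cdot> y)"
  using aut_adj[of g "(- g) \<cdot> x" y] by simp

lemma path_aut [simp]: "g \<in> aut \<Longrightarrow> path (map (ap g) xs) \<longleftrightarrow> path xs"
proof (induction xs rule: induct_list012)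
  case (3 x y zs)
  then show ?case by (cases zs) auto
qed simp_all

lemma dst_aut: "g \<in> aut \<Longrightarrow> dst n x y \<Longrightarrow> dst n (g \<cdot> x) (g \<cdot> y)"
  unfolding dst_def
  by (metis hd_map last_map length_0_conv length_map nat.distinct(1) path_aut)

lemma apt_aut: "g \<in> aut \<Longrightarrow> apt v \<Longrightarrow> apt (\<lambda>i. g \<cdot> v i)"
  unfolding apt_def by simp

text \<open>
  \<open>K x\<close> and \<open>N x\<close> fix all elements at distance at most 1 and 2 from \<open>x\<close>, respectively. An apartment
  \<open>v\<close> is indexed by the integers modulo 12, and \<open>U v i\<close> below is the group of root elations of the
  path \<open>v i, \<dots>, v (i + 6)\<close>.
\<close>

definition K :: "'a \<Rightarrow> 'a bijection set" where
  "K x = {g \<in> aut. g \<cdot> x = x \<and> (\<forall>y. adj x y \<longrightarrow> g \<cdot> y = y)}"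

definition N :: "'a \<Rightarrow> 'a bijection set" where
  "N x = {g \<in> K x. \<forall>y. adj x y \<longrightarrow> g \<in> K y}"

lemma K_aut: "g \<in> K x \<Longrightarrow> g \<in> aut"
  and K_fix: "g \<in> K x \<Longrightarrow> g \<cdot> x = x"
  and K_adj: "g \<in> K x \<Longrightarrow> adj x y \<Longrightarrow> g \<cdot> y = y"
  by (auto simp: K_def)

lemma K_0 [simp]: "0 \<in> K x"
  and K_add [simp]: "g \<in> K x \<Longrightarrow> h \<in> K x \<Longrightarrow> g + h \<in> K x"
  and K_minus [simp]: "g \<in> K x \<Longrightarrow> - g \<in> K x"
  by (auto simp: K_def ap_minus_eq)

lemma K_diff [simp]: "g \<in> K x \<Longrightarrow> h \<in> K x \<Longrightarrow> g - h \<in> K x"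
  by (simp only: diff_conv_add_uminus K_add K_minus)

lemma N_K: "g \<in> N x \<Longrightarrow> g \<in> K x"
  and N_adj: "g \<in> N x \<Longrightarrow> adj x y \<Longrightarrow> g \<in> K y"
  by (auto simp: N_def)

lemma N_add [simp]: "g \<in> N x \<Longrightarrow> h \<in> N x \<Longrightarrow> g + h \<in> N x"
  and N_minus [simp]: "g \<in> N x \<Longrightarrow> - g \<in> N x"
  by (auto simp: N_def)

lemma K_conj:
  assumes "g \<in> aut" "h \<in> K x" shows "g + h - g \<in> K (g \<cdot> x)"
proof -
  have "(g + h - g) \<cdot> y = y" if "adj (g \<cdot> x) y" for y
  proof -
    have "adj x ((- g) \<cdot> y)" using that aut_adj_minus[OF assms(1), of y x] adj_comm by blast
    then show ?thesis using K_adj[OF assms(2)] by simp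
  qed
  then show ?thesis using assms K_aut[OF assms(2)] K_fix[OF assms(2)] by (simp add: K_def)
qed

lemma N_conj:
  assumes "g \<in> aut" "h \<in> N x" shows "g + h - g \<in> N (g \<cdot> x)"
proof -
  have "g + h - g \<in> K y" if "adj (g \<cdot> x) y" for y
  proof -
    have "adj x ((- g) \<cdot> y)" using that aut_adj_minus[OF assms(1), of y x] adj_comm by blast
    then show ?thesis using K_conj[OF assms(1) N_adj[OF assms(2)]] by fastforce
  qed
  then show ?thesis using K_conj[OF assms(1) N_K[OF assms(2)]] by (simp add: N_def)
qed

lemma K_conj': "g \<in> aut \<Longrightarrow> h \<in> K x \<Longrightarrow> g \<cdot> x = y \<Longrightarrow> g + h - g \<in> K y"
  and N_conj': "g \<in> aut \<Longrightarrow> h \<in> N x \<Longrightarrow> g \<cdot> x = y \<Longrightarrow> g + h - g \<in> N y"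
  using K_conj N_conj by blast+

text \<open>\<open>K x\<close> is normal in the stabiliser of \<open>x\<close>: the commutator is
  the sum of \<open>g\<close> and a conjugate of \<open>- g\<close>.\<close>

lemma K_cm: "g \<in> K x \<Longrightarrow> h \<in> aut \<Longrightarrow> h \<cdot> x = x \<Longrightarrow> cm g h \<in> K x"
proof -
  assume a: "g \<in> K x" "h \<in> aut" "h \<cdot> x = x"
  have "g + (h + - g - h) \<in> K x"
    using K_add[OF a(1) K_conj'[OF a(2) K_minus[OF a(1)] a(3)]] .
  then show ?thesis by (simp only: cm_def group_simps)
qed

lemma N_cm: "g \<in> N x \<Longrightarrow> h \<in> aut \<Longrightarrow> h \<cdot> x = x \<Longrightarrow> cm g h \<in> N x"
proof -
  assume a: "g \<in> N x" "h \<in> aut" "h \<cdot> x = x"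
  have "g + (h + - g - h) \<in> N x"
    using N_add[OF a(1) N_conj'[OF a(2) N_minus[OF a(1)] a(3)]] .
  then show ?thesis by (simp only: cm_def group_simps)
qed

lemma K_cm': "h \<in> K x \<Longrightarrow> g \<in> aut \<Longrightarrow> g \<cdot> x = x \<Longrightarrow> cm g h \<in> K x"
  using K_cm[of h x g] cm_swap[of g h] K_minus by metis

lemma N_cm': "h \<in> N x \<Longrightarrow> g \<in> aut \<Longrightarrow> g \<cdot> x = x \<Longrightarrow> cm g h \<in> N x"
  using N_cm[of h x g] cm_swap[of g h] N_minus by metis

section \<open>Rigidity of automorphisms fixing an apartment\<close>

lemma fixed_apt:
  assumes "g \<in> aut" "apt v" "\<And>k. k \<in> {0..7} \<Longrightarrow> g \<cdot> v (m + k) = v (m + k)"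
  shows "g \<cdot> v i = v i"
proof -
  have "(\<lambda>i. g \<cdot> v (i + m)) = (\<lambda>i. v (i + m))"
    by (rule apt_unique[OF apt_aut[OF assms(1) apt_shift[OF assms(2)]] apt_shift[OF assms(2)]])
      (use assms(3) in \<open>simp add: add.commute\<close>)
  then have "g \<cdot> v ((i - m) + m) = v ((i - m) + m)" by metis
  then show ?thesis by simp
qed

text \<open>Projection matches the neighbours of opposite elements. A neighbour \<open>y\<close> of
  \<open>u 6\<close> lies on the unique path of five steps from a neighbour \<open>w 11\<close> of
  \<open>u 0\<close> to \<open>u 6\<close>, and both ends of it are fixed.\<close>

lemma K_opposite:
  assumes g: "g \<in> aut" and v: "apt v" and f: "\<And>i. g \<cdot> v i = v i" and k: "g \<in> K (v m)"
  shows "g \<in> K (v (m + 6))"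
proof -
  define u where "u = (\<lambda>i. v (i + m))"
  have u: "apt u" using v apt_shift u_def by simp
  note ua = apt_adj[OF u]
  have fu: "g \<cdot> u i = u i" for i by (simp add: u_def f)
  have "g \<cdot> y = y" if y: "adj (u 6) y" for y
  proof (cases "y = u 5")
    case False
    have "path [u 0, u 1, u 2, u 3, u 4, u 5, u 6, y]"
      using y False by (simp add: ua)
    from apt_exists_7[OF this] obtain w where w: "apt w" "w 0 = u 0" "w 6 = u 6" "w 7 = y"
      by blast
    note wa = apt_adj[OF w(1)]
    have p: "path [w 11, w 10, w 9, w 8, w 7, w 6]" by (simp add: wa)
    have w11: "g \<cdot> w 11 = w 11"
    proof -
      have "adj (w 12) (w 11)" by (simp add: wa)
      then have "adj (u 0) (w 11)" using apt_period[OF w(1), of 12 0] w(2) by simp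
      then show ?thesis using K_adj[OF k] by (simp add: u_def)
    qed
    have "path (map (ap g) [w 11, w 10, w 9, w 8, w 7, w 6])" using p path_aut[OF g] by blast
    then have "map (ap g) [w 11, w 10, w 9, w 8, w 7, w 6] = [w 11, w 10, w 9, w 8, w 7, w 6]"
      by (rule path_unique[OF _ p]) (use w11 w(3) fu in simp_all)
    then show ?thesis using w by simp
  qed (use fu in simp)
  then show ?thesis using g fu[of 6] by (simp add: K_def u_def add.commute)
qed

text \<open>\<open>K (v 0)\<close> passes to the opposite element \<open>v 6\<close>. Replacing
  \<open>v 0\<close> by \<open>w\<close> gives another fixed apartment in which \<open>v 6\<close>
  is opposite to \<open>w\<close>, so the property passes on to \<open>w\<close>.\<close>

lemma K_step_aux:
  assumes g: "g \<in> aut" and v: "apt v" and f: "\<And>i. g \<cdot> v i = v i"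
    and k: "g \<in> K (v 0)" "g \<in> K (v 1)" and w: "adj (v 1) w" "w \<noteq> v 2"
  shows "g \<in> K w"
proof -
  note va = apt_adj[OF v]
  have "path [w, v 1, v 2, v 3, v 4, v 5, v 6, v 7]" using w adj_sym by (simp add: va)
  from apt_exists_7[OF this] obtain u where u: "apt u" "u 0 = w" "u 1 = v 1" "u 2 = v 2"
    "u 3 = v 3" "u 4 = v 4" "u 5 = v 5" "u 6 = v 6" "u 7 = v 7" by blast
  have "g \<cdot> u i = u i" if "i \<in> {0..7}" for i
    using int_0_7[OF that] u f K_adj[OF k(2) w(1)] by auto
  then have fu: "g \<cdot> u i = u i" for i using fixed_apt[OF g u(1), of 0] by simp
  have "g \<in> K (v (0 + 6))" using K_opposite[OF g v f k(1)] .
  then have "g \<in> K (u 6)" using u by simp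
  then have "g \<in> K (u (6 + 6))" by (rule K_opposite[OF g u(1) fu])
  then show ?thesis using apt_period[OF u(1), of 12 0] u by simp
qed

lemma fixed_path:
  assumes "g \<in> aut" "path [x0, x1, x2, x3, x4, x5, x6, x7]"
    "\<forall>x\<in>set [x0, x1, x2, x3, x4, x5, x6, x7]. g \<cdot> x = x"
  shows "\<exists>v. apt v \<and> v 0 = x0 \<and> v 1 = x1 \<and> v 2 = x2 \<and> (\<forall>i. g \<cdot> v i = v i)"
proof -
  obtain v where v: "apt v" "v 0 = x0" "v 1 = x1" "v 2 = x2" "v 3 = x3" "v 4 = x4" "v 5 = x5"
    "v 6 = x6" "v 7 = x7" using apt_exists_7[OF assms(2)] by blast
  have "g \<cdot> v i = v i" if "i \<in> {0..7}" for i
    using int_0_7[OF that] v assms(3) by auto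
  then have "g \<cdot> v i = v i" for i using fixed_apt[OF assms(1) v(1), of 0] by simp
  then show ?thesis using v by blast
qed

lemma K_step:
  assumes g: "g \<in> aut" and v: "apt v" and f: "\<And>i. g \<cdot> v i = v i"
    and k: "g \<in> K (v 0)" "g \<in> K (v 1)" and w: "adj (v 1) w"
  shows "g \<in> K w"
proof (cases "w = v 2")
  case True
  note va = apt_adj[OF v]
  \<comment> \<open>The previous lemma misses only \<open>v 2\<close>. An apartment through
    \<open>v 0\<close>, \<open>v 1\<close> and a third neighbour \<open>z\<close> of
    \<open>v 1\<close> gives the exceptional place to \<open>z\<close>.\<close>
  have "adj (v 1) (v 0)" by (simp add: va)
  obtain z where z: "adj (v 1) z" "z \<noteq> v 0" "z \<noteq> v 2"
    using thick_adj[of "v 1" "v 0"] \<open>adj (v 1) (v 0)\<close> by metis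
  have p: "path [z, v 1, v 0, v (-1), v (-2), v (-3), v (-4), v (-5)]"
    using z adj_sym by (simp add: va)
  obtain u where u: "apt u" "u 0 = z" "u 1 = v 1" "u 2 = v 0" "\<forall>i. g \<cdot> u i = u i"
    using fixed_path[OF g p] f K_adj[OF k(2) z(1)] by auto
  have "g \<in> K w"
  proof (rule K_step_aux[OF g apt_reflect[OF u(1), of 2]])
    show "w \<noteq> u (2 - 2)" using True z u by simp
  qed (use u k w in auto)
  then show ?thesis .
qed (use K_step_aux assms in blast)

text \<open>The situation is inherited by every neighbour: \<open>good y\<close> places
  \<open>y\<close> next to another element of a fixed apartment, with \<open>g\<close> in
  \<open>K\<close> of both. Connectedness of the graph does the rest.\<close>

lemma rigid_apt:
  assumes g: "g \<in> aut" and v: "apt v" and f: "\<And>i. g \<cdot> v i = v i"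
    and k: "g \<in> K (v 0)" "g \<in> K (v 1)"
  shows "g = 0"
proof -
  define good where "good y \<longleftrightarrow> (\<exists>v. apt v \<and> (\<forall>i. g \<cdot> v i = v i) \<and> g \<in> K (v 0) \<and> g \<in> K (v 1) \<and> v 1 = y)" for y
  have step: "good w" if "good y" "adj y w" for y w
  proof -
    from that(1)[unfolded good_def] obtain v where v: "apt v" "\<forall>i. g \<cdot> v i = v i"
      "g \<in> K (v 0)" "g \<in> K (v 1)" "v 1 = y"
      by (elim exE conjE)
    note va = apt_adj[OF v(1)]
    have kw: "g \<in> K w" using K_step[OF g v(1)] v that(2) by blast
    show ?thesis
    proof (cases "w = v 0")
      case True
      then show ?thesis unfolding good_def
        by (intro exI[of _ "\<lambda>i. v (1 - i)"]) (use v apt_reflect[OF v(1)] in auto)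
    next
      case False
      have p: "path [w, v 1, v 0, v (-1), v (-2), v (-3), v (-4), v (-5)]"
        using False that(2)[folded v(5)] adj_sym by (simp add: va)
      obtain u where u: "apt u" "u 0 = w" "u 1 = v 1" "u 2 = v 0" "\<forall>i. g \<cdot> u i = u i"
        using fixed_path[OF g p] v kw K_fix by auto
      show ?thesis unfolding good_def
        by (intro exI[of _ "\<lambda>i. u (1 - i)"]) (use v u kw apt_reflect[OF u(1)] in auto)
    qed
  qed
  have walk: "path xs \<Longrightarrow> good (hd xs) \<Longrightarrow> good (last xs)" for xs
  proof (induction xs rule: induct_list012)
    case (3 x y zs)
    have "adj x y" "path (y # zs)" using 3(3) by (cases zs; auto)+
    then show ?case using 3(2,4) step[of x y] by simp
  qed simp_all
  have "good (v 1)" unfolding good_def using v f k by blast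
  have "g \<cdot> x = x" for x
  proof (cases "\<exists>y. adj x y")
    case True
    have "adj (v 1) (v 2)" by (simp add: apt_adj[OF v])
    then obtain xs where "path xs" "hd xs = v 1" "last xs = x"
      using diameter True by metis
    then have "good x" using walk \<open>good (v 1)\<close> by metis
    then show ?thesis unfolding good_def using K_fix by blast
  next
    case False
    then show ?thesis using aut_isolated[OF g] by blast
  qed
  then show ?thesis by (intro bijection_eqI) simp
qed

lemma rigid:
  assumes g: "g \<in> aut" and v: "apt v"
    and f: "g \<cdot> v m = v m" "g \<cdot> v (m+1) = v (m+1)" "g \<cdot> v (m+2) = v (m+2)" "g \<cdot> v (m+3) = v (m+3)"
      "g \<cdot> v (m+4) = v (m+4)" "g \<cdot> v (m+5) = v (m+5)" "g \<cdot> v (m+6) = v (m+6)" "g \<cdot> v (m+7) = v (m+7)"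
    and k: "g \<in> K (v j)" "g \<in> K (v (j+1))"
  shows "g = 0"
proof -
  have "g \<cdot> v (m + i) = v (m + i)" if "i \<in> {0..7}" for i
    using int_0_7[OF that] f by auto
  then have "g \<cdot> v i = v i" for i using fixed_apt[OF g v] by blast
  then show ?thesis using rigid_apt[OF g apt_shift[OF v, of j]] k by (simp add: add.commute)
qed

lemma K_apt_fix:
  assumes "apt v" "g \<in> K (v i)"
  shows "j = i \<or> j = i + 1 \<or> i = j + 1 \<Longrightarrow> g \<cdot> v j = v j"
  using K_adj[OF assms(2), of "v j"] K_fix[OF assms(2)] apt_adj(1,2)[OF assms(1), where i = i and j = j]
  by auto

text \<open>The six neighbourhoods contain eight consecutive elements of the apartment, enough to
  fix all of it. Most relations between root elations below are proved by exhibiting six consecutive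
  \<open>K\<close>.\<close>

lemma rigid6:
  assumes v: "apt v"
    and k: "g \<in> K (v (m+1))" "g \<in> K (v (m+2))" "g \<in> K (v (m+3))" "g \<in> K (v (m+4))"
      "g \<in> K (v (m+5))" "g \<in> K (v (m+6))"
  shows "g = 0"
  by (rule rigid[OF K_aut[OF k(1)] v, of m "m + 1"])
    (use k K_apt_fix[OF v k(1)] K_apt_fix[OF v k(6)] K_fix in \<open>auto simp: add.assoc\<close>)

definition U :: "(int \<Rightarrow> 'a) \<Rightarrow> int \<Rightarrow> 'a bijection set" where
  "U v i = {g. g \<in> K (v (i+1)) \<and> g \<in> K (v (i+2)) \<and> g \<in> K (v (i+3)) \<and> g \<in> K (v (i+4)) \<and> g \<in> K (v (i+5))}"

lemma U_aut: "g \<in> U v i \<Longrightarrow> g \<in> aut"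
  using K_aut unfolding U_def by blast

lemma U_0 [simp]: "0 \<in> U v i"
  and U_add [simp]: "g \<in> U v i \<Longrightarrow> h \<in> U v i \<Longrightarrow> g + h \<in> U v i"
  and U_minus [simp]: "g \<in> U v i \<Longrightarrow> - g \<in> U v i"
  unfolding U_def by auto

lemma U_diff [simp]: "g \<in> U v i \<Longrightarrow> h \<in> U v i \<Longrightarrow> g - h \<in> U v i"
  by (simp only: diff_conv_add_uminus U_add U_minus)

lemma U_K: "g \<in> U v i \<Longrightarrow> k = i+1 \<or> k = i+2 \<or> k = i+3 \<or> k = i+4 \<or> k = i+5 \<Longrightarrow> g \<in> K (v k)"
  unfolding U_def by auto

lemma U_fix:
  assumes "apt v" "g \<in> U v i" "i \<le> k" "k \<le> i + 6"
  shows "g \<cdot> v k = v k"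
proof -
  have "k = i \<or> k = i+1 \<or> k = i+2 \<or> k = i+3 \<or> k = i+4 \<or> k = i+5 \<or> k = i+6"
    using assms(3,4) by arith
  then show ?thesis
    using assms(1,2) K_apt_fix[OF assms(1), of g "i+1" i] K_apt_fix[OF assms(1), of g "i+5" "i+6"]
      K_fix unfolding U_def by auto
qed

lemma U_free:
  assumes "apt v" "g \<in> U v i" "g \<cdot> v k = v k" "k = i - 1 \<or> k = i + 7"
  shows "g = 0"
proof -
  note f = U_fix[OF assms(1,2)]
  from assms(4) show ?thesis
  proof
    assume "k = i - 1"
    then show ?thesis
      by (intro rigid[OF U_aut[OF assms(2)] assms(1), of "i - 1" "i + 1"])
        (use assms(2,3) f in \<open>auto simp: U_def add.assoc\<close>)
  next
    assume "k = i + 7"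
    then show ?thesis
      by (intro rigid[OF U_aut[OF assms(2)] assms(1), of i "i + 1"])
        (use assms(2,3) f in \<open>auto simp: U_def add.assoc\<close>)
  qed
qed

end

section \<open>Root groups\<close>

definition com :: "'b::group_add \<Rightarrow> 'b \<Rightarrow> bool" where "com g h \<longleftrightarrow> g + h = h + g"

lemma com_sym: "com g h \<Longrightarrow> com h g"
  by (simp add: com_def)

lemma com_add: "com g h \<Longrightarrow> com g k \<Longrightarrow> com g (h + k)"
  unfolding com_def by (metis add.assoc)

lemma com_minus: "com g h \<Longrightarrow> com g (- h)"
  unfolding com_def by (rule commute_minus)

lemma com_cm: "com g h \<Longrightarrow> com g k \<Longrightarrow> com g (cm h k)"
  unfolding cm_def by (simp only: diff_conv_add_uminus com_add com_minus)

lemma com_iff_cm: "com g h \<longleftrightarrow> cm g h = 0"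
  by (simp only: com_def cm_eq_0)

lemma com_conj: "com g h \<Longrightarrow> g + h - g = h"
  unfolding com_def by (rule conj_commute)

text \<open>Conjugation by \<open>a\<close> multiplies \<open>b\<close> and \<open>b'\<close> by
  \<open>c\<close> and \<open>c'\<close>. These are central in the group generated by
  \<open>b\<close>, \<open>b'\<close>, \<open>c\<close>, \<open>c'\<close>, so they do not affect
  the commutator.\<close>

lemma com_cm_of_bilinear:
  assumes "com (cm a b) b" "com (cm a b) b'" "com (cm a b') b" "com (cm a b') b'"
    "com (cm a b) (cm a b')"
  shows "com a (cm b (b'::'b::group_add))"
proof -
  define c c' where c: "c = cm a b" and c': "c' = cm a b'"
  have cc: "com (c + c') (cm b b')"
    by (intro com_sym[OF com_add] com_sym[OF com_cm]) (use assms c c' in auto)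
  have "(c + b) + (c' + b') = (c + c') + (b + b')"
    using assms(3) unfolding c[symmetric] c'[symmetric] com_def by (metis add.assoc)
  moreover have "(c' + b') + (c + b) = (c + c') + (b' + b)"
    using assms(2,5) unfolding c[symmetric] c'[symmetric] com_def by (metis add.assoc)
  moreover have "cm (c + b) (c' + b') = ((c + b) + (c' + b')) - ((c' + b') + (c + b))"
    by (simp only: cm_def group_simps)
  ultimately have "cm (c + b) (c' + b') = ((c + c') + (b + b')) - ((c + c') + (b' + b))"
    by simp
  also have "\<dots> = (c + c') + cm b b' - (c + c')"
    by (simp only: cm_def group_simps)
  also have "\<dots> = cm b b'" by (rule com_conj[OF cc])
  finally have e: "cm (c + b) (c' + b') = cm b b'" .
  have "a + cm b b' - a = cm (a + b - a) (a + b' - a)" by (rule cm_conj)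
  also have "\<dots> = cm (c + b) (c' + b')" by (simp only: conj_eq_cm c c')
  finally have "a + cm b b' - a = cm b b'" using e by simp
  then show ?thesis unfolding com_def by (metis diff_add_cancel)
qed

text \<open>Under these hypotheses the commutator is additive in each argument. Expanding
  \<open>cm (a + a') (b + b')\<close> first on the left or first on the right lists the same four
  terms with the two middle ones exchanged.\<close>

lemma cm_values_commute:
  assumes "\<And>x y u. x \<in> {a, a'} \<Longrightarrow> y \<in> {b, b'} \<Longrightarrow> u \<in> {a, a', b, b'} \<Longrightarrow> com u (cm x y)"
  shows "com (cm a b) (cm a' (b'::'b::group_add))"
proof -
  define p q r s where d: "p = cm a b" "q = cm a b'" "r = cm a' b" "s = cm a' b'"
  have com: "com a r" "com a s" "com b q" "com b s"
    using assms by (simp_all add: d)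
  have "cm (a + a') (b + b') = a + cm a' (b + b') - a + cm a (b + b')"
    by (rule cm_add_left)
  also have "cm a' (b + b') = r + s"
    using com_conj[OF com(4)] by (simp only: cm_add_right d)
  also have "cm a (b + b') = p + q"
    using com_conj[OF com(3)] by (simp only: cm_add_right d)
  also have "a + (r + s) - a = r + s"
    by (rule com_conj[OF com_add[OF com(1,2)]])
  finally have 1: "cm (a + a') (b + b') = r + s + (p + q)" .
  have "cm (a + a') (b + b') = cm (a + a') b + (b + cm (a + a') b' - b)"
    by (rule cm_add_right)
  also have "cm (a + a') b = r + p"
    using com_conj[OF com(1)] by (simp only: cm_add_left d)
  also have "cm (a + a') b' = s + q"
    using com_conj[OF com(2)] by (simp only: cm_add_left d)
  also have "b + (s + q) - b = s + q"
    by (rule com_conj[OF com_add[OF com(4,3)]])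
  finally have "r + (s + p) + q = r + (p + s) + q"
    using 1 by (simp add: add.assoc)
  then have "s + p = p + s" by simp
  then show ?thesis by (simp add: com_def d)
qed

text \<open>Transitivity on the neighbours of \<open>x6\<close> stands for transitivity on hexagons,
  because a path of seven steps lies in exactly one apartment.\<close>

locale moufang_hexagon = hexagon +
  assumes moufang: "walk adj [x0, x1, x2, x3, x4, x5, x6] \<Longrightarrow>
    adj x6 n \<Longrightarrow> adj x6 n' \<Longrightarrow> n \<noteq> x5 \<Longrightarrow> n' \<noteq> x5 \<Longrightarrow>
    \<exists>g. g \<in> hexagon.K adj pt x1 \<and> g \<in> hexagon.K adj pt x2 \<and> g \<in> hexagon.K adj pt x3 \<and>
      g \<in> hexagon.K adj pt x4 \<and> g \<in> hexagon.K adj pt x5 \<and> g \<cdot> n = n'"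
begin

section \<open>Root groups of an apartment: transitivity and commutator relations\<close>

lemma U_reflect: "U (\<lambda>i. v (c - i)) j = U v (c - j - 6)"
  unfolding U_def by (auto simp: algebra_simps)

lemma U_shift: "U (\<lambda>i. v (i + c)) j = U v (j + c)"
  unfolding U_def by (auto simp: algebra_simps)

lemma U_transR:
  assumes "apt v" "adj (v (i+6)) n" "n \<noteq> v (i+5)" "adj (v (i+6)) n'" "n' \<noteq> v (i+5)"
  shows "\<exists>g\<in>U v i. g \<cdot> n = n'"
proof -
  have "path [v i, v (i+1), v (i+2), v (i+3), v (i+4), v (i+5), v (i+6)]"
    by (simp add: apt_adj[OF assms(1)])
  from moufang[OF this] show ?thesis using assms unfolding U_def by blast
qed

lemma U_transL:
  assumes "apt v" "adj (v i) n" "n \<noteq> v (i+1)" "adj (v i) n'" "n' \<noteq> v (i+1)"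
  shows "\<exists>g\<in>U v i. g \<cdot> n = n'"
proof -
  have "path [v (i+6), v (i+5), v (i+4), v (i+3), v (i+2), v (i+1), v i]"
    by (simp add: apt_adj[OF assms(1)])
  from moufang[OF this] show ?thesis using assms unfolding U_def by blast
qed

lemma U_nontrivial:
  assumes v: "apt v" shows "\<exists>g\<in>U v i. g \<noteq> 0"
proof -
  have a: "adj (v i) (v (i + 1))" "adj (v i) (v (i - 1))" "v (i - 1) \<noteq> v (i + 1)"
    by (simp_all add: apt_adj[OF v])
  then obtain z where z: "adj (v i) z" "z \<noteq> v (i + 1)" "z \<noteq> v (i - 1)"
    using thick_adj[OF a(1)] by metis
  obtain g where "g \<in> U v i" "g \<cdot> v (i - 1) = z"
    using U_transL[OF v a(2,3) z(1,2)] by blast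
  then show ?thesis using z by (intro bexI[of _ g]) auto
qed

text \<open>In this range both elations fix \<open>v k\<close> and at least one of them is in
  \<open>K (v k)\<close>: \<open>h\<close> if \<open>k = i + 6\<close>, and \<open>g\<close>
  otherwise.\<close>

lemma U_cm_K:
  assumes "apt v" "g \<in> U v i" "h \<in> U v j" "i < j" "j \<le> i + 5" "j \<le> k" "k \<le> i + 6"
  shows "cm g h \<in> K (v k)"
proof (cases "k = i + 6")
  case True
  have "k = j+1 \<or> k = j+2 \<or> k = j+3 \<or> k = j+4 \<or> k = j+5" using True assms by arith
  then show ?thesis
    using assms by (intro K_cm' U_K U_aut U_fix[OF assms(1,2)]) auto
next
  case False
  have "k = i+1 \<or> k = i+2 \<or> k = i+3 \<or> k = i+4 \<or> k = i+5" using False assms by arith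
  then show ?thesis
    using assms by (intro K_cm U_K U_aut U_fix[OF assms(1,3)]) auto
qed

lemma U_commute1:
  assumes "apt v" "g \<in> U v i" "h \<in> U v (i + 1)"
  shows "com g h"
  unfolding com_iff_cm
  by (rule rigid6[OF assms(1), of _ i]) (rule U_cm_K[OF assms], simp_all)+

lemma U_cm2:
  assumes "apt v" "g \<in> U v i" "h \<in> U v (i + 2)"
  shows "cm g h \<in> U v (i + 1)"
  unfolding U_def using U_cm_K[OF assms] by (simp add: add.assoc)

text \<open>\<open>U_cm_K\<close> covers the five indices from \<open>i + 2\<close> to
  \<open>i + 6\<close>; membership in \<open>N (v (i + 2))\<close> adds the sixth,
  \<open>i + 1\<close>.\<close>

lemma commute_N:
  assumes v: "apt v" and g: "g \<in> U v i" "g \<in> N (v (i + 2))" and h: "h \<in> U v (i + 2)"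
  shows "com g h"
proof -
  have "cm g h \<in> N (v (i + 2))"
    by (rule N_cm[OF g(2) U_aut[OF h]]) (rule U_fix[OF v h], simp_all)
  then have "cm g h \<in> K (v (i + 1))" by (rule N_adj) (simp add: apt_adj[OF v])
  then show ?thesis unfolding com_iff_cm
    by (rule rigid6[OF v, of _ i]) (rule U_cm_K[OF v g(1) h], simp_all)+
qed

lemma commute_N':
  assumes v: "apt v" and g: "g \<in> U v i" "g \<in> N (v (i + 4))" and h: "h \<in> U v (i - 2)"
  shows "com g h"
proof (rule commute_N[OF apt_reflect[OF v, of 0], of g "- i - 6"])
  show "g \<in> U (\<lambda>i. v (0 - i)) (- i - 6)" using g unfolding U_reflect by simp
  show "g \<in> N (v (0 - (- i - 6 + 2)))" using g by simp
  show "h \<in> U (\<lambda>i. v (0 - i)) (- i - 6 + 2)" using h unfolding U_reflect by simp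
qed

text \<open>Converse of \<open>commute_N\<close>: \<open>U v (i + 2)\<close> moves
  \<open>v (i + 1)\<close> to all neighbours of \<open>v (i + 2)\<close> except
  \<open>v (i + 3)\<close>, and conjugation by its elements leaves \<open>g\<close> unchanged. With
  the mirror image this describes \<open>Y v i\<close> below as the part of \<open>U v i\<close>
  that commutes with \<open>U v (i + 2)\<close> and \<open>U v (i - 2)\<close>.\<close>

lemma N_commute:
  assumes v: "apt v" and g: "g \<in> U v i" and c: "\<And>h. h \<in> U v (i + 2) \<Longrightarrow> com g h"
  shows "g \<in> N (v (i + 2))"
proof -
  have gK: "g \<in> K (v (i+1))" "g \<in> K (v (i+2))" "g \<in> K (v (i+3))" using g by (auto simp: U_def)
  have "g \<in> K y" if y: "adj (v (i + 2)) y" for y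
  proof (cases "y = v (i + 3)")
    case False
    obtain h where h: "h \<in> U v (i + 2)" "h \<cdot> v (i + 1) = y"
      using U_transL[OF v, of "i + 2" "v (i + 1)" y] y False apt_adj[OF v] by (auto simp: add.assoc)
    have "h + g - h \<in> K y" by (rule K_conj'[OF U_aut[OF h(1)] gK(1) h(2)])
    then show ?thesis using com_conj[OF com_sym[OF c[OF h(1)]]] by simp
  qed (use gK in simp)
  then show ?thesis using gK by (simp add: N_def)
qed

lemma N_commute':
  assumes v: "apt v" and g: "g \<in> U v i" and c: "\<And>h. h \<in> U v (i - 2) \<Longrightarrow> com g h"
  shows "g \<in> N (v (i + 4))"
proof -
  have "g \<in> N ((\<lambda>i. v (0 - i)) (- i - 6 + 2))"
  proof (rule N_commute[OF apt_reflect[OF v, of 0]])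
    show "g \<in> U (\<lambda>i. v (0 - i)) (- i - 6)" using g unfolding U_reflect by simp
    show "com g h" if "h \<in> U (\<lambda>i. v (0 - i)) (- i - 6 + 2)" for h
      using that c unfolding U_reflect by simp
  qed
  then show ?thesis by (simp add: add.commute)
qed

section \<open>Factorisation into root elations\<close>

lemma peelL:
  assumes v: "apt v" and x: "x \<in> aut" "x \<cdot> v i = v i" "x \<cdot> v (i+1) = v (i+1)"
  obtains h where "h \<in> U v i" "(- h + x) \<cdot> v (i - 1) = v (i - 1)"
proof -
  have "adj (x \<cdot> v i) (x \<cdot> v (i - 1))" "x \<cdot> v (i - 1) \<noteq> x \<cdot> v (i + 1)"
    using x(1) by (simp_all add: apt_adj[OF v])
  then have "\<exists>h\<in>U v i. h \<cdot> v (i - 1) = x \<cdot> v (i - 1)"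
    using x by (intro U_transL[OF v]) (auto simp: apt_adj[OF v])
  then show ?thesis using that by (auto simp: ap_minus_eq)
qed

lemma peelR:
  assumes v: "apt v" and x: "x \<in> aut" "x \<cdot> v (i+6) = v (i+6)" "x \<cdot> v (i+5) = v (i+5)"
  obtains h where "h \<in> U v i" "(- h + x) \<cdot> v (i + 7) = v (i + 7)"
proof -
  have "adj (x \<cdot> v (i + 6)) (x \<cdot> v (i + 7))" "x \<cdot> v (i + 7) \<noteq> x \<cdot> v (i + 5)"
    using x(1) by (simp_all add: apt_adj[OF v])
  then have "\<exists>h\<in>U v i. h \<cdot> v (i + 7) = x \<cdot> v (i + 7)"
    using x by (intro U_transR[OF v]) (auto simp: apt_adj[OF v])
  then show ?thesis using that by (auto simp: ap_minus_eq)
qed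

lemma U_fix_minus:
  "apt v \<Longrightarrow> h \<in> U v i \<Longrightarrow> i \<le> k \<Longrightarrow> k \<le> i + 6 \<Longrightarrow> x \<cdot> v k = v k \<Longrightarrow> (- h + x) \<cdot> v k = v k"
  using U_fix[of v h i k] by (simp add: ap_minus_eq)

lemma U_K_minus:
  "h \<in> U v i \<Longrightarrow> x \<in> K (v k) \<Longrightarrow> k = i+1 \<or> k = i+2 \<or> k = i+3 \<or> k = i+4 \<or> k = i+5 \<Longrightarrow>
   - h + x \<in> K (v k)"
  using U_K[of h v i k] by (intro K_add K_minus) auto

text \<open>Each factor split off makes one more element of the apartment fixed. The factors are
  chosen from root groups inside \<open>K (v 4)\<close> and \<open>K (v 5)\<close>, so that the
  remainder stays there and is trivial once eight consecutive elements are fixed.\<close>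

lemma K4567_decomp:
  assumes v: "apt v" and k: "x \<in> K (v 4)" "x \<in> K (v 5)" "x \<in> K (v 6)" "x \<in> K (v 7)"
  shows "\<exists>a\<in>U v 3. \<exists>b\<in>U v 2. x = a + b"
proof -
  have x: "x \<in> aut" "x \<cdot> v 3 = v 3" "x \<cdot> v 4 = v 4" "x \<cdot> v 5 = v 5" "x \<cdot> v 6 = v 6"
    "x \<cdot> v 7 = v 7" "x \<cdot> v 8 = v 8"
    using k K_aut K_apt_fix[OF v k(1)] K_apt_fix[OF v k(4)] K_fix by auto
  obtain h where h: "h \<in> U v 3" "(- h + x) \<cdot> v 2 = v 2" using peelL[OF v x(1), of 3] x by auto
  define x1 where "x1 = - h + x"
  have x1: "x1 \<in> aut" "x1 \<cdot> v 2 = v 2" "x1 \<cdot> v 3 = v 3" "x1 \<cdot> v 4 = v 4" "x1 \<cdot> v 5 = v 5"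
    "x1 \<cdot> v 6 = v 6" "x1 \<cdot> v 7 = v 7" "x1 \<cdot> v 8 = v 8" "x1 \<in> K (v 4)" "x1 \<in> K (v 5)"
    unfolding x1_def using h x k U_aut[OF h(1)] U_fix_minus[OF v h(1)] U_K_minus[OF h(1)]
    by (simp_all del: ap_add)
  obtain g where g: "g \<in> U v 2" "(- g + x1) \<cdot> v 9 = v 9" using peelR[OF v x1(1), of 2] x1 by auto
  have "- g + x1 = 0"
    by (rule rigid[OF _ v, of _ 2 4])
      (use g x1 U_aut[OF g(1)] U_fix_minus[OF v g(1)] U_K_minus[OF g(1)] in \<open>simp_all del: ap_add\<close>)
  then have "x1 = g" by (simp add: neg_eq_iff_add_eq_0 eq_neg_iff_add_eq_0 add_eq_0_iff)
  then have "x = h + g" unfolding x1_def by (metis add_minus_cancel)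
  then show ?thesis using g h by blast
qed

lemma K456_decomp:
  assumes v: "apt v" and k: "x \<in> K (v 4)" "x \<in> K (v 5)" "x \<in> K (v 6)"
  shows "\<exists>a\<in>U v 3. \<exists>b\<in>U v 2. \<exists>c\<in>U v 1. x = a + b + c"
proof -
  have x: "x \<in> aut" "x \<cdot> v 3 = v 3" "x \<cdot> v 4 = v 4" "x \<cdot> v 5 = v 5" "x \<cdot> v 6 = v 6"
    "x \<cdot> v 7 = v 7"
    using k K_aut K_apt_fix[OF v k(1)] K_apt_fix[OF v k(3)] K_fix by auto
  obtain h where h: "h \<in> U v 3" "(- h + x) \<cdot> v 2 = v 2" using peelL[OF v x(1), of 3] x by auto
  define x1 where "x1 = - h + x"
  have x1: "x1 \<in> aut" "x1 \<cdot> v 2 = v 2" "x1 \<cdot> v 3 = v 3" "x1 \<cdot> v 4 = v 4" "x1 \<cdot> v 5 = v 5"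
    "x1 \<cdot> v 6 = v 6" "x1 \<cdot> v 7 = v 7" "x1 \<in> K (v 4)" "x1 \<in> K (v 5)"
    unfolding x1_def using h x k U_aut[OF h(1)] U_fix_minus[OF v h(1)] U_K_minus[OF h(1)]
    by (simp_all del: ap_add)
  obtain g where g: "g \<in> U v 2" "(- g + x1) \<cdot> v 1 = v 1" using peelL[OF v x1(1), of 2] x1 by auto
  define x2 where "x2 = - g + x1"
  have x2: "x2 \<in> aut" "x2 \<cdot> v 1 = v 1" "x2 \<cdot> v 2 = v 2" "x2 \<cdot> v 3 = v 3" "x2 \<cdot> v 4 = v 4"
    "x2 \<cdot> v 5 = v 5" "x2 \<cdot> v 6 = v 6" "x2 \<cdot> v 7 = v 7" "x2 \<in> K (v 4)" "x2 \<in> K (v 5)"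
    unfolding x2_def using g x1 U_aut[OF g(1)] U_fix_minus[OF v g(1)] U_K_minus[OF g(1)]
    by (simp_all del: ap_add)
  obtain f where f: "f \<in> U v 1" "(- f + x2) \<cdot> v 8 = v 8" using peelR[OF v x2(1), of 1] x2 by auto
  have "- f + x2 = 0"
    by (rule rigid[OF _ v, of _ 1 4])
      (use f x2 U_aut[OF f(1)] U_fix_minus[OF v f(1)] U_K_minus[OF f(1)] in \<open>simp_all del: ap_add\<close>)
  then have "x2 = f" by (simp add: neg_eq_iff_add_eq_0 eq_neg_iff_add_eq_0 add_eq_0_iff)
  then have "x = h + g + f" unfolding x1_def x2_def by (metis add_minus_cancel add.assoc)
  then show ?thesis using f g h by blast
qed

lemma K67_decomp:
  assumes v: "apt v" and k: "x \<in> K (v 6)" "x \<in> K (v 7)"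
  shows "\<exists>a\<in>U v 5. \<exists>b\<in>K (v 5). x = a + b"
proof -
  have x: "x \<in> aut" "x \<cdot> v 5 = v 5" "x \<cdot> v 6 = v 6" "x \<cdot> v 7 = v 7" "x \<cdot> v 8 = v 8"
    using k K_aut K_apt_fix[OF v k(1)] K_apt_fix[OF v k(2)] K_fix by auto
  obtain e where e: "e \<in> U v 5" "(- e + x) \<cdot> v 4 = v 4" using peelL[OF v x(1), of 5] x by auto
  define x0 where "x0 = - e + x"
  have x0: "x0 \<in> aut" "x0 \<cdot> v 4 = v 4" "x0 \<cdot> v 5 = v 5" "x0 \<cdot> v 6 = v 6"
    "x0 \<cdot> v 7 = v 7" "x0 \<cdot> v 8 = v 8" "x0 \<in> K (v 6)" "x0 \<in> K (v 7)"
    unfolding x0_def using e x k U_aut[OF e(1)] U_fix_minus[OF v e(1)] U_K_minus[OF e(1)]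
    by (simp_all del: ap_add)
  obtain h where h: "h \<in> U v 4" "(- h + x0) \<cdot> v 3 = v 3" using peelL[OF v x0(1), of 4] x0 by auto
  define x1 where "x1 = - h + x0"
  have x1: "x1 \<in> aut" "x1 \<cdot> v 3 = v 3" "x1 \<cdot> v 4 = v 4" "x1 \<cdot> v 5 = v 5"
    "x1 \<cdot> v 6 = v 6" "x1 \<cdot> v 7 = v 7" "x1 \<cdot> v 8 = v 8" "x1 \<in> K (v 6)" "x1 \<in> K (v 7)"
    unfolding x1_def using h x0 U_aut[OF h(1)] U_fix_minus[OF v h(1)] U_K_minus[OF h(1)]
    by (simp_all del: ap_add)
  obtain g where g: "g \<in> U v 3" "(- g + x1) \<cdot> v 2 = v 2" using peelL[OF v x1(1), of 3] x1 by auto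
  define x2 where "x2 = - g + x1"
  have x2: "x2 \<in> aut" "x2 \<cdot> v 2 = v 2" "x2 \<cdot> v 3 = v 3" "x2 \<cdot> v 4 = v 4"
    "x2 \<cdot> v 5 = v 5" "x2 \<cdot> v 6 = v 6" "x2 \<cdot> v 7 = v 7" "x2 \<cdot> v 8 = v 8" "x2 \<in> K (v 6)" "x2 \<in> K (v 7)"
    unfolding x2_def using g x1 U_aut[OF g(1)] U_fix_minus[OF v g(1)] U_K_minus[OF g(1)]
    by (simp_all del: ap_add)
  obtain f where f: "f \<in> U v 2" "(- f + x2) \<cdot> v 9 = v 9" using peelR[OF v x2(1), of 2] x2 by auto
  have "- f + x2 = 0"
    by (rule rigid[OF _ v, of _ 2 6])
      (use f x2 U_aut[OF f(1)] U_fix_minus[OF v f(1)] U_K_minus[OF f(1)] in \<open>simp_all del: ap_add\<close>)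
  then have "x2 = f" by (simp add: neg_eq_iff_add_eq_0 eq_neg_iff_add_eq_0 add_eq_0_iff)
  then have "x = e + (h + g + f)" unfolding x0_def x1_def x2_def
    by (metis add_minus_cancel add.assoc)
  moreover have "h + g + f \<in> K (v 5)"
    using U_K[OF h(1), of 5] U_K[OF g(1), of 5] U_K[OF f(1), of 5] by simp
  ultimately show ?thesis using e by blast
qed


section \<open>Elations of second order and reflections of an apartment\<close>

definition Y :: "(int \<Rightarrow> 'a) \<Rightarrow> int \<Rightarrow> 'a bijection set" where
  "Y v i = {g. g \<in> N (v (i+2)) \<and> g \<in> N (v (i+4))}"

lemma Y_shift: "Y (\<lambda>i. v (i + c)) j = Y v (j + c)"
  unfolding Y_def by (auto simp: algebra_simps)

lemma Y_U: "apt v \<Longrightarrow> g \<in> Y v i \<Longrightarrow> g \<in> U v i"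
proof -
  assume v: "apt v" and g: "g \<in> Y v i"
  then have g: "g \<in> N (v (i+2))" "g \<in> N (v (i+4))" unfolding Y_def by auto
  show ?thesis unfolding U_def
    using N_K[OF g(1)] N_K[OF g(2)] N_adj[OF g(1)] N_adj[OF g(2)] by (simp add: apt_adj[OF v])
qed

lemma Y_minus [simp]: "g \<in> Y v i \<Longrightarrow> - g \<in> Y v i"
  unfolding Y_def by simp

lemma rigid_path:
  assumes g: "g \<in> aut" and p: "path [x0, x1, x2, x3, x4, x5, x6, x7]"
    and f: "\<forall>x\<in>set [x0, x1, x2, x3, x4, x5, x6, x7]. g \<cdot> x = x"
    and k: "g \<in> K x3" "g \<in> K x4"
  shows "g = 0"
proof -
  obtain v where v: "apt v" "v 0 = x0" "v 1 = x1" "v 2 = x2" "v 3 = x3" "v 4 = x4" "v 5 = x5"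
    "v 6 = x6" "v 7 = x7" using apt_exists_7[OF p] by blast
  show ?thesis by (rule rigid[OF g v(1), of 0 3]) (use v f k in simp_all)
qed

lemma apt_mod:
  assumes "apt v"
  shows "v 13 = v 1" "v 12 = v 0" "v (-5) = v 7" "v (-7) = v 5" "v (-1) = v 11" "v (-3) = v 9"
    "v (-2) = v 10" "v (-4) = v 8" "v (-6) = v 6" "v (-8) = v 4"
  using apt_period[OF assms, of 13 1] apt_period[OF assms, of 12 0] apt_period[OF assms, of 7 "-5"]
    apt_period[OF assms, of 5 "-7"] apt_period[OF assms, of 11 "-1"] apt_period[OF assms, of 9 "-3"]
    apt_period[OF assms, of 10 "-2"] apt_period[OF assms, of 8 "-4"] apt_period[OF assms, of 6 "-6"]
    apt_period[OF assms, of 4 "-8"]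
  by simp_all

text \<open>\<open>z''\<close> sends \<open>v 2\<close> to the preimage of \<open>v 0\<close> under
  \<open>z\<close>, and \<open>z'\<close> sends the image of \<open>v 0\<close> under
  \<open>z\<close> to \<open>v 2\<close>. So the product exchanges \<open>v 0\<close> and
  \<open>v 2\<close> while fixing \<open>v 1\<close> and \<open>v 7\<close>; uniqueness of paths of
  five steps determines it on the rest.\<close>

lemma reflection_exists:
  assumes v: "apt v" and z: "z \<in> U v 1" "z \<noteq> 0"
  shows "\<exists>z'\<in>U v 7. \<exists>z''\<in>U v 7. \<forall>i. (z' + z + z'') \<cdot> v i = v (2 - i)"
proof -
  note va = apt_adj[OF v]
  have zaut: "z \<in> aut" and z1: "z \<cdot> v 1 = v 1" and z7: "z \<cdot> v 7 = v 7"
    using U_aut[OF z(1)] U_fix[OF v z(1)] by auto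
  have z0: "z \<cdot> v 0 \<noteq> v 0" using U_free[OF v z(1), of 0] z(2) by auto
  have a: "adj (v 1) (z \<cdot> v 0)"
    using aut_adj[OF zaut, of "v 1" "v 0"] z1 by (simp add: va)
  have b: "adj (v 1) ((- z) \<cdot> v 0)"
    using aut_adj_minus[OF zaut, of "v 0" "v 1"] z1 adj_comm by (simp add: va)
  have c: "(- z) \<cdot> v 0 \<noteq> v 0" using z0 by (metis ap_minus_eq)
  have s: "\<exists>g\<in>U v 7. g \<cdot> n = n'" if "adj (v 1) n" "n \<noteq> v 0" "adj (v 1) n'" "n' \<noteq> v 0" for n n'
    using U_transR[OF v, of 7 n n'] that apt_mod[OF v] by simp
  obtain z'' where z'': "z'' \<in> U v 7" "z'' \<cdot> v 2 = (- z) \<cdot> v 0"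
    using s[OF _ _ b c, of "v 2"] by (auto simp: va)
  obtain z' where z': "z' \<in> U v 7" "z' \<cdot> z \<cdot> v 0 = v 2"
    using s[OF a z0, of "v 2"] by (auto simp: va)
  have f: "g \<cdot> v 0 = v 0 \<and> g \<cdot> v 1 = v 1 \<and> g \<cdot> v 7 = v 7" if "g \<in> U v 7" for g
    using U_fix[OF v that, of 12] U_fix[OF v that, of 13] U_fix[OF v that, of 7] apt_mod[OF v] by simp
  define m where "m = z' + z + z''"
  have m: "m \<in> aut" unfolding m_def using U_aut z' z'' zaut by simp
  have ma: "apt (\<lambda>i. m \<cdot> v i)" by (rule apt_aut[OF m v])
  have wa: "apt (\<lambda>i. v (2 - i))" by (rule apt_reflect[OF v])
  have m0: "m \<cdot> v 0 = v 2" "m \<cdot> v 1 = v 1" "m \<cdot> v 2 = v 0" "m \<cdot> v 7 = v 7"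
    unfolding m_def using f[OF z'(1)] f[OF z''(1)] z' z'' z1 z7 by simp_all
  have "[m \<cdot> v 2, m \<cdot> v 3, m \<cdot> v 4, m \<cdot> v 5, m \<cdot> v 6, m \<cdot> v 7] = [v 0, v (-1), v (-2), v (-3), v (-4), v (-5)]"
  proof (rule path_unique)
    show "path [m \<cdot> v 2, m \<cdot> v 3, m \<cdot> v 4, m \<cdot> v 5, m \<cdot> v 6, m \<cdot> v 7]"
      using m by (simp add: va)
    show "path [v 0, v (-1), v (-2), v (-3), v (-4), v (-5)]" by (simp add: va)
  qed (use m0 apt_mod[OF v] in simp_all)
  then have "m \<cdot> v i = v (2 - i)" if "i \<in> {0..7}" for i
  proof -
    assume e: "[m \<cdot> v 2, m \<cdot> v 3, m \<cdot> v 4, m \<cdot> v 5, m \<cdot> v 6, m \<cdot> v 7] = [v 0, v (-1), v (-2), v (-3), v (-4), v (-5)]"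
    have "i = 0 \<or> i = 1 \<or> i = 2 \<or> i = 3 \<or> i = 4 \<or> i = 5 \<or> i = 6 \<or> i = 7" using that by auto
    then show ?thesis using e m0 by auto
  qed
  then have "(\<lambda>i. m \<cdot> v i) = (\<lambda>i. v (2 - i))" using apt_unique[OF ma wa] by blast
  then have "\<forall>i. m \<cdot> v i = v (2 - i)" by metis
  then show ?thesis using z' z'' unfolding m_def by blast
qed

text \<open>The reflection \<open>m\<close> maps \<open>v 7\<close> to itself and \<open>v 9\<close>
  to \<open>v 5\<close>, so the conjugate of \<open>y\<close> is in \<open>Y v 3\<close>, as is
  \<open>w = cm z y\<close>. Written out it is \<open>k + w + y\<close> with
  \<open>k = cm z' w\<close>. Hence \<open>k + y\<close> is in \<open>U v 3\<close>, and it is also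
  in \<open>K (v 9)\<close>, so it vanishes.\<close>

lemma Y_reflection:
  assumes v: "apt v" and z: "z \<in> Y v 1" and z': "z' \<in> U v 7" and z'': "z'' \<in> U v 7"
    and r: "\<forall>i. (z' + z + z'') \<cdot> v i = v (2 - i)" and y: "y \<in> Y v 5"
  shows "cm z y \<in> Y v 3" "(z' + z + z'') + y - (z' + z + z'') = cm z y" "cm z' (cm z y) = - y"
proof -
  note va = apt_adj[OF v]
  define m where "m = z' + z + z''"
  define w where "w = cm z y"
  have zU: "z \<in> U v 1" and yU: "y \<in> U v 5" using Y_U[OF v] z y by auto
  have zN: "z \<in> N (v 3)" "z \<in> N (v 5)" and yN: "y \<in> N (v 7)" "y \<in> N (v 9)"
    using z y unfolding Y_def by auto
  have aut: "z \<in> aut" "y \<in> aut" "z' \<in> aut" "z'' \<in> aut" using U_aut zU yU z' z'' by auto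
  have "w \<in> N (v 5)" unfolding w_def
    by (rule N_cm[OF zN(2) aut(2)]) (rule U_fix[OF v yU], simp_all)
  moreover have w7: "w \<in> N (v 7)" unfolding w_def
    by (rule N_cm'[OF yN(1) aut(1)]) (rule U_fix[OF v zU], simp_all)
  ultimately have wY: "w \<in> Y v 3" unfolding Y_def by simp
  then show "cm z y \<in> Y v 3" by (simp add: w_def)
  have wU: "w \<in> U v 3" using Y_U[OF v wY] .
  have com: "com y z'" "com y z''" "com w y"
    using commute_N[OF v yU] yN z' z'' commute_N[OF v wU] \<open>w \<in> N (v 5)\<close> yU by simp_all
  define k where "k = cm z' w"
  have maut: "m \<in> aut" unfolding m_def using aut by simp
  have "m + y - m = z' + (z + (z'' + y - z'') - z) - z'"
    unfolding m_def by (simp only: group_simps)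
  also have "z'' + y - z'' = y" by (rule com_conj[OF com_sym[OF com(2)]])
  also have "z + y - z = w + y" unfolding w_def by (rule conj_eq_cm)
  also have "z' + (w + y) - z' = (z' + w - z') + (z' + y - z')" by (simp only: group_simps)
  also have "z' + y - z' = y" by (rule com_conj[OF com_sym[OF com(1)]])
  also have "z' + w - z' = k + w" unfolding k_def by (rule conj_eq_cm)
  finally have M: "m + y - m = k + w + y" .
  have "m \<cdot> v 7 = v 7" "m \<cdot> v 9 = v 5" using r apt_mod[OF v] unfolding m_def by simp_all
  then have "m + y - m \<in> N (v 7)" "m + y - m \<in> N (v 5)"
    using N_conj'[OF maut yN(1)] N_conj'[OF maut yN(2)] by simp_all
  then have MY: "m + y - m \<in> Y v 3" unfolding Y_def by simp
  have ky: "k + y = (m + y - m) - w"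
    using com(3) unfolding M com_def by (metis add.assoc add_diff_cancel)
  then have "k + y \<in> U v 3" using Y_U[OF v MY] wU by simp
  moreover have k7: "k \<in> N (v 7)" unfolding k_def
    by (rule N_cm'[OF w7 aut(3)]) (rule U_fix[OF v z'], simp_all)
  have "k \<in> K (v 9)" unfolding k_def
    by (rule K_cm[OF U_K[OF z'] U_aut[OF wU] U_fix[OF v wU]]) simp_all
  then have "k + y \<in> K (v 9)" using U_K[OF yU, of 9] by simp
  ultimately have "k + y = 0" by (intro rigid6[OF v, of _ 3]) (simp_all add: U_def)
  then have "k = - y" by (simp add: eq_neg_iff_add_eq_0)
  then show "cm z' (cm z y) = - y" by (simp add: k_def w_def)
  have "m + y - m = w" using ky \<open>k + y = 0\<close> by simp
  then show "(z' + z + z'') + y - (z' + z + z'') = cm z y" by (simp add: m_def w_def)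
qed

text \<open>The previous lemma, applied to a reflection induced by \<open>w\<close>, produces some
  \<open>q\<close> in \<open>Y v 7\<close> with the same commutator with \<open>w\<close> as
  \<open>z'\<close>. Thus \<open>r = - q + z'\<close> commutes with \<open>w\<close>. If
  \<open>r\<close> moved \<open>v 6\<close>, then \<open>w\<close> would fix a path of eight
  elements through \<open>v 7\<close> that branches off to the images under \<open>r\<close>, and
  would be trivial.\<close>

lemma Y_reflection_factor:
  assumes v: "apt v" and z: "z \<in> Y v 1" and z': "z' \<in> U v 7" and z'': "z'' \<in> U v 7"
    and r: "\<forall>i. (z' + z + z'') \<cdot> v i = v (2 - i)" and y: "y \<in> Y v 5" "y \<noteq> 0"
  shows "z' \<in> Y v 7"
proof -
  note va = apt_adj[OF v]
  define w where "w = cm z y"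
  note * = Y_reflection[OF v z z' z'' r y(1), folded w_def]
  have wU: "w \<in> U v 3" using Y_U[OF v *(1)] .
  have w0: "w \<noteq> 0"
  proof
    assume "w = 0"
    then have "- y = 0" using *(3) by (simp add: cm_def)
    then show False using y by simp
  qed
  define u where "u = (\<lambda>i. v (i + 2))"
  have u: "apt u" unfolding u_def by (rule apt_shift[OF v])
  have Uu: "U u j = U v (j + 2)" "Y u j = Y v (j + 2)" for j
    unfolding u_def by (rule U_shift Y_shift)+
  have wu: "w \<in> U u 1" "w \<in> Y u 1" using wU *(1) Uu by simp_all
  obtain w' w'' where w': "w' \<in> U u 7" "w'' \<in> U u 7" "\<forall>i. (w' + w + w'') \<cdot> u i = u (2 - i)"
    using reflection_exists[OF u wu(1) w0] by blast
  define m where "m = w' + w + w''"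
  have maut: "m \<in> aut" unfolding m_def using U_aut w' wU by simp
  have mv: "m \<cdot> v (i + 2) = v (4 - i)" for i
    using w'(3) unfolding u_def m_def by (metis add.commute add_diff_eq numeral_Bit0)
  have "(- m) \<cdot> v 7 = v 11" "(- m) \<cdot> v 9 = v 9"
    using mv[of "-3"] mv[of "-5"] apt_mod[OF v] by (simp_all add: ap_minus_eq)
  moreover have "y \<in> N (v 7)" "y \<in> N (v 9)" using y unfolding Y_def by simp_all
  ultimately have "- m + y - (- m) \<in> N (v 11)" "- m + y - (- m) \<in> N (v 9)"
    using N_conj'[OF aut_minus[OF maut]] by blast+
  then have q: "- m + y + m \<in> Y v 7" unfolding Y_def by simp
  define q where "q = - m + y + m"
  have qY: "q \<in> Y v 7" using q q_def by simp
  have "m + q - m = cm w q"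
    using Y_reflection(2)[OF u wu(2) w', of q] qY Uu by (simp add: m_def)
  moreover have "m + q - m = y" unfolding q_def by (simp only: group_simps)
  ultimately have "cm q w = - y" using cm_swap[of q w] by simp
  then have "cm z' w = cm q w" using *(3) by simp
  then have e: "z' + w - z' = q + w - q" using conj_eq_cm[of z' w] conj_eq_cm[of q w] by simp
  define r where "r = - q + z'"
  have rw: "r + w - r = w"
  proof -
    have "r + w - r = - q + (z' + w - z') + q" unfolding r_def by (simp only: group_simps)
    also have "\<dots> = w" unfolding e by (simp only: group_simps)
    finally show ?thesis .
  qed
  have rU: "r \<in> U v 7" unfolding r_def using Y_U[OF v qY] z' by simp
  have raut: "r \<in> aut" using U_aut rU by blast
  have "r = 0"
  proof (rule ccontr)
    assume "r \<noteq> 0"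
    then have r6: "r \<cdot> v 6 \<noteq> v 6" using U_free[OF v rU, of 6] by auto
    have r7: "r \<cdot> v 7 = v 7" using U_fix[OF v rU] by simp
    have w5: "w \<in> N (v 5)" "w \<in> N (v 7)" using *(1) unfolding Y_def by simp_all
    have "w \<in> N (r \<cdot> v 5)" using N_conj[OF raut w5(1)] rw by simp
    note wr = K_adj[OF N_K[OF this]] K_fix[OF N_K[OF this]]
    have a: "adj (r \<cdot> v 5) (r \<cdot> v 6)" "adj (r \<cdot> v 5) (r \<cdot> v 4)" "adj (r \<cdot> v 6) (r \<cdot> v 7)"
      "adj (r \<cdot> v 6) (r \<cdot> v 5)" "r \<cdot> v 5 \<noteq> r \<cdot> v 7" "r \<cdot> v 6 \<noteq> r \<cdot> v 4"
      using raut by (simp_all add: va)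
    have "w = 0"
    proof (rule rigid_path[OF U_aut[OF wU]])
      show "path [v 3, v 4, v 5, v 6, v 7, r \<cdot> v 6, r \<cdot> v 5, r \<cdot> v 4]"
        using a r6 r7 adj_sym by (simp add: va)
      show "\<forall>x\<in>set [v 3, v 4, v 5, v 6, v 7, r \<cdot> v 6, r \<cdot> v 5, r \<cdot> v 4]. w \<cdot> x = x"
        using wr a U_fix[OF v wU] by simp
      show "w \<in> K (v 6)" "w \<in> K (v 7)" using U_K[OF wU] by simp_all
    qed
    then show False using w0 by simp
  qed
  then have "z' = q" unfolding r_def by (metis add_minus_cancel add_0_right)
  then show ?thesis using qY by simp
qed

text \<open>
  A single nontrivial element \<open>z\<close> of \<open>Y v 1\<close> makes all of \<open>U v 3\<close> semicentral: the reflection \<open>\<mu>\<close> induced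
  by \<open>z\<close> has its factors in \<open>Y v 7\<close>, which commutes with \<open>U v 5\<close>, so conjugation by \<open>\<mu>\<close>, which maps
  \<open>U v 5\<close> onto \<open>U v 3\<close>, is given by commutators with \<open>z\<close>.
\<close>

lemma U_sub_N_of_Y:
  assumes v: "apt v" and z: "z \<in> Y v 1" "z \<noteq> 0" and y: "y \<in> Y v 5" "y \<noteq> 0" and b: "b \<in> U v 3"
  shows "b \<in> N (v 5)"
proof -
  have zU: "z \<in> U v 1" using Y_U[OF v] z by auto
  obtain z' z'' where z': "z' \<in> U v 7" "z'' \<in> U v 7" "\<forall>i. (z' + z + z'') \<cdot> v i = v (2 - i)"
    using reflection_exists[OF v zU z(2)] by blast
  have z'Y: "z' \<in> Y v 7" by (rule Y_reflection_factor[OF v z(1) z' y])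
  \<comment> \<open>The inverse of the reflection acts on the apartment in the same way; it is
    induced by \<open>- z\<close> and has \<open>- z''\<close> as its first factor.\<close>
  have z''Y: "z'' \<in> Y v 7"
  proof -
    have "(- z'' + - z + - z') \<cdot> v i = v (2 - i)" for i
    proof -
      have "- z'' + - z + - z' = - (z' + z + z'')" by (simp only: group_simps)
      then show ?thesis using z'(3) by (simp only: ap_minus_eq) simp
    qed
    then have "- z'' \<in> Y v 7"
      using Y_reflection_factor[OF v _ _ _ _ y, of "- z" "- z''" "- z'"] z z' by simp
    then show ?thesis using Y_minus[of "- z''"] by simp
  qed
  define m where "m = z' + z + z''"
  have aut: "z \<in> aut" "z' \<in> aut" "z'' \<in> aut" "b \<in> aut" using U_aut zU z' b by auto
  have maut: "m \<in> aut" unfolding m_def using aut by simp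
  have mv: "(- m) \<cdot> v i = v (2 - i)" for i using z'(3) unfolding m_def ap_minus_eq by simp
  define a where "a = - m + b + m"
  have "- m + b - (- m) \<in> U v 5" unfolding U_def
    using K_conj'[OF aut_minus[OF maut] U_K[OF b, of 8] mv] K_conj'[OF aut_minus[OF maut] U_K[OF b, of 7] mv]
      K_conj'[OF aut_minus[OF maut] U_K[OF b, of 6] mv] K_conj'[OF aut_minus[OF maut] U_K[OF b, of 5] mv]
      K_conj'[OF aut_minus[OF maut] U_K[OF b, of 4] mv] apt_mod[OF v] by simp
  then have a: "a \<in> U v 5" unfolding a_def by simp
  have aaut: "a \<in> aut" using U_aut[OF a] .
  have ca: "com z'' a" using commute_N'[OF v z'(2) _, of a] a z''Y unfolding Y_def by simp
  define g where "g = cm z a"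
  have zN: "z \<in> N (v 5)" using z unfolding Y_def by simp
  have "b = m + a - m" unfolding a_def by (simp only: group_simps)
  also have "\<dots> = z' + (z + (z'' + a - z'') - z) - z'" unfolding m_def by (simp only: group_simps)
  also have "z'' + a - z'' = a" by (rule com_conj[OF ca])
  also have "z + a - z = g + a" unfolding g_def by (rule conj_eq_cm)
  finally have b1: "b = z' + (g + a) - z'" .
  define k where "k = cm (- z') b"
  have "k + b = - z' + b - (- z')" unfolding k_def by (rule conj_eq_cm[symmetric])
  also have "\<dots> = g + a" unfolding b1 by (simp only: group_simps)
  finally have kb: "k + b = g + a" .
  have g5: "g \<in> N (v 5)" unfolding g_def
    by (rule N_cm[OF zN aaut]) (rule U_fix[OF v a], simp_all)
  have g7: "g \<in> K (v 7)" unfolding g_def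
    by (rule K_cm'[OF U_K[OF a] aut(1) U_fix[OF v zU]]) simp_all
  have "- z' \<in> N (v 9)" using z'Y unfolding Y_def by simp
  then have k9: "k \<in> N (v 9)" unfolding k_def
    by (rule N_cm[OF _ aut(4)]) (rule U_fix[OF v b], simp_all)
  have k7: "k \<in> K (v 7)" unfolding k_def
    by (rule K_cm'[OF U_K[OF b] aut_minus[OF aut(2)] U_fix[OF v U_minus[OF z'(1)]]]) simp_all
  have kk: "k \<in> K (v 8)" "k \<in> K (v 9)" "k \<in> K (v 10)"
    using N_K[OF k9] N_adj[OF k9] by (simp_all add: apt_adj[OF v])
  have gk: "g \<in> K (v 4)" "g \<in> K (v 5)" "g \<in> K (v 6)"
    using N_K[OF g5] N_adj[OF g5] by (simp_all add: apt_adj[OF v])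
  have "g = k + b - a" unfolding kb by simp
  then have g8: "g \<in> K (v 8)" using kk U_K[OF b, of 8] U_K[OF a, of 8] by simp
  define g' where "g' = - a + g + a"
  have af: "(- a) \<cdot> v 5 = v 5" using U_fix[OF v U_minus[OF a]] by simp
  have "- a + g - (- a) \<in> N (v 5)" by (rule N_conj'[OF aut_minus[OF aaut] g5 af])
  then have g'5: "g' \<in> N (v 5)" unfolding g'_def by simp
  have g'78: "g' \<in> K (v 7)" "g' \<in> K (v 8)" unfolding g'_def
    using g7 g8 U_K[OF a, of 7] U_K[OF a, of 8] by simp_all
  have g'k: "g' \<in> K (v 4)" "g' \<in> K (v 5)" "g' \<in> K (v 6)"
    using N_K[OF g'5] N_adj[OF g'5] by (simp_all add: apt_adj[OF v])
  have "k + b = a + g'" unfolding kb g'_def by (simp only: group_simps)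
  then have "- k + (k + b) - g' = - k + (a + g') - g'" by simp
  then have e: "b - g' = - k + a" by (simp only: group_simps)
  \<comment> \<open>The left side of the equation shows membership in \<open>K\<close> at
    \<open>v 4\<close> to \<open>v 8\<close>, the right side at \<open>v 9\<close>.\<close>
  have "b - g' = 0"
  proof (rule rigid6[OF v, of _ 3])
    show "b - g' \<in> K (v (3 + 6))" unfolding e using kk U_K[OF a, of 9] by simp
  qed (use g'k g'78 U_K[OF b] in simp_all)
  then show ?thesis using g'5 by simp
qed

text \<open>By \<open>N_commute\<close> it suffices that \<open>g = cm a b\<close> commutes with
  every \<open>d\<close> in \<open>U v 4\<close>. Conjugation by \<open>d\<close> fixes
  \<open>b\<close> and changes \<open>a\<close> by \<open>x = cm d a\<close>. This is a sum from
  \<open>U v 3\<close> and \<open>U v 2\<close>, so it commutes with \<open>b\<close> and with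
  \<open>g\<close>, and the commutator is unchanged.\<close>

lemma cm_U13_Y2_half:
  assumes v: "apt v" and ab: "\<And>b b'. b \<in> U v 3 \<Longrightarrow> b' \<in> U v 3 \<Longrightarrow> com b b'"
    and a: "a \<in> U v 1" and b: "b \<in> U v 3"
  shows "cm a b \<in> N (v 4)"
proof -
  define g where "g = cm a b"
  have g: "g \<in> U v 2" unfolding g_def using U_cm2[OF v a] b by simp
  have "com g d" if d: "d \<in> U v (2 + 2)" for d
  proof -
    have d4: "d \<in> U v 4" using d by simp
    define x where "x = cm d a"
    have "cm a d \<in> K (v k)" if "4 \<le> k" "k \<le> 7" for k
      using U_cm_K[OF v a d4, of k] that by simp
    then have "x \<in> K (v k)" if "4 \<le> k" "k \<le> 7" for k
      unfolding x_def using cm_swap[of d a] that by simp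
    then obtain h3 h2 where h: "h3 \<in> U v 3" "h2 \<in> U v 2" "x = h3 + h2"
      using K4567_decomp[OF v, of x] by auto
    have "com b h3" using ab b h by blast
    moreover have "com b h2" using com_sym[OF U_commute1[OF v h(2), of b]] b by simp
    ultimately have "com b x" unfolding h by (rule com_add)
    have "com g h3" using U_commute1[OF v g] h by simp
    moreover have "com h2 a" using com_sym[OF U_commute1[OF v a, of h2]] h by simp
    have "com h2 b" using U_commute1[OF v h(2)] b by simp
    then have "com h2 g" unfolding g_def using \<open>com h2 a\<close> by (intro com_cm)
    ultimately have "com g x" unfolding h using com_sym by (intro com_add) blast+
    have "d + g - d = cm (d + a - d) (d + b - d)" unfolding g_def by (rule cm_conj)
    also have "d + b - d = b"
      by (rule com_conj[OF com_sym[OF U_commute1[OF v b]]]) (use d4 in simp)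
    also have "d + a - d = x + a" unfolding x_def by (rule conj_eq_cm)
    also have "cm (x + a) b = x + g - x + cm x b" unfolding g_def by (rule cm_add_left)
    also have "x + g - x = g" by (rule com_conj[OF com_sym[OF \<open>com g x\<close>]])
    also have "cm x b = 0" using com_sym[OF \<open>com b x\<close>] unfolding com_iff_cm .
    finally have "d + g - d = g" by simp
    then show ?thesis unfolding com_def by (metis diff_add_cancel)
  qed
  then have "g \<in> N (v (2 + 2))" using N_commute[OF v g] by blast
  then show ?thesis by (simp add: g_def)
qed

text \<open>Elements \<open>a\<close> of \<open>U v 1\<close> have commutators with
  \<open>U v 3\<close> in \<open>U v 2\<close>, which commutes with both groups. So
  \<open>com_cm_of_bilinear\<close> applies and \<open>N_commute'\<close> translates the
  result.\<close>

lemma cm_U33_Y3_half: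
  assumes v: "apt v" and b: "b \<in> U v 3" "b' \<in> U v 3"
  shows "cm b b' \<in> N (v 7)"
proof -
  have "com (cm b b') a" if a: "a \<in> U v (3 - 2)" for a
  proof (rule com_sym[OF com_cm_of_bilinear])
    have a1: "a \<in> U v 1" using a by simp
    have c: "cm a y \<in> U v 2" if "y \<in> U v 3" for y using U_cm2[OF v a1] that by simp
    then have c3: "com (cm a y) y'" if "y \<in> U v 3" "y' \<in> U v 3" for y y'
      using U_commute1[OF v c] that by simp
    show "com (cm a b) b" "com (cm a b) b'" "com (cm a b') b" "com (cm a b') b'"
      using c3 b by auto
    have c1: "com a (cm a y)" if "y \<in> U v 3" for y
      using U_commute1[OF v a1] c[OF that] by simp
    show "com (cm a b) (cm a b')"
      by (rule cm_values_commute) (use b c1 c3 com_sym in blast)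
  qed
  then have "cm b b' \<in> N (v (3 + 4))"
    using b by (intro N_commute'[OF v]) (simp_all add: cm_def)
  then show ?thesis by simp
qed

text \<open>
  If all \<open>Y v i\<close> were trivial, then all root groups would be abelian, hence \<open>U v 1\<close> and \<open>U v 3\<close> would
  commute, which puts \<open>U v 1\<close> into \<open>Y v 1\<close>.
\<close>

lemma Y_exists: "adj x0 x1 \<Longrightarrow> \<exists>v. apt v \<and> (\<exists>z\<in>Y v 1. z \<noteq> 0)"
proof (rule ccontr)
  assume "adj x0 x1" and none: "\<not> (\<exists>v. apt v \<and> (\<exists>z\<in>Y v 1. z \<noteq> 0))"
  then obtain v0 where v0: "apt v0" using apt_exists_1 by blast
  have triv: "g = 0" if "apt v" "g \<in> Y v i" for v g i
  proof -
    have "g \<in> Y (\<lambda>j. v (j + (i - 1))) 1" using that(2) unfolding Y_shift by simp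
    then show ?thesis using none apt_shift[OF that(1)] by blast
  qed
  have ab: "com b b'" if v: "apt v" and b: "b \<in> U v 3" "b' \<in> U v 3" for v b b'
  proof -
    \<comment> \<open>This reflection preserves the root of \<open>U v 3\<close> and exchanges
      \<open>v 5\<close> and \<open>v 7\<close>, which supplies the other half.\<close>
    have u: "apt (\<lambda>i. v (12 - i))" using apt_reflect[OF v] .
    have "b \<in> U (\<lambda>i. v (12 - i)) 3" "b' \<in> U (\<lambda>i. v (12 - i)) 3"
      using b unfolding U_reflect by simp_all
    from cm_U33_Y3_half[OF u this] have "cm b b' \<in> N (v 5)" by simp
    moreover have "cm b b' \<in> N (v 7)" by (rule cm_U33_Y3_half[OF v b])
    ultimately have "cm b b' \<in> Y v 3" unfolding Y_def by simp
    then show ?thesis using triv[OF v] unfolding com_iff_cm by blast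
  qed
  have ab1: "com b b'" if v: "apt v" and b: "b \<in> U v 1" "b' \<in> U v 1" for v b b'
  proof -
    have "b \<in> U (\<lambda>i. v (i + - 2)) 3" "b' \<in> U (\<lambda>i. v (i + - 2)) 3"
      using b unfolding U_shift by simp_all
    then show ?thesis using ab[OF apt_shift[OF v]] by blast
  qed
  have c13: "com a b" if v: "apt v" and a: "a \<in> U v 1" and b: "b \<in> U v 3" for v a b
  proof -
    \<comment> \<open>This reflection exchanges \<open>U v 1\<close> with \<open>U v 3\<close> and
      \<open>v 4\<close> with \<open>v 6\<close>.\<close>
    have u: "apt (\<lambda>i. v (10 - i))" using apt_reflect[OF v] .
    have "b \<in> U (\<lambda>i. v (10 - i)) 1" "a \<in> U (\<lambda>i. v (10 - i)) 3"
      using a b unfolding U_reflect by simp_all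
    from cm_U13_Y2_half[OF u ab[OF u] this] have "cm b a \<in> N (v 6)" by simp
    then have "cm a b \<in> N (v 6)" using cm_swap[of a b] by simp
    moreover have "cm a b \<in> N (v 4)" using cm_U13_Y2_half[OF v ab[OF v] a b] by simp
    ultimately have "cm a b \<in> Y v 2" unfolding Y_def by simp
    then show ?thesis using triv[OF v] unfolding com_iff_cm by blast
  qed
  obtain a where a: "a \<in> U v0 1" "a \<noteq> 0" using U_nontrivial[OF v0] by blast
  have "a \<in> N (v0 (1 + 2))"
    using c13[OF v0 a(1)] by (intro N_commute[OF v0 a(1)]) simp
  moreover have "a \<in> N (v0 (1 + 4))"
  proof (rule N_commute'[OF v0 a(1)])
    fix h assume "h \<in> U v0 (1 - 2)"
    then have "h \<in> U (\<lambda>i. v0 (i + - 2)) 1" "a \<in> U (\<lambda>i. v0 (i + - 2)) 3"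
      using a unfolding U_shift by simp_all
    then show "com a h" using c13[OF apt_shift[OF v0]] com_sym by blast
  qed
  ultimately have "a \<in> Y v0 1" unfolding Y_def by simp
  then show False using triv[OF v0] a by blast
qed


section \<open>Transitivity on paths and apartments\<close>

lemma path_extend_left:
  assumes "path xs" "2 \<le> length xs" "length xs \<le> 7"
  shows "\<exists>ys. path (ys @ xs) \<and> length (ys @ xs) = 7"
  using assms
proof (induction "7 - length xs" arbitrary: xs)
  case 0
  then show ?case by (intro exI[of _ "[]"]) simp
next
  case (Suc n)
  then obtain x y zs where xs: "xs = x # y # zs"
    by (metis Suc_le_length_iff numeral_2_eq_2)
  then have "adj y x" using Suc.prems(1) adj_sym by (cases zs) auto
  then obtain z where "adj x z" "y \<noteq> z" using path_extend by blast
  then have "path (z # xs)" using Suc.prems(1) xs adj_sym by auto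
  moreover have "n = 7 - length (z # xs)" "length (z # xs) \<le> 7" using Suc by auto
  ultimately obtain ys where "path (ys @ z # xs)" "length (ys @ z # xs) = 7"
    using Suc.hyps(1)[of "z # xs"] Suc.prems by auto
  then show ?case by (intro exI[of _ "ys @ [z]"]) simp
qed

text \<open>Extended on the left to six steps, \<open>xs\<close> becomes the path of a root elation.
  If \<open>xs\<close> is a single vertex, the extension starts with a neighbour different from
  \<open>n\<close> and \<open>n'\<close>.\<close>

lemma move_last:
  assumes p: "path (xs @ [n])" "path (xs @ [n'])" and l: "xs \<noteq> []" "length xs \<le> 7"
  shows "\<exists>g\<in>aut. (\<forall>x\<in>set xs. g \<cdot> x = x) \<and> g \<cdot> n = n'"
proof -
  have long: "\<exists>g\<in>aut. (\<forall>x\<in>set xs. g \<cdot> x = x) \<and> g \<cdot> n = n'"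
    if p: "path (xs @ [n])" "path (xs @ [n'])" and l: "2 \<le> length xs" "length xs \<le> 7" for xs
  proof -
    have "xs \<noteq> []" using l by auto
    then have "path xs" using walk_take[OF p(1), of "length xs"] by simp
    then obtain ys where ys: "path (ys @ xs)" "length (ys @ xs) = 7"
      using path_extend_left l by blast
    define zs where "zs = ys @ xs"
    have "length zs = 7" using ys(2) zs_def by simp
    then obtain x0 x1 x2 x3 x4 x5 x6 where "zs = [x0, x1, x2, x3, x4, x5, x6]"
      by (auto simp: length_Suc_conv numeral_eq_Suc)
    then have z: "ys @ xs = [x0, x1, x2, x3, x4, x5, x6]" using zs_def by simp
    have xs: "xs = drop (length ys) [x0, x1, x2, x3, x4, x5, x6]" using z by (metis append_eq_conv_conj)
    have "length ys = 0 \<or> length ys = 1 \<or> length ys = 2 \<or> length ys = 3 \<or> length ys = 4 \<or> length ys = 5"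
      using ys(2) l unfolding length_append by arith
    then have "adj x6 n \<and> adj x6 n' \<and> n \<noteq> x5 \<and> n' \<noteq> x5"
      using p unfolding xs by (elim disjE) auto
    moreover have pz: "path [x0, x1, x2, x3, x4, x5, x6]" using ys z by simp
    ultimately obtain g where g: "g \<in> K x1" "g \<in> K x2" "g \<in> K x3" "g \<in> K x4" "g \<in> K x5" "g \<cdot> n = n'"
      using moufang[OF pz, of n n'] by blast
    have "adj x1 x0" "adj x5 x6" using pz adj_sym by auto
    then have "\<forall>x\<in>set (ys @ xs). g \<cdot> x = x"
      unfolding z using g K_fix K_adj by auto
    then show ?thesis using g K_aut by auto
  qed
  show ?thesis
  proof (cases "length xs = 1")
    case True
    then obtain x where x: "xs = [x]" by (auto simp: length_Suc_conv)
    show ?thesis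
    proof (cases "n = n'")
      case False
      have a: "adj x n" "adj x n'" using p x by auto
      then obtain z where "adj x z" "z \<noteq> n" "z \<noteq> n'" using thick_adj[OF a(1)] by metis
      then have "path ([z, x] @ [n])" "path ([z, x] @ [n'])" using a adj_sym by auto
      from long[OF this] show ?thesis using x by auto
    qed (intro bexI[of _ 0], auto)
  next
    case False
    then have "2 \<le> length xs" using l(1) by (cases xs) (auto simp: neq_Nil_conv)
    then show ?thesis using long p l by blast
  qed
qed

lemma path_trans:
  "path xs \<Longrightarrow> path ys \<Longrightarrow> length xs = length ys \<Longrightarrow> length xs \<le> 8 \<Longrightarrow> hd xs = hd ys \<Longrightarrow>
   \<exists>g\<in>aut. map (ap g) xs = ys"
proof (induction xs arbitrary: ys rule: rev_induct)
  case (snoc n xs)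
  then obtain ys' n' where ys: "ys = ys' @ [n']" by (metis length_append_singleton rev_exhaust
    length_0_conv nat.distinct(1))
  show ?case
  proof (cases "xs = []")
    case True
    then show ?thesis using snoc.prems ys by (intro bexI[of _ 0]) auto
  next
    case False
    then have ne: "ys' \<noteq> []" and len: "length xs = length ys'" using snoc.prems ys by auto
    have "path xs" using walk_take[OF snoc.prems(1), of "length xs"] False by simp
    moreover have "path ys'" using walk_take[of adj ys "length ys'"] snoc.prems(2) ys ne by simp
    ultimately obtain g where g: "g \<in> aut" "map (ap g) xs = ys'"
      using snoc.IH[of ys'] snoc.prems ys len False ne by auto
    have "path (map (ap g) (xs @ [n]))" using snoc.prems(1) path_aut[OF g(1)] by blast
    then have "path (ys' @ [g \<cdot> n])" using g by simp
    then obtain h where h: "h \<in> aut" "\<forall>x\<in>set ys'. h \<cdot> x = x" "h \<cdot> g \<cdot> n = n'"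
      using move_last[of ys' "g \<cdot> n" n'] snoc.prems ys ne by auto
    have "map (ap (h + g)) xs = ys'" using h(2) g(2)
      by (metis (no_types, lifting) ap_add list.map_comp comp_apply map_idI list.map_cong)
    then show ?thesis using h g ys by (intro bexI[of _ "h + g"]) auto
  qed
qed simp

text \<open>Equal types are joined by an even number of steps, and two steps at a time can be
  bridged by turning around the middle vertex with \<open>move_last\<close>.\<close>

lemma vertex_trans:
  assumes "adj x x'" "adj y y'" "pt x \<longleftrightarrow> pt y"
  shows "\<exists>g\<in>aut. g \<cdot> x = y"
proof -
  have *: "path xs \<Longrightarrow> odd (length xs) \<Longrightarrow> \<exists>g\<in>aut. g \<cdot> hd xs = last xs" for xs
  proof (induction "length xs" arbitrary: xs rule: less_induct)
    case less
    show ?case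
    proof (cases "length xs = 1")
      case True
      then show ?thesis by (intro bexI[of _ 0]) (auto simp: length_Suc_conv)
    next
      case False
      then obtain a b zs where "xs = a # b # zs" using less.prems(2)
        by (cases xs; cases "tl xs") auto
      then obtain c us where xs: "xs = a # b # c # us" using less.prems(2) by (cases zs) auto
      have "path (c # us)" "path ([b] @ [a])" "path ([b] @ [c])"
        using less.prems(1) adj_sym xs by (cases us; auto)+
      then obtain h where h: "h \<in> aut" "h \<cdot> a = c" using move_last[of "[b]" a c] by auto
      obtain g where "g \<in> aut" "g \<cdot> c = last xs"
        using less.hyps[of "c # us"] \<open>path (c # us)\<close> less.prems xs by auto
      then show ?thesis using h xs by (intro bexI[of _ "g + h"]) auto
    qed
  qed
  obtain xs where xs: "path xs" "hd xs = x" "last xs = y" "length xs \<le> 7"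
    using diameter assms by blast
  then have ne: "xs \<noteq> []" by auto
  then have "dst (length xs - 1) x y" unfolding dst_def using xs by (intro exI[of _ xs]) auto
  then have "odd (length xs)" using dst_pt assms(3) ne by fastforce
  then show ?thesis using * xs by blast
qed

lemma apt_trans:
  assumes v: "apt v" and w: "apt w" and t: "pt (v 0) \<longleftrightarrow> pt (w 0)"
  shows "\<exists>g\<in>aut. \<forall>i. g \<cdot> v i = w i"
proof -
  have "adj (v 0) (v 1)" "adj (w 0) (w 1)" by (simp_all add: apt_adj[OF v] apt_adj[OF w])
  then obtain g where g: "g \<in> aut" "g \<cdot> v 0 = w 0" using vertex_trans t by blast
  define u where "u = (\<lambda>i. g \<cdot> v i)"
  have u: "apt u" unfolding u_def by (rule apt_aut[OF g(1) v])
  have "path [u 0, u 1, u 2, u 3, u 4, u 5, u 6, u 7]" "path [w 0, w 1, w 2, w 3, w 4, w 5, w 6, w 7]"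
    by (simp_all add: apt_adj[OF u] apt_adj[OF w])
  then obtain h where h: "h \<in> aut" "map (ap h) [u 0, u 1, u 2, u 3, u 4, u 5, u 6, u 7] =
      [w 0, w 1, w 2, w 3, w 4, w 5, w 6, w 7]"
    using path_trans[of "[u 0, u 1, u 2, u 3, u 4, u 5, u 6, u 7]" "[w 0, w 1, w 2, w 3, w 4, w 5, w 6, w 7]"]
      g(2) by (auto simp: u_def)
  have "(\<lambda>i. h \<cdot> u i) = w"
  proof (rule apt_unique[OF apt_aut[OF h(1) u] w])
    fix i :: int assume "i \<in> {0..7}"
    then have "i = 0 \<or> i = 1 \<or> i = 2 \<or> i = 3 \<or> i = 4 \<or> i = 5 \<or> i = 6 \<or> i = 7" by auto
    then show "h \<cdot> u i = w i" using h(2) by auto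
  qed
  then have "h \<cdot> u i = w i" for i by (rule fun_cong)
  then have "\<forall>i. (h + g) \<cdot> v i = w i" unfolding u_def by simp
  moreover have "h + g \<in> aut" using g h by simp
  ultimately show ?thesis by (rule bexI)
qed

section \<open>Types of roots and central elations\<close>

lemma apt_pt: "apt v \<Longrightarrow> pt (v (i + 1)) \<longleftrightarrow> \<not> pt (v i)"
  using adj_pt[of "v i" "v (i + 1)"] by (simp add: apt_adj)

lemma apt_pt2: "apt v \<Longrightarrow> j = i + 2 \<Longrightarrow> pt (v j) \<longleftrightarrow> pt (v i)"
  using apt_pt[of v i] apt_pt[of v "i + 1"] by (simp add: add.assoc)

text \<open>\<open>v 4\<close> is the middle of the root from \<open>v 1\<close> to
  \<open>v 7\<close>, and its type distinguishes the two kinds of roots.\<close>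

definition semicentral :: "bool \<Rightarrow> bool" where
  "semicentral b \<longleftrightarrow> (\<forall>v. apt v \<longrightarrow> (pt (v 4) \<longleftrightarrow> b) \<longrightarrow> U v 1 \<subseteq> Y v 1)"

lemma semicentral_U:
  assumes "semicentral b" "apt v" "pt (v (i + 3)) \<longleftrightarrow> b" "g \<in> U v i"
  shows "g \<in> Y v i"
proof -
  have "4 + (i - 1) = i + 3" by simp
  then have "pt (v (4 + (i - 1))) \<longleftrightarrow> b" using assms(3) by metis
  then have "U (\<lambda>j. v (j + (i - 1))) 1 \<subseteq> Y (\<lambda>j. v (j + (i - 1))) 1"
    using assms(1) apt_shift[OF assms(2)] unfolding semicentral_def by blast
  then show ?thesis using assms(4) unfolding U_shift Y_shift by auto
qed

text \<open>Conjugates of \<open>z\<close> supply nontrivial elements of \<open>Y\<close> for all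
  roots of this kind, as the group is transitive on apartments. So \<open>U_sub_N_of_Y\<close>
  applies to every apartment, and its reflected form gives the second neighbourhood.\<close>

lemma semicentralI:
  assumes v: "apt v" and z: "z \<in> Y v 1" "z \<noteq> 0"
  shows "semicentral (pt (v 4))"
proof -
  have ynt: "\<exists>y\<in>Y w 1. y \<noteq> 0" if w: "apt w" "pt (w 4) \<longleftrightarrow> pt (v 4)" for w
  proof -
    have "pt (v 0) \<longleftrightarrow> pt (w 0)"
      using w(2) apt_pt2[OF v, of 2 0] apt_pt2[OF v, of 4 2] apt_pt2[OF w(1), of 2 0] apt_pt2[OF w(1), of 4 2]
      by simp
    then obtain g where g: "g \<in> aut" "\<forall>i. g \<cdot> v i = w i" using apt_trans[OF v w(1)] by blast
    have "g + z - g \<in> Y w 1"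
      using z(1) N_conj'[OF g(1), of z "v 3" "w 3"] N_conj'[OF g(1), of z "v 5" "w 5"] g(2)
      unfolding Y_def by simp
    moreover have "g + z - g \<noteq> 0"
    proof
      assume "g + z - g = 0"
      then have "g + z = g" by simp
      then have "- g + (g + z) = - g + g" by simp
      then have "z = 0" by (simp only: group_simps)
      then show False using z(2) by simp
    qed
    ultimately show ?thesis by blast
  qed
  have half: "b \<in> N (w 3)" if w: "apt w" "pt (w 4) \<longleftrightarrow> pt (v 4)" and b: "b \<in> U w 1" for w b
  proof -
    define u where "u = (\<lambda>i. w (i + (- 2)))"
    have u: "apt u" unfolding u_def by (rule apt_shift[OF w(1)])
    have p: "pt (u 4) \<longleftrightarrow> pt (v 4)" "pt (u 8) \<longleftrightarrow> pt (v 4)"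
      using w(2) apt_pt2[OF w(1), of 4 2] apt_pt2[OF w(1), of 6 4] by (simp_all add: u_def)
    obtain y where y: "y \<in> Y u 1" "y \<noteq> 0" using ynt[OF u p(1)] by blast
    have u': "apt (\<lambda>i. u (i + 4))" by (rule apt_shift[OF u])
    obtain x where "x \<in> Y (\<lambda>i. u (i + 4)) 1" "x \<noteq> 0"
      using ynt[OF u'] p(2) by auto
    then have x: "x \<in> Y u 5" "x \<noteq> 0" unfolding Y_shift by simp_all
    have "b \<in> U u 3" using b unfolding u_def U_shift by simp
    then have "b \<in> N (u 5)" by (rule U_sub_N_of_Y[OF u y x])
    then show ?thesis by (simp add: u_def)
  qed
  show ?thesis unfolding semicentral_def
  proof (intro allI impI subsetI)
    fix w b assume w: "apt w" "pt (w 4) \<longleftrightarrow> pt (v 4)" and b: "b \<in> U w 1"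
    have "b \<in> U (\<lambda>i. w (8 - i)) 1" using b unfolding U_reflect by simp
    from half[OF apt_reflect[OF w(1)] _ this] have "b \<in> N (w 5)" using w(2) by simp
    moreover have "b \<in> N (w 3)" by (rule half[OF w b])
    ultimately show "b \<in> Y w 1" unfolding Y_def by simp
  qed
qed

lemma semicentral_exists: "adj x0 x1 \<Longrightarrow> \<exists>b. semicentral b"
  using Y_exists semicentralI by blast

text \<open>Conjugation by the reflection of \<open>z\<close> carries \<open>U v 5\<close> onto
  \<open>U v 3\<close>, and by \<open>Y_reflection\<close> it coincides there with the commutator
  with \<open>z\<close>. Writing all of \<open>U v 3\<close> as commutators with one
  \<open>z\<close> is what makes the next results computable.\<close>

lemma U3_eq_cm:
  assumes s: "semicentral b" and v: "apt v" "pt (v 4) \<longleftrightarrow> b"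
    and z: "z \<in> U v 1" "z \<noteq> 0" and g: "g \<in> U v 3"
  shows "\<exists>y\<in>U v 5. g = cm z y"
proof -
  have zY: "z \<in> Y v 1" using semicentral_U[OF s v(1) _ z(1)] v(2) by simp
  obtain z' z'' where z': "z' \<in> U v 7" "z'' \<in> U v 7" "\<forall>i. (z' + z + z'') \<cdot> v i = v (2 - i)"
    using reflection_exists[OF v(1) z] by blast
  define m where "m = z' + z + z''"
  have maut: "m \<in> aut" unfolding m_def using U_aut z z' by simp
  have mv: "(- m) \<cdot> v i = v (2 - i)" for i using z'(3) unfolding m_def ap_minus_eq by simp
  define y where "y = - m + g + m"
  have "- m + g - (- m) \<in> U v 5" unfolding U_def
    using K_conj'[OF aut_minus[OF maut] U_K[OF g, of 8] mv] K_conj'[OF aut_minus[OF maut] U_K[OF g, of 7] mv]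
      K_conj'[OF aut_minus[OF maut] U_K[OF g, of 6] mv] K_conj'[OF aut_minus[OF maut] U_K[OF g, of 5] mv]
      K_conj'[OF aut_minus[OF maut] U_K[OF g, of 4] mv] apt_mod[OF v(1)] by simp
  then have y: "y \<in> U v 5" unfolding y_def by simp
  have p8: "pt (v (5 + 3)) \<longleftrightarrow> b"
    using v(2) apt_pt2[OF v(1), of 6 4] apt_pt2[OF v(1), of 8 6] by simp
  have "m + y - m = cm z y" unfolding m_def
    by (rule Y_reflection(2)[OF v(1) zY z' semicentral_U[OF s v(1) p8 y]])
  moreover have "m + y - m = g" unfolding y_def by (simp only: group_simps)
  ultimately show ?thesis using y by blast
qed

text \<open>Both elements are commutators with the same \<open>z\<close>, and all commutators
  involved lie in \<open>U v 3\<close>, which commutes with \<open>U v 1\<close> and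
  \<open>U v 5\<close> by \<open>commute_N\<close>.\<close>

lemma semicentral_abelian:
  assumes s: "semicentral b" and v: "apt v" "pt (v 4) \<longleftrightarrow> b" and g: "g \<in> U v 3" and h: "h \<in> U v 3"
  shows "com g h"
proof -
  obtain z where z: "z \<in> U v 1" "z \<noteq> 0" using U_nontrivial[OF v(1)] by blast
  obtain y y' where y: "y \<in> U v 5" "g = cm z y" "y' \<in> U v 5" "h = cm z y'"
    using U3_eq_cm[OF s v z] g h by blast
  have zN: "z \<in> N (v 3)" using semicentral_U[OF s v(1) _ z(1)] v(2) unfolding Y_def by simp
  have p6: "pt (v (3 + 3)) \<longleftrightarrow> b" using v(2) apt_pt2[OF v(1), of 6 4] by simp
  have c: "com u x" if x: "x \<in> U v 3" and u: "u \<in> {z, y, y'}" for x u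
  proof -
    have "com z x" using commute_N[OF v(1) z(1)] zN x by simp
    moreover have "x \<in> N (v 5)" using semicentral_U[OF s v(1) p6 x] unfolding Y_def by simp
    then have "com x y" "com x y'" using commute_N[OF v(1) x] y by simp_all
    ultimately show ?thesis using u com_sym by blast
  qed
  show ?thesis unfolding y
  proof (rule cm_values_commute)
    fix x y0 u assume "x \<in> {z, z}" "y0 \<in> {y, y'}" "u \<in> {z, z, y, y'}"
    then have "cm x y0 \<in> U v 3" "u \<in> {z, y, y'}" using y g h by auto
    then show "com u (cm x y0)" using c by blast
  qed
qed

lemma semicentral_abelian_U:
  assumes s: "semicentral b" and v: "apt v" "pt (v (i + 3)) \<longleftrightarrow> b" and g: "g \<in> U v i" and h: "h \<in> U v i"
  shows "com g h"
proof -
  have "pt (v (i + 3)) \<longleftrightarrow> pt (v (i + 1))" using apt_pt2[OF v(1), of "i + 3" "i + 1"] by simp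
  moreover have "4 + (i - 3) = i + 1" by simp
  ultimately have "pt (v (4 + (i - 3))) \<longleftrightarrow> b" using v(2) by metis
  moreover have "g \<in> U (\<lambda>j. v (j + (i - 3))) 3" "h \<in> U (\<lambda>j. v (j + (i - 3))) 3"
    using g h unfolding U_shift by simp_all
  ultimately show ?thesis using semicentral_abelian[OF s apt_shift[OF v(1)]] by blast
qed

text \<open>Let \<open>g = cm z y\<close>, and let \<open>e\<close> in \<open>U v 6\<close> map
  \<open>v 5\<close> to the neighbour \<open>w\<close>. Conjugation by \<open>- e\<close> fixes
  \<open>y\<close> and replaces \<open>z\<close> by \<open>c + r + z\<close> with \<open>c\<close>
  in \<open>U v 5\<close> and \<open>r\<close> in \<open>K (v 5)\<close>. As \<open>U v 5\<close> is
  abelian, \<open>c\<close> contributes only a conjugation, so the conjugate of \<open>g\<close> is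
  in \<open>K (v 5)\<close>.\<close>

lemma semicentral_N_mid_aux:
  assumes s: "semicentral b" and v: "apt v" "pt (v 4) \<longleftrightarrow> b" and g: "g \<in> U v 3"
  shows "g \<in> N (v 6)"
proof -
  obtain z where z: "z \<in> U v 1" "z \<noteq> 0" using U_nontrivial[OF v(1)] by blast
  obtain y where y: "y \<in> U v 5" "g = cm z y" using U3_eq_cm[OF s v z g] by blast
  have p8: "pt (v (5 + 3)) \<longleftrightarrow> b"
    using v(2) apt_pt2[OF v(1), of 6 4] apt_pt2[OF v(1), of 8 6] by simp
  have aut: "z \<in> aut" "y \<in> aut" using U_aut z y by auto
  have "g \<in> K w" if w: "adj (v 6) w" for w
  proof (cases "w = v 7")
    case True
    then show ?thesis using U_K[OF g] by simp
  next
    case False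
    obtain e where e: "e \<in> U v 6" "e \<cdot> v 5 = w"
      using U_transL[OF v(1), of 6 "v 5" w] w False by (auto simp: apt_adj[OF v(1)])
    have me: "- e \<in> U v 6" using e by simp
    define k where "k = cm (- e) z"
    have "k \<in> K (v 6)" unfolding k_def
      by (rule K_cm'[OF U_K[OF z(1)] U_aut[OF me] U_fix[OF v(1) me]]) simp_all
    moreover have "k \<in> K (v 7)" unfolding k_def
      by (rule K_cm[OF U_K[OF me] aut(1) U_fix[OF v(1) z(1)]]) simp_all
    ultimately obtain c r where c: "c \<in> U v 5" "r \<in> K (v 5)" "k = c + r"
      using K67_decomp[OF v(1)] by blast
    have "- e + g - (- e) = cm (- e + z - (- e)) (- e + y - (- e))"
      unfolding y by (rule cm_conj)
    also have "- e + y - (- e) = y"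
      by (rule com_conj[OF com_sym[OF U_commute1[OF v(1) y(1)]]]) (use me in simp)
    also have "- e + z - (- e) = k + z" unfolding k_def by (rule conj_eq_cm)
    also have "k + z = c + (r + z)" unfolding c by (simp add: add.assoc)
    also have "cm (c + (r + z)) y = c + cm (r + z) y - c + cm c y" by (rule cm_add_left)
    also have "cm c y = 0"
      using semicentral_abelian_U[OF s v(1) p8 c(1) y(1)] unfolding com_iff_cm .
    finally have eg: "- e + g - (- e) = c + cm (r + z) y - c" by simp
    have "r + z \<in> K (v 5)" using c U_K[OF z(1), of 5] by simp
    then have "cm (r + z) y \<in> K (v 5)"
      by (rule K_cm[OF _ aut(2)]) (rule U_fix[OF v(1) y(1)], simp_all)
    then have "- e + g - (- e) \<in> K (v 5)" unfolding eg
      by (rule K_conj'[OF U_aut[OF c(1)]]) (rule U_fix[OF v(1) c(1)], simp_all)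
    then have "e + (- e + g - (- e)) - e \<in> K w"
      by (rule K_conj'[OF U_aut[OF e(1)] _ e(2)])
    moreover have "e + (- e + g - (- e)) - e = g" by (simp only: group_simps)
    ultimately show ?thesis by simp
  qed
  then show ?thesis using U_K[OF g, of 6] by (simp add: N_def)
qed

lemma semicentral_N_mid:
  assumes s: "semicentral b" and v: "apt v" "pt (v (i + 3)) \<longleftrightarrow> b" and g: "g \<in> U v i"
  shows "g \<in> N (v (i + 3))"
proof -
  have "pt (v (i + 3)) \<longleftrightarrow> pt (v (i + 1))" using apt_pt2[OF v(1), of "i + 3" "i + 1"] by simp
  moreover have "4 + (i - 3) = i + 1" by simp
  ultimately have "pt (v (4 + (i - 3))) \<longleftrightarrow> b" using v(2) by metis
  moreover have "g \<in> U (\<lambda>j. v (j + (i - 3))) 3"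
    using g unfolding U_shift by simp_all
  ultimately have "g \<in> N (v (6 + (i - 3)))"
    using semicentral_N_mid_aux[OF s apt_shift[OF v(1)]] by blast
  then show ?thesis by (simp add: add.commute)
qed

text \<open>The roots of \<open>a\<close> and \<open>d\<close> are of different kinds. The
  commutator \<open>c\<close> turns out to lie in \<open>Y v 2\<close>. If it were not
  \<open>0\<close>, the other kind of root would be semicentral as well; then \<open>d\<close> would
  be in \<open>N (v 7)\<close>, which forces \<open>c = 0\<close> after all.\<close>

lemma semicentral_U14:
  assumes s: "semicentral b" and v: "apt v" "pt (v 4) \<longleftrightarrow> b" and a: "a \<in> U v 1" and d: "d \<in> U v 4"
  shows "com a d"
proof -
  have aN: "a \<in> N (v 3)" "a \<in> N (v 4)" "a \<in> N (v 5)"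
    using semicentral_U[OF s v(1) _ a] semicentral_N_mid[OF s v(1) _ a] v(2) unfolding Y_def by simp_all
  have aut: "a \<in> aut" "d \<in> aut" using U_aut a d by auto
  define c where "c = cm a d"
  have c4: "c \<in> N (v 4)" unfolding c_def
    by (rule N_cm[OF aN(2) aut(2)]) (rule U_fix[OF v(1) d], simp_all)
  have c5: "c \<in> N (v 5)" unfolding c_def
    by (rule N_cm[OF aN(3) aut(2)]) (rule U_fix[OF v(1) d], simp_all)
  have c7: "c \<in> K (v 7)" unfolding c_def
    by (rule K_cm'[OF U_K[OF d] aut(1) U_fix[OF v(1) a]]) simp_all
  have cU: "c \<in> U v 2" unfolding U_def
    using c7 N_K[OF c4] N_K[OF c5] N_adj[OF c4] N_adj[OF c5] by (simp add: apt_adj[OF v(1)])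
  \<comment> \<open>Conjugation by \<open>e\<close> keeps \<open>c\<close> in \<open>U v 2\<close>,
    while \<open>cm e c\<close> is also in \<open>U v 1\<close>; the two groups meet
    trivially.\<close>
  have "com c e" if "e \<in> U v (2 - 2)" for e
  proof -
    have e: "e \<in> U v 0" using that by simp
    define q where "q = cm e d"
    have "q \<in> K (v k)" if "4 \<le> k" "k \<le> 6" for k
      unfolding q_def using U_cm_K[OF v(1) e d, of k] that by simp
    then obtain q3 q2 q1 where q: "q3 \<in> U v 3" "q2 \<in> U v 2" "q1 \<in> U v 1" "q = q3 + q2 + q1"
      using K456_decomp[OF v(1), of q] by auto
    have "com a q1" by (rule semicentral_abelian_U[OF s v(1) _ a q(3)]) (use v(2) in simp)
    moreover have "com a q2" using U_commute1[OF v(1) a] q by simp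
    moreover have "com a q3" using commute_N[OF v(1) a] aN q by simp
    ultimately have aq: "com a q" unfolding q by (intro com_add)
    define c' where "c' = q2 + c - q2"
    have c': "c' \<in> U v 2" unfolding c'_def using q cU by simp
    have "e + c - e = cm (e + a - e) (e + d - e)" unfolding c_def by (rule cm_conj)
    also have "e + a - e = a" by (rule com_conj[OF U_commute1[OF v(1) e]]) (use a in simp)
    also have "e + d - e = q + d" unfolding q_def by (rule conj_eq_cm)
    also have "cm a (q + d) = cm a q + (q + c - q)" unfolding c_def by (rule cm_add_right)
    also have "cm a q = 0" using aq unfolding com_iff_cm .
    also have "q + c - q = q3 + (q2 + (q1 + c - q1) - q2) - q3" unfolding q by (simp only: group_simps)
    also have "q1 + c - q1 = c" by (rule com_conj[OF U_commute1[OF v(1) q(3)]]) (use cU in simp)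
    also have "q3 + (q2 + c - q2) - q3 = c'" unfolding c'_def[symmetric]
      by (rule com_conj[OF com_sym[OF U_commute1[OF v(1) c']]]) (use q in simp)
    finally have "e + c - e = c'" by simp
    then have "cm e c = c' - c" using conj_eq_cm[of e c] by (metis add_diff_cancel)
    then have "cm e c \<in> U v 2" using c' cU by simp
    moreover have "cm e c \<in> U v 1" using U_cm2[OF v(1) e] cU by simp
    ultimately have "cm e c = 0"
      by (intro rigid6[OF v(1), of _ 1]) (simp_all add: U_def)
    then show ?thesis using com_sym unfolding com_iff_cm[symmetric] by blast
  qed
  then have c6: "c \<in> N (v (2 + 4))" using N_commute'[OF v(1) cU] by blast
  have "c = 0"
  proof (rule ccontr)
    assume "c \<noteq> 0"
    have "c \<in> Y (\<lambda>i. v (i + 1)) 1" using c4 c6 unfolding Y_def by simp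
    then have "semicentral (pt (v (4 + 1)))"
      using semicentralI[OF apt_shift[OF v(1), of 1]] \<open>c \<noteq> 0\<close> by blast
    moreover have "pt (v (4 + 3)) \<longleftrightarrow> pt (v (4 + 1))" using apt_pt2[OF v(1), of 7 5] by simp
    ultimately have "d \<in> N (v (4 + 3))" using semicentral_N_mid[OF _ v(1) _ d] by blast
    then have "c \<in> N (v 7)" unfolding c_def
      by (intro N_cm'[OF _ aut(1)] U_fix[OF v(1) a]) simp_all
    then have "c \<in> K (v 8)" by (rule N_adj) (simp add: apt_adj[OF v(1)])
    then have "c = 0" using cU by (intro rigid6[OF v(1), of _ 2]) (simp_all add: U_def)
    then show False using \<open>c \<noteq> 0\<close> by blast
  qed
  then show ?thesis unfolding com_iff_cm c_def .
qed

text \<open>\<open>U v 4\<close> moves \<open>v 3\<close> to all other neighbours of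
  \<open>v 4\<close> except \<open>v 5\<close>, and by \<open>semicentral_U14\<close> conjugation by
  it does not change \<open>a\<close>.\<close>

lemma semicentral_central:
  assumes s: "semicentral b" and v: "apt v" "pt (v 4) \<longleftrightarrow> b" and a: "a \<in> U v 1" and w: "adj (v 4) w"
  shows "a \<in> N w"
proof -
  have aN: "a \<in> N (v 3)" "a \<in> N (v 5)"
    using semicentral_U[OF s v(1) _ a] v(2) unfolding Y_def by simp_all
  show ?thesis
  proof (cases "w = v 5")
    case False
    obtain d where d: "d \<in> U v 4" "d \<cdot> v 3 = w"
      using U_transL[OF v(1), of 4 "v 3" w] w False by (auto simp: apt_adj[OF v(1)])
    have "d + a - d \<in> N w" by (rule N_conj'[OF U_aut[OF d(1)] aN(1) d(2)])
    then show ?thesis using com_conj[OF com_sym[OF semicentral_U14[OF s v a d(1)]]] by simp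
  qed (use aN in simp)
qed

end

section \<open>Distance-2 regularity\<close>

context moufang_hexagon
begin

lemma central_elation:
  assumes s: "semicentral b" and p: "path [x0, x1, x2, x3, x4, x5, x6]" and t: "pt x3 \<longleftrightarrow> b"
    and n: "adj x0 n" "n \<noteq> x1" "adj x0 n'" "n' \<noteq> x1"
  shows "\<exists>g\<in>aut. g \<cdot> x0 = x0 \<and> g \<cdot> x6 = x6 \<and> g \<cdot> n = n' \<and> (\<forall>w. adj x3 w \<longrightarrow> g \<in> N w)"
proof -
  obtain v where v: "apt v" "v 0 = x0" "v 1 = x1" "v 2 = x2" "v 3 = x3" "v 4 = x4" "v 5 = x5" "v 6 = x6"
    using apt_exists_6[OF p] by blast
  obtain g where g: "g \<in> U v 0" "g \<cdot> n = n'" using U_transL[OF v(1), of 0 n n'] n v by auto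
  have "g \<in> U (\<lambda>i. v (i + (- 1))) 1" using g unfolding U_shift by simp
  then have "\<forall>w. adj x3 w \<longrightarrow> g \<in> N w"
    using semicentral_central[OF s apt_shift[OF v(1), of "- 1"]] t v by simp
  moreover have "g \<cdot> x0 = x0" "g \<cdot> x6 = x6" using U_fix[OF v(1) g(1), of 0] U_fix[OF v(1) g(1), of 6] v by simp_all
  ultimately show ?thesis using g U_aut by blast
qed

definition trace :: "'a \<Rightarrow> 'a \<Rightarrow> 'a set" where
  "trace a u = {c. dst 2 a c \<and> dst 4 c u}"

lemma trace_path:
  assumes "dst 6 a u" "c \<in> trace a u"
  shows "\<exists>D C b B. path [a, D, c, C, b, B, u]"
proof -
  obtain D where D: "path [a, D, c]" using assms(2) unfolding trace_def dst_2 by blast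
  obtain C b B where C: "path [c, C, b, B, u]" using assms(2) unfolding trace_def dst_4 by blast
  have "D \<noteq> C"
  proof
    assume e: "D = C"
    show False
    proof (cases "b = a")
      case True
      then have "path [a, B, u]" using C by simp
      then have "dst 2 a u" using dst_2 by blast
      then show False using dst_unique[OF _ assms(1), of 2] by simp
    next
      case False
      then have "path [a, D, b, B, u]" using C D e by simp
      then have "dst 4 a u" using dst_4 by blast
      then show False using dst_unique[OF _ assms(1), of 4] by simp
    qed
  qed
  then show ?thesis using C D by (intro exI[of _ D] exI[of _ C] exI[of _ b] exI[of _ B]) simp
qed

lemma path_trace: "path [a, D, c, C, b, B, u] \<Longrightarrow> c \<in> trace a u"
proof -
  assume "path [a, D, c, C, b, B, u]"
  then have "path [a, D, c]" "path [c, C, b, B, u]" by simp_all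
  then show ?thesis unfolding trace_def dst_2 dst_4 by blast
qed

lemma opposite_path_unique:
  assumes "path [a, D, c, C, b, B, u]" "path [a, D, c', C', b', B', u]"
  shows "c = c'" "C = C'" "b = b'" "B = B'"
proof -
  have "[D, c, C, b, B, u] = [D, c', C', b', B', u]"
    by (rule path_unique) (use assms in simp_all)
  then show "c = c'" "C = C'" "b = b'" "B = B'" by simp_all
qed

text \<open>A central elation with centre \<open>D2\<close> can turn the path at \<open>c1\<close>
  into the direction \<open>C1\<close>. It keeps \<open>C2\<close> and everything at distance at
  most 2 from \<open>a\<close>, so moving \<open>u\<close> along with it does not enlarge the
  trace.\<close>

lemma regular_move:
  assumes s: "semicentral t" and a: "pt a \<longleftrightarrow> \<not> t"
    and p: "path [a, D1, c1, C1', b1, B1, u]" "path [a, D2, c2, C2, b2, B2, u]"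
    and D: "D1 \<noteq> D2" and C: "adj c1 C1" "C1 \<noteq> D1"
  shows "\<exists>u' e1 f1 e2 f2. path [a, D1, c1, C1, e1, f1, u'] \<and> path [a, D2, c2, C2, e2, f2, u'] \<and>
    trace a u' \<subseteq> trace a u"
proof -
  have q: "path [c1, D1, a, D2, c2, C2, b2]" using p D adj_sym by auto
  have t: "pt D2 \<longleftrightarrow> t" using p(2) a adj_pt[of a D2] by simp
  have n: "adj c1 C1'" "C1' \<noteq> D1" using p by auto
  obtain g where g: "g \<in> aut" "g \<cdot> c1 = c1" "g \<cdot> C1' = C1" "\<forall>w. adj D2 w \<longrightarrow> g \<in> N w"
    using central_elation[OF s q t n C] by blast
  have ga: "g \<in> N a" "g \<in> N c2" using g(4) p adj_sym by auto
  have f: "g \<cdot> a = a" "g \<cdot> D1 = D1" "g \<cdot> D2 = D2" "g \<cdot> c2 = c2" "g \<cdot> C2 = C2"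
    using K_fix[OF N_K[OF ga(1)]] K_adj[OF N_K[OF ga(1)]] K_fix[OF N_K[OF ga(2)]] K_adj[OF N_K[OF ga(2)]] p
    by auto
  have "path (map (ap g) [a, D1, c1, C1', b1, B1, u])" "path (map (ap g) [a, D2, c2, C2, b2, B2, u])"
    using p path_aut[OF g(1)] by blast+
  then have "path [a, D1, c1, C1, g \<cdot> b1, g \<cdot> B1, g \<cdot> u]" "path [a, D2, c2, C2, g \<cdot> b2, g \<cdot> B2, g \<cdot> u]"
    using f g by simp_all
  moreover have "trace a (g \<cdot> u) \<subseteq> trace a u"
  proof
    fix c assume c: "c \<in> trace a (g \<cdot> u)"
    then obtain d where d: "path [a, d, c]" unfolding trace_def dst_2 by blast
    have "g \<in> K d" using N_adj[OF ga(1)] d by simp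
    then have "g \<cdot> c = c" using K_adj d by simp
    then have "(- g) \<cdot> c = c" by (simp add: ap_minus_eq)
    moreover have "dst 4 ((- g) \<cdot> c) ((- g) \<cdot> g \<cdot> u)"
      using c dst_aut[OF aut_minus[OF g(1)]] unfolding trace_def by blast
    ultimately show "c \<in> trace a u" using c unfolding trace_def by simp
  qed
  ultimately show ?thesis by blast
qed

text \<open>Two moves replace \<open>u'\<close> by some \<open>x\<close> for which the paths through
  \<open>c1\<close> and \<open>c2\<close> leave in the same directions \<open>C1\<close> and
  \<open>C2\<close> as those to \<open>u\<close>. Now \<open>x\<close> and \<open>u\<close> are both
  at distance 3 from \<open>C1\<close>, so a central elation with centre \<open>C1\<close> fixes
  \<open>a\<close>, \<open>u\<close> and \<open>x\<close>. Chosen to map \<open>D2\<close> to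
  \<open>D3\<close>, it maps \<open>c2\<close> to \<open>c3\<close>.\<close>

lemma regular:
  assumes s: "semicentral t" and a: "pt a \<longleftrightarrow> \<not> t"
    and u: "dst 6 a u" "dst 6 a u'"
    and c1: "c1 \<in> trace a u" "c1 \<in> trace a u'" and c2: "c2 \<in> trace a u" "c2 \<in> trace a u'"
    and ne: "c1 \<noteq> c2"
  shows "trace a u \<subseteq> trace a u'"
proof
  fix c3 assume c3: "c3 \<in> trace a u"
  obtain D1 C1 b1 B1 where p1: "path [a, D1, c1, C1, b1, B1, u]" using trace_path u c1 by blast
  obtain D2 C2 b2 B2 where p2: "path [a, D2, c2, C2, b2, B2, u]" using trace_path u c2 by blast
  obtain D3 C3 b3 B3 where p3: "path [a, D3, c3, C3, b3, B3, u]" using trace_path u c3 by blast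
  obtain E1 C1' b1' B1' where q1: "path [a, E1, c1, C1', b1', B1', u']" using trace_path u c1 by blast
  obtain E2 C2' b2' B2' where q2: "path [a, E2, c2, C2', b2', B2', u']" using trace_path u c2 by blast
  have "[a, D1, c1] = [a, E1, c1]" "[a, D2, c2] = [a, E2, c2]"
    by (rule path_unique; use p1 p2 q1 q2 in simp)+
  then have E: "E1 = D1" "E2 = D2" by simp_all
  have D12: "D1 \<noteq> D2" using opposite_path_unique(1)[OF p1] p2 ne by blast
  obtain w e1 f1 e2 f2 where w: "path [a, D1, c1, C1, e1, f1, w]" "path [a, D2, c2, C2', e2, f2, w]"
    "trace a w \<subseteq> trace a u'"
    using regular_move[OF s a q1[unfolded E] q2[unfolded E] D12, of C1] p1 by auto
  obtain x g1 h1 g2 h2 where x: "path [a, D2, c2, C2, g2, h2, x]" "path [a, D1, c1, C1, g1, h1, x]"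
    "trace a x \<subseteq> trace a w"
    using regular_move[OF s a w(2,1) D12[symmetric], of C2] p2 by auto
  have "c3 \<in> trace a x"
  proof (cases "D3 = D1")
    case True
    then have "c3 = c1" using opposite_path_unique(1)[OF p1] p3 by blast
    then show ?thesis using path_trace x by blast
  next
    case False
    have t: "pt C1 \<longleftrightarrow> t" using p1 a adj_pt[of a D1] adj_pt[of D1 c1] adj_pt[of c1 C1] by simp
    have n: "adj a D2" "D2 \<noteq> D1" "adj a D3" "D3 \<noteq> D1" using p2 p3 D12 False by auto
    obtain g where g: "g \<in> aut" "g \<cdot> a = a" "g \<cdot> u = u" "g \<cdot> D2 = D3" "\<forall>w. adj C1 w \<longrightarrow> g \<in> N w"
      using central_elation[OF s p1 t n] by blast
    have "g \<in> N g1" "adj g1 h1" "adj h1 x" using g(5) x by auto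
    then have gx: "g \<cdot> x = x" using N_adj K_adj by blast
    have "path (map (ap g) [a, D2, c2, C2, b2, B2, u])" using p2 path_aut[OF g(1)] by blast
    then have "path [a, D3, g \<cdot> c2, g \<cdot> C2, g \<cdot> b2, g \<cdot> B2, u]" using g by simp
    then have "g \<cdot> c2 = c3" by (rule opposite_path_unique(1)[OF _ p3])
    moreover have "c2 \<in> trace a x" using path_trace x by blast
    ultimately have "dst 4 c3 x" using dst_aut[OF g(1), of 4 c2 x] gx unfolding trace_def by simp
    then show ?thesis using c3 unfolding trace_def by simp
  qed
  then show "c3 \<in> trace a u'" using w x by blast
qed

section \<open>Finite and infinite neighbourhoods\<close>

text \<open>
  Induction step of the degree argument: the commutators with \<open>b \<in> U v 1\<close> act on the finite
  neighbourhood of \<open>v 8\<close>, and this action is multiplicative along a list of elements of \<open>U v 1\<close> each of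
  which has trivial iterated commutators with the sums of initial segments of its successors. By the
  pigeonhole principle two final segments of a long list act equally, so the sum of the elements
  between acts trivially.
\<close>

lemma cm_trivial_step:
  assumes v: "apt v" and S: "finite S"
    and C: "\<And>q b. q \<in> S \<Longrightarrow> b \<in> U v 1 \<Longrightarrow> cm q b \<in> C"
    and Cf: "\<And>p. p \<in> C \<Longrightarrow> p \<in> aut \<and> p \<cdot> v 8 = v 8"
    and fin: "finite {n. adj (v 8) n}"
    and inf: "\<And>P. finite P \<Longrightarrow> P \<subseteq> C \<Longrightarrow> infinite {b \<in> U v 1. \<forall>p\<in>P. cm p b \<in> K (v 8)}"
  shows "infinite {b \<in> U v 1. \<forall>q\<in>S. cm q b \<in> K (v 8)}" (is "infinite ?X")
proof
  assume finX: "finite ?X"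
  \<comment> \<open>Only the action on neighbours of \<open>v 8\<close> counts. The constant default
    elsewhere leaves finitely many possible functions.\<close>
  define tr where "tr g = (\<lambda>n. if adj (v 8) n then g \<cdot> n else v 8)" for g
  have fixed: "adj (v 8) (h \<cdot> n)" if "h \<in> aut" "h \<cdot> v 8 = v 8" "adj (v 8) n" for h n
    using aut_adj[of h "v 8" n] that by simp
  have tr_add: "tr (g + h) = tr g \<circ> tr h" if "h \<in> aut" "h \<cdot> v 8 = v 8" for g h
    unfolding tr_def using fixed[OF that] by (intro ext) auto
  have tr_K: "tr (k + g) = tr g" if "k \<in> K (v 8)" "g \<in> C" for k g
    unfolding tr_def using fixed[of g] Cf[OF \<open>g \<in> C\<close>] K_adj[OF \<open>k \<in> K (v 8)\<close>]
    by (intro ext) auto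
  \<comment> \<open>Keeping \<open>x + s\<close> out of the supposedly finite set \<open>?X\<close>
    prepares the contradiction: the sum found by the pigeonhole principle will belong to
    \<open>?X\<close>.\<close>
  define good where "good x s \<longleftrightarrow> (\<forall>q\<in>S. cm (cm q s) x \<in> K (v 8)) \<and> x + s \<notin> ?X" for x s
  \<comment> \<open>Lists grow at the head. A new head has to be good for all sums of initial
    segments of the tail, including the empty sum.\<close>
  define G where "G = rec_list True (\<lambda>x bs r. r \<and> x \<in> U v 1 \<and> (\<forall>i\<le>length bs. good x (sum_list (take i bs))))"
  have G: "G []" "G (x # bs) \<longleftrightarrow> G bs \<and> x \<in> U v 1 \<and> (\<forall>i\<le>length bs. good x (sum_list (take i bs)))" for x bs
    by (simp_all add: G_def)
  have GU: "sum_list (take i bs) \<in> U v 1" if "G bs" for i bs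
    using that
  proof (induction bs arbitrary: i)
    case (Cons x bs)
    then show ?case using G(2) by (cases i) simp_all
  qed simp
  have ex: "\<exists>bs. length bs = n \<and> G bs" for n
  proof (induction n)
    case (Suc n)
    then obtain bs where bs: "length bs = n" "G bs" by blast
    define A where "A = (\<lambda>i. sum_list (take i bs)) ` {..length bs}"
    define P where "P = (\<lambda>(q, s). cm q s) ` (S \<times> A)"
    have "finite P" "P \<subseteq> C" unfolding P_def A_def using S C GU[OF bs(2)] by auto
    then have "infinite {b \<in> U v 1. \<forall>p\<in>P. cm p b \<in> K (v 8)}" by (rule inf)
    moreover have "finite ((\<lambda>(e, s). e - s) ` (?X \<times> A))" unfolding A_def using finX by auto
    ultimately have "\<not> {b \<in> U v 1. \<forall>p\<in>P. cm p b \<in> K (v 8)} \<subseteq> (\<lambda>(e, s). e - s) ` (?X \<times> A)"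
      using finite_subset by blast
    then obtain x where x: "x \<in> U v 1" "\<forall>p\<in>P. cm p x \<in> K (v 8)" "x \<notin> (\<lambda>(e, s). e - s) ` (?X \<times> A)"
      unfolding subset_iff mem_Collect_eq by blast
    have "good x s" if s: "s \<in> A" for s
    proof -
      have "\<forall>q\<in>S. cm (cm q s) x \<in> K (v 8)" using x(2) s unfolding P_def by auto
      moreover have "x + s \<notin> ?X"
      proof
        assume "x + s \<in> ?X"
        then have "(x + s) - s \<in> (\<lambda>(e, s). e - s) ` (?X \<times> A)" using s by (intro image_eqI[of _ _ "(x + s, s)"]) auto
        then show False using x(3) by simp
      qed
      ultimately show ?thesis unfolding good_def by blast
    qed
    then have "G (x # bs)" using G(2) bs x(1) unfolding A_def by auto
    then show ?case using bs by (intro exI[of _ "x # bs"]) simp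
  qed (use G in simp)
  have mult: "tr (cm q (x + s)) = tr (cm q x) \<circ> tr (cm q s)"
    if "good x s" "q \<in> S" "x \<in> U v 1" "s \<in> U v 1" for x s q
  proof -
    have cs: "cm q s \<in> C" using C that by blast
    have k: "cm x (cm q s) \<in> K (v 8)"
      using that cm_swap[of x "cm q s"] unfolding good_def by simp
    \<comment> \<open>Conjugation by \<open>x\<close> alters \<open>cm q s\<close> by
      \<open>cm x (cm q s)\<close>, which acts trivially because \<open>x\<close> is good for
      \<open>s\<close>.\<close>
    have "cm q (x + s) = cm q x + (cm x (cm q s) + cm q s)"
      unfolding cm_add_right[of q x s] conj_eq_cm[of x "cm q s"] ..
    also have "tr \<dots> = tr (cm q x) \<circ> tr (cm x (cm q s) + cm q s)"
      by (rule tr_add) (use Cf[OF cs] K_fix[OF k] K_aut[OF k] in simp_all)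
    also have "tr (cm x (cm q s) + cm q s) = tr (cm q s)" by (rule tr_K[OF k cs])
    finally show ?thesis .
  qed
  have split: "tr (cm q (sum_list xs + sum_list ys)) = tr (cm q (sum_list xs)) \<circ> tr (cm q (sum_list ys))"
    if "G (xs @ ys)" "q \<in> S" for xs ys q
    using that
  proof (induction xs)
    case Nil
    have "cm q (sum_list ys) \<in> C" using C Nil GU[of ys "length ys"] by simp
    then have "tr (0 + cm q (sum_list ys)) = tr 0 \<circ> tr (cm q (sum_list ys))"
      using Cf by (intro tr_add) blast+
    then show ?case by (simp add: cm_def)
  next
    case (Cons x xs)
    have g: "G (xs @ ys)" "x \<in> U v 1" "\<And>i. i \<le> length (xs @ ys) \<Longrightarrow> good x (sum_list (take i (xs @ ys)))"
      using Cons.prems(1) G by auto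
    have g1: "good x (sum_list xs + sum_list ys)" "good x (sum_list xs)"
      using g(3)[of "length (xs @ ys)"] g(3)[of "length xs"] by simp_all
    have u: "sum_list xs + sum_list ys \<in> U v 1" "sum_list xs \<in> U v 1"
      using GU[OF g(1), of "length (xs @ ys)"] GU[OF g(1), of "length xs"] by simp_all
    have "tr (cm q (x + (sum_list xs + sum_list ys))) = tr (cm q x) \<circ> tr (cm q (sum_list xs + sum_list ys))"
      by (rule mult[OF g1(1) Cons.prems(2) g(2) u(1)])
    also have "tr (cm q (sum_list xs + sum_list ys)) = tr (cm q (sum_list xs)) \<circ> tr (cm q (sum_list ys))"
      by (rule Cons.IH[OF g(1) Cons.prems(2)])
    also have "tr (cm q x) \<circ> (tr (cm q (sum_list xs)) \<circ> tr (cm q (sum_list ys)))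
        = (tr (cm q x) \<circ> tr (cm q (sum_list xs))) \<circ> tr (cm q (sum_list ys))"
      by (simp add: comp_assoc)
    also have "tr (cm q x) \<circ> tr (cm q (sum_list xs)) = tr (cm q (x + sum_list xs))"
      by (rule mult[OF g1(2) Cons.prems(2) g(2) u(2), symmetric])
    finally show ?case by (simp add: add.assoc)
  qed
  have notX: "sum_list xs \<notin> ?X" if gx: "G (xs @ ys)" and ne: "xs \<noteq> []" for xs ys
  proof -
    obtain x zs where xs: "xs = x # zs" using ne by (meson neq_Nil_conv)
    then have "\<forall>i\<le>length (zs @ ys). good x (sum_list (take i (zs @ ys)))" using gx G by auto
    from this[rule_format, of "length zs"] show ?thesis unfolding good_def xs by simp
  qed
  have Gdrop: "G (drop i bs)" if "G bs" for i bs
    using that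
  proof (induction bs arbitrary: i)
    case (Cons x bs)
    then show ?case using G(2) by (cases i) simp_all
  qed simp
  define F where "F = {h. \<forall>n. (n \<in> {n. adj (v 8) n} \<longrightarrow> h n \<in> {n. adj (v 8) n}) \<and> (n \<notin> {n. adj (v 8) n} \<longrightarrow> h n = v 8)}"
  have F: "finite F" unfolding F_def by (rule finite_set_of_finite_funs[OF fin fin])
  define R where "R = {f. \<forall>q. (q \<in> S \<longrightarrow> f q \<in> F) \<and> (q \<notin> S \<longrightarrow> f q = id)}"
  have R: "finite R" unfolding R_def by (rule finite_set_of_finite_funs[OF S F])
  obtain bs where bs: "length bs = card R" "G bs" using ex by blast
  define \<psi> where "\<psi> k = (\<lambda>q. if q \<in> S then tr (cm q (sum_list (drop k bs))) else id)" for k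
  have dropU: "sum_list (drop k bs) \<in> U v 1" for k
    using GU[OF Gdrop[OF bs(2)], of "length bs" k] by simp
  have "\<psi> ` {..card R} \<subseteq> R"
  proof -
    have "tr (cm q (sum_list (drop k bs))) \<in> F" if "q \<in> S" for q k
    proof -
      have "cm q (sum_list (drop k bs)) \<in> C" using C[OF that dropU] .
      then show ?thesis using fixed[of "cm q (sum_list (drop k bs))"] Cf
        unfolding F_def tr_def by auto
    qed
    then show ?thesis unfolding R_def \<psi>_def by auto
  qed
  then have "card (\<psi> ` {..card R}) \<le> card R" using R by (intro card_mono)
  then have "\<not> inj_on \<psi> {..card R}" using card_image[of \<psi> "{..card R}"] by auto
  then obtain i j where "i \<in> {..card R}" "j \<in> {..card R}" "i \<noteq> j" "\<psi> i = \<psi> j" unfolding inj_on_def by blast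
  then obtain k l where kl: "k < l" "l \<le> length bs" "\<psi> k = \<psi> l"
    using bs(1) by (metis atMost_iff nat_neq_iff)
  define xs where "xs = take (l - k) (drop k bs)"
  have d: "drop k bs = xs @ drop l bs" unfolding xs_def using kl(1)
    by (metis append_take_drop_id drop_drop le_add_diff_inverse2 less_imp_le)
  have xs: "xs \<noteq> []" unfolding xs_def using kl by auto
  have GG: "G (xs @ drop l bs)" using Gdrop[OF bs(2), of k] d by simp
  have xsU: "sum_list xs \<in> U v 1" using GU[OF GG, of "length xs"] by simp
  have "cm q (sum_list xs) \<in> K (v 8)" if q: "q \<in> S" for q
  proof -
    define y where "y = cm q (sum_list (drop l bs))"
    have y: "y \<in> aut" "y \<cdot> v 8 = v 8" using Cf C[OF q dropU] unfolding y_def by blast+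
    have c: "cm q (sum_list xs) \<in> aut" "cm q (sum_list xs) \<cdot> v 8 = v 8" using Cf C[OF q xsU] by blast+
    have "tr (cm q (sum_list (drop k bs))) = tr y" using fun_cong[OF kl(3), of q] q unfolding \<psi>_def y_def by simp
    then have e: "tr (cm q (sum_list xs)) \<circ> tr y = tr y" using split[OF GG q] d unfolding y_def by simp
    have "cm q (sum_list xs) \<cdot> n = n" if n: "adj (v 8) n" for n
    proof -
      have m: "adj (v 8) ((- y) \<cdot> n)" using aut_adj_minus[OF y(1), of n "v 8"] y(2) n adj_comm by metis
      have "(tr (cm q (sum_list xs)) \<circ> tr y) ((- y) \<cdot> n) = tr y ((- y) \<cdot> n)" unfolding e ..
      then show ?thesis using m n unfolding tr_def by simp
    qed
    then show ?thesis unfolding K_def using c by simp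
  qed
  then have "sum_list xs \<in> ?X" using xsU by blast
  then show False using notX[OF GG xs] by blast
qed

lemma U_infinite:
  assumes v: "apt v" and inf: "infinite {n. adj (v 7) n}"
  shows "infinite (U v 1)"
proof
  assume "finite (U v 1)"
  moreover have "{n. adj (v 7) n} \<subseteq> insert (v 6) ((\<lambda>g. g \<cdot> v 8) ` U v 1)"
  proof
    fix n assume n: "n \<in> {n. adj (v 7) n}"
    show "n \<in> insert (v 6) ((\<lambda>g. g \<cdot> v 8) ` U v 1)"
    proof (cases "n = v 6")
      case False
      then obtain g where "g \<in> U v 1" "g \<cdot> v 8 = n"
        using U_transR[OF v, of 1 "v 8" n] n by (auto simp: apt_adj[OF v])
      then show ?thesis by blast
    qed simp
  qed
  ultimately show False using inf finite_subset by blast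
qed

text \<open>Let \<open>y = v 8\<close> have finitely many neighbours. For a nontrivial
  \<open>f\<close> in \<open>U v 6\<close> there is then a nontrivial \<open>b\<close> in
  \<open>U v 1\<close> such that \<open>cm f b\<close> acts trivially around \<open>v 8\<close>. It
  follows that \<open>f\<close> fixes the image \<open>z\<close> of \<open>v 9\<close> under
  \<open>- b\<close>, hence a path that leaves the apartment at \<open>v 7\<close>, and rigidity
  gives \<open>f = 0\<close>.\<close>

lemma infinite_adj:
  assumes xy: "adj x y" and inf: "infinite {n. adj x n}"
  shows "infinite {n. adj y n}"
proof
  assume fin: "finite {n. adj y n}"
  obtain w where w: "apt w" "w 0 = x" "w 1 = y" using apt_exists_1[OF xy] by blast
  define v where "v = (\<lambda>i. w (i + (- 7)))"
  have v: "apt v" unfolding v_def by (rule apt_shift[OF w(1)])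
  have v7: "v 7 = x" "v 8 = y" using w by (simp_all add: v_def)
  have fin: "finite {n. adj (v 8) n}" using fin v7 by simp
  have infU: "infinite (U v 1)" using U_infinite[OF v] inf v7 by simp
  note fix1 = U_fix[OF v]
  \<comment> \<open>A commutator with \<open>U v 1\<close> leads from \<open>Q k\<close> to
    \<open>Q (k - 1)\<close>, and \<open>Q 3\<close> is \<open>U v 2\<close>, which commutes with
    \<open>U v 1\<close>. So four applications of \<open>cm_trivial_step\<close> suffice.\<close>
  define Q where "Q k = {g. \<forall>i. k \<le> i \<and> i \<le> 7 \<longrightarrow> g \<in> K (v i)}" for k :: int
  have Qf: "p \<in> aut \<and> p \<cdot> v 8 = v 8" if "p \<in> Q k" "k \<le> 7" for p k
  proof -
    have "p \<in> K (v 7)" using that unfolding Q_def by simp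
    then show ?thesis using K_aut K_apt_fix[OF v, of p 7 8] by simp
  qed
  have Qfix: "p \<cdot> v (k - 1) = v (k - 1)" if "p \<in> Q k" "k \<le> 7" for p k
  proof -
    have "p \<in> K (v k)" using that unfolding Q_def by simp
    then show ?thesis using K_apt_fix[OF v, of p k "k - 1"] by simp
  qed
  have step: "cm q b \<in> Q (k - 1)" if q: "q \<in> Q k" and k: "3 < k" "k \<le> 7" and b: "b \<in> U v 1" for q b k
  proof -
    have "cm q b \<in> K (v i)" if i: "k - 1 \<le> i" "i \<le> 7" for i
    proof (cases "i = k - 1")
      case True
      have "i = 1 + 1 \<or> i = 1 + 2 \<or> i = 1 + 3 \<or> i = 1 + 4 \<or> i = 1 + 5" using True k by arith
      then have "b \<in> K (v i)" by (rule U_K[OF b])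
      then show ?thesis by (rule K_cm') (use Qf[OF q] Qfix[OF q] k True in simp_all)
    next
      case False
      then have "q \<in> K (v i)" using q i unfolding Q_def by simp
      then show ?thesis by (rule K_cm) (use U_aut[OF b] fix1[OF b] i k in simp_all)
    qed
    then show ?thesis unfolding Q_def by blast
  qed
  have base: "infinite {b \<in> U v 1. \<forall>q\<in>P. cm q b \<in> K (v 8)}" if "P \<subseteq> Q 3" for P
  proof -
    have "cm q b \<in> K (v 8)" if "q \<in> P" "b \<in> U v 1" for q b
    proof -
      have "q \<in> U v (1 + 1)" using \<open>P \<subseteq> Q 3\<close> that unfolding Q_def U_def by auto
      then have "com q b" using U_commute1[OF v that(2)] com_sym by blast
      then show ?thesis unfolding com_iff_cm by simp
    qed
    then have "{b \<in> U v 1. \<forall>q\<in>P. cm q b \<in> K (v 8)} = U v 1" by blast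
    then show ?thesis using infU by simp
  qed
  have lev: "infinite {b \<in> U v 1. \<forall>q\<in>P. cm q b \<in> K (v 8)}"
    if "finite P" "P \<subseteq> Q (k + 1)" "3 \<le> k" "k \<le> 6"
      "\<And>P'. finite P' \<Longrightarrow> P' \<subseteq> Q k \<Longrightarrow> infinite {b \<in> U v 1. \<forall>q\<in>P'. cm q b \<in> K (v 8)}" for P k
  proof (rule cm_trivial_step[OF v that(1) _ _ fin that(5)])
    show "cm q b \<in> Q k" if "q \<in> P" "b \<in> U v 1" for q b
      using step[of q "k + 1" b] that \<open>P \<subseteq> Q (k + 1)\<close> \<open>3 \<le> k\<close> \<open>k \<le> 6\<close> by auto
    show "p \<in> aut \<and> p \<cdot> v 8 = v 8" if "p \<in> Q k" for p
      using Qf that \<open>k \<le> 6\<close> by simp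
  qed
  have lev4: "infinite {b \<in> U v 1. \<forall>q\<in>P. cm q b \<in> K (v 8)}" if "finite P" "P \<subseteq> Q 4" for P
    using lev[of P 3] that base by simp
  have lev5: "infinite {b \<in> U v 1. \<forall>q\<in>P. cm q b \<in> K (v 8)}" if "finite P" "P \<subseteq> Q 5" for P
    using lev[of P 4] that lev4 by simp
  have lev6: "infinite {b \<in> U v 1. \<forall>q\<in>P. cm q b \<in> K (v 8)}" if "finite P" "P \<subseteq> Q 6" for P
    using lev[of P 5] that lev5 by simp
  obtain f where f: "f \<in> U v 6" "f \<noteq> 0" using U_nontrivial[OF v] by blast
  have faut: "f \<in> aut" using U_aut f by blast
  have "infinite {b \<in> U v 1. \<forall>q\<in>{f}. cm q b \<in> K (v 8)}"
  proof (rule cm_trivial_step[OF v _ _ _ fin lev6])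
    show "cm q b \<in> Q 6" if "q \<in> {f}" "b \<in> U v 1" for q b
    proof -
      have "cm b f \<in> K (v i)" if i: "6 \<le> i" "i \<le> 7" for i
        using U_cm_K[OF v \<open>b \<in> U v 1\<close> f(1), of i] i by simp
      then show ?thesis using that cm_swap[of q b] unfolding Q_def by simp
    qed
  qed (use Qf in simp_all)
  then have "\<not> {b \<in> U v 1. \<forall>q\<in>{f}. cm q b \<in> K (v 8)} \<subseteq> {0}" using finite_subset by blast
  then obtain b where b: "b \<in> U v 1" "b \<noteq> 0" "cm f b \<in> K (v 8)" by auto
  have baut: "b \<in> aut" using U_aut b by blast
  note va = apt_adj[OF v]
  define z where "z = (- b) \<cdot> v 9"
  have f9: "f \<cdot> v k = v k" if "6 \<le> k" "k \<le> 12" for k using fix1[OF f(1)] that by simp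
  have "cm f b \<cdot> v 9 = v 9" using K_adj[OF b(3)] by (simp add: va)
  then have "f \<cdot> b \<cdot> (- f) \<cdot> z = v 9" by (simp add: cm_def z_def)
  then have "f \<cdot> b \<cdot> (- f) \<cdot> z = f \<cdot> v 9" using f9[of 9] by simp
  then have "b \<cdot> (- f) \<cdot> z = v 9" by simp
  then have "(- f) \<cdot> z = z" unfolding z_def by (metis ap_minus(1))
  then have fz: "f \<cdot> z = z" by (metis ap_minus_eq)
  have b7: "(- b) \<cdot> v 7 = v 7" using fix1[OF U_minus[OF b(1)]] by simp
  have b8: "(- b) \<cdot> v 8 \<noteq> v 8" using U_free[OF v U_minus[OF b(1)], of 8] b(2) by auto
  have a: "adj ((- b) \<cdot> v 9) ((- b) \<cdot> v 8)" "adj ((- b) \<cdot> v 8) ((- b) \<cdot> v 7)" "adj ((- b) \<cdot> v 7) ((- b) \<cdot> v 8)"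
    "(- b) \<cdot> v 9 \<noteq> (- b) \<cdot> v 7" using aut_minus[OF baut] by (simp_all add: va)
  have "f = 0"
  proof (rule rigid_path[OF faut])
    show "path [z, (- b) \<cdot> v 8, v 7, v 8, v 9, v 10, v 11, v 12]"
      using a b7 b8 unfolding z_def by (simp add: va)
    have "f \<in> K (v 7)" using U_K[OF f(1)] by simp
    then have "f \<cdot> (- b) \<cdot> v 8 = (- b) \<cdot> v 8" using K_adj a(3) b7 by metis
    then show "\<forall>x\<in>set [z, (- b) \<cdot> v 8, v 7, v 8, v 9, v 10, v 11, v 12]. f \<cdot> x = x"
      using fz f9 by simp
    show "f \<in> K (v 8)" "f \<in> K (v 9)" using U_K[OF f(1)] by simp_all
  qed
  then show False using f by blast
qed

lemma infinite_adj_all: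
  assumes xx: "adj x x'" and inf: "infinite {n. adj x n}" and y: "adj y y'"
  shows "infinite {n. adj y n}"
proof -
  have "path xs \<Longrightarrow> infinite {n. adj (hd xs) n} \<Longrightarrow> infinite {n. adj (last xs) n}" for xs
  proof (induction xs rule: induct_list012)
    case (3 x y zs)
    have "adj x y" "path (y # zs)" using 3(3) by (cases zs; auto)+
    then show ?case using 3(2,4) infinite_adj[of x y] by simp
  qed simp_all
  then show ?thesis using diameter[OF xx y] inf by metis
qed

end

section \<open>Domestic collineations\<close>

lemma finite_if_all_equal: "(\<And>x y. x \<in> A \<Longrightarrow> y \<in> A \<Longrightarrow> x = y) \<Longrightarrow> finite A"
  by (metis finite.simps finite_insert is_singletonI' is_singleton_def)

context hexagon
begin

lemma opposite_path:
  assumes o: "dst 6 p q" and D: "adj p D"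
  shows "\<exists>y M z E. path [p, D, y, M, z, E, q]"
proof -
  obtain a b c d e where p: "path [p, a, b, c, d, e, q]" using o dst_6 by blast
  show ?thesis
  proof (cases "a = D")
    case True
    then show ?thesis using p by blast
  next
    case False
    then have "path [D, p, a, b, c, d, e, q]" using p D adj_sym by simp
    from apt_exists_7[OF this] obtain v where v: "apt v" "v 0 = D" "v 1 = p" "v 7 = q" by blast
    have "path [v 13, v 12, v 11, v 10, v 9, v 8, v 7]" by (simp add: apt_adj[OF v(1)])
    then have "path [p, D, v 11, v 10, v 9, v 8, q]"
      using apt_period[OF v(1), of 13 1] apt_period[OF v(1), of 12 0] v by simp
    then show ?thesis by blast
  qed
qed

end

text \<open>Elements of type \<open>\<not> t\<close> take the part of points: the central elations
  are those whose root has a middle of type \<open>t\<close>. Both values of \<open>t\<close> are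
  needed, one being dual to the other.\<close>

locale exceptional_situation = moufang_hexagon +
  fixes t :: bool and \<theta> :: "'a bijection"
  assumes semi: "semicentral t"
    and inf_adj: "adj x y \<Longrightarrow> infinite {n. adj x n}"
    and aut_\<theta>: "\<theta> \<in> aut"
    and no_chamber: "adj x y \<Longrightarrow> dst 6 x (\<theta> \<cdot> x) \<Longrightarrow> \<not> dst 6 y (\<theta> \<cdot> y)"
begin

definition opp :: "'a \<Rightarrow> bool" where
  "opp x \<longleftrightarrow> dst 6 x (\<theta> \<cdot> x)"

text \<open>If the path through \<open>D\<close> did not end with the image of \<open>D\<close>, it
  could be continued to that image. Without its first element it would then show \<open>D\<close> to
  be opposite to its image, against \<open>no_chamber\<close>.\<close>

lemma opp_line_path:
  assumes p: "opp p" "adj p D"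
  shows "\<exists>y M z. path [p, D, y, M, z, \<theta> \<cdot> D, \<theta> \<cdot> p]"
proof -
  obtain y M z E where e: "path [p, D, y, M, z, E, \<theta> \<cdot> p]"
    using opposite_path p unfolding opp_def by blast
  have "E = \<theta> \<cdot> D"
  proof (rule ccontr)
    assume "E \<noteq> \<theta> \<cdot> D"
    moreover have "adj (\<theta> \<cdot> p) (\<theta> \<cdot> D)" using p aut_\<theta> by simp
    ultimately have "path [D, y, M, z, E, \<theta> \<cdot> p, \<theta> \<cdot> D]" using e by simp
    then have "dst 6 D (\<theta> \<cdot> D)" using dst_6 by blast
    then show False using no_chamber p unfolding opp_def by blast
  qed
  then show ?thesis using e by blast
qed

lemma opp_line:
  assumes p: "opp p" "adj p D"
  obtains y M z where "path [p, D, y, M, z, \<theta> \<cdot> D, \<theta> \<cdot> p]"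
    "\<And>x. adj D x \<Longrightarrow> \<not> opp x \<Longrightarrow> x = y \<or> \<theta> \<cdot> x = z"
proof -
  obtain y M z where e: "path [p, D, y, M, z, \<theta> \<cdot> D, \<theta> \<cdot> p]" using opp_line_path p by blast
  \<comment> \<open>With \<open>p\<close> and its image replaced by \<open>x\<close> and its image,
    the same path still has six steps and no backtracking.\<close>
  have "opp x" if "adj D x" "x \<noteq> y" "\<theta> \<cdot> x \<noteq> z" for x
  proof -
    have "adj (\<theta> \<cdot> D) (\<theta> \<cdot> x)" using that aut_\<theta> by simp
    then have "path [x, D, y, M, z, \<theta> \<cdot> D, \<theta> \<cdot> x]" using e that adj_sym by auto
    then show ?thesis unfolding opp_def dst_6 by blast
  qed
  then show ?thesis using that e by blast
qed

lemma opp_line_two: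
  assumes p: "opp p" "adj p D"
  shows "\<exists>y z. \<forall>x. adj D x \<longrightarrow> \<not> opp x \<longrightarrow> x = y \<or> x = z"
proof -
  obtain y M z where "\<And>x. adj D x \<Longrightarrow> \<not> opp x \<Longrightarrow> x = y \<or> \<theta> \<cdot> x = z"
    using opp_line[OF p] by metis
  then show ?thesis using ap_minus_eq[of \<theta> z] by metis
qed

lemma opp_line_finite: "opp p \<Longrightarrow> adj p D \<Longrightarrow> finite {x. adj D x \<and> \<not> opp x}"
proof -
  assume "opp p" "adj p D"
  then obtain y z where "\<forall>x. adj D x \<longrightarrow> \<not> opp x \<longrightarrow> x = y \<or> x = z" using opp_line_two by blast
  then have "{x. adj D x \<and> \<not> opp x} \<subseteq> {y, z}" by blast
  then show ?thesis by (rule finite_subset) simp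
qed

lemma opp_minus: "opp p \<Longrightarrow> dst 6 p ((- \<theta>) \<cdot> p)"
  using dst_aut[OF aut_minus[OF aut_\<theta>], of 6 p "\<theta> \<cdot> p"] dst_sym unfolding opp_def by simp

lemma not_opp_trace:
  assumes p: "opp p" and x: "dst 2 p x" "\<not> opp x"
  shows "x \<in> trace p (\<theta> \<cdot> p) \<or> x \<in> trace p ((- \<theta>) \<cdot> p)"
proof -
  obtain D where D: "path [p, D, x]" using x dst_2 by blast
  then have "adj p D" "adj D x" by auto
  obtain y M z where e: "path [p, D, y, M, z, \<theta> \<cdot> D, \<theta> \<cdot> p]"
    "\<And>x. adj D x \<Longrightarrow> \<not> opp x \<Longrightarrow> x = y \<or> \<theta> \<cdot> x = z"
    using opp_line[OF p \<open>adj p D\<close>] by metis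
  consider "x = y" | "\<theta> \<cdot> x = z" using e(2) \<open>adj D x\<close> x(2) by blast
  then show ?thesis
  proof cases
    case 1
    then show ?thesis using path_trace[OF e(1)] by blast
  next
    case 2
    then have "path [p, D, y, M, \<theta> \<cdot> x]" using e by simp
    then have "dst 4 p (\<theta> \<cdot> x)" using dst_4 by blast
    then have "dst 4 ((- \<theta>) \<cdot> p) x" using dst_aut[OF aut_minus[OF aut_\<theta>], of 4 p "\<theta> \<cdot> x"] by simp
    then show ?thesis using x dst_sym unfolding trace_def by blast
  qed
qed

text \<open>Here \<open>x = y\<close> or \<open>\<theta> \<cdot> x = z\<close>, and either shortens
  the path from \<open>x\<close> to its image to at most four steps. Consequently one good element
  on a trace distinguishes it from both exceptional traces.\<close>

lemma trace_not_opp: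
  assumes p: "opp p" and x: "x \<in> trace p (\<theta> \<cdot> p) \<or> x \<in> trace p ((- \<theta>) \<cdot> p)"
  shows "\<not> opp x"
proof
  assume ox: "opp x"
  have "dst 2 p x" using x unfolding trace_def by blast
  then obtain D where D: "path [p, D, x]" using dst_2 by blast
  then have a: "adj p D" "adj D x" "adj x D" "x \<noteq> p" "adj (\<theta> \<cdot> D) (\<theta> \<cdot> x)"
    using aut_\<theta> adj_sym by auto
  obtain y M z where e: "path [p, D, y, M, z, \<theta> \<cdot> D, \<theta> \<cdot> p]" using opp_line_path[OF p a(1)] by blast
  have no: "\<not> dst n x (\<theta> \<cdot> x)" if "n \<le> 5" for n
    using dst_unique[OF _ ox[unfolded opp_def], of n] that by auto
  have "x = y \<or> \<theta> \<cdot> x = z"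
  proof (rule ccontr)
    assume n: "\<not> (x = y \<or> \<theta> \<cdot> x = z)"
    then have "path [p, D, y, M, z, \<theta> \<cdot> D, \<theta> \<cdot> x]" "path [x, D, y, M, z, \<theta> \<cdot> D, \<theta> \<cdot> p]"
      using e a by auto
    then have "dst 6 p (\<theta> \<cdot> x)" "dst 6 x (\<theta> \<cdot> p)" using dst_6 by blast+
    moreover have "dst 4 x (\<theta> \<cdot> p) \<or> dst 4 (\<theta> \<cdot> x) p"
      using x dst_aut[OF aut_\<theta>, of 4 x "(- \<theta>) \<cdot> p"] unfolding trace_def by auto
    ultimately show False
      using dst_unique[of 4 x "\<theta> \<cdot> p" 6] dst_unique[of 4 p "\<theta> \<cdot> x" 6] dst_sym by force
  qed
  moreover have "\<not> (x = y \<and> \<theta> \<cdot> x = z)"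
  proof
    assume "x = y \<and> \<theta> \<cdot> x = z"
    then have "path [x, M, \<theta> \<cdot> x]" using e by auto
    then have "dst 2 x (\<theta> \<cdot> x)" using dst_2 by blast
    then show False using no[of 2] by simp
  qed
  moreover have "\<not> (x = y \<and> \<theta> \<cdot> x \<noteq> z)"
  proof
    assume "x = y \<and> \<theta> \<cdot> x \<noteq> z"
    then have "path [x, M, z, \<theta> \<cdot> D, \<theta> \<cdot> x]" using e a by auto
    then have "dst 4 x (\<theta> \<cdot> x)" using dst_4 by blast
    then show False using no[of 4] by simp
  qed
  moreover have "\<not> (x \<noteq> y \<and> \<theta> \<cdot> x = z)"
  proof
    assume "x \<noteq> y \<and> \<theta> \<cdot> x = z"
    then have "path [x, D, y, M, \<theta> \<cdot> x]" using e a by auto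
    then have "dst 4 x (\<theta> \<cdot> x)" using dst_4 by blast
    then show False using no[of 4] by simp
  qed
  ultimately show False by blast
qed

definition bad :: "'a \<Rightarrow> 'a \<Rightarrow> bool" where
  "bad a u \<longleftrightarrow> trace a u = trace a (\<theta> \<cdot> a) \<or> trace a u = trace a ((- \<theta>) \<cdot> a)"

text \<open>The elements that are not good lie in the two exceptional traces of \<open>a\<close>,
  and by \<open>regular\<close> a trace different from both meets each of them at most once.\<close>

lemma trace_finite_not_opp:
  assumes a: "opp a" "pt a \<longleftrightarrow> \<not> t" and u: "dst 6 a u" "\<not> bad a u"
  shows "finite {x \<in> trace a u. \<not> opp x}"
proof -
  have one: "finite (trace a u \<inter> trace a w)" if w: "dst 6 a w" "trace a u \<noteq> trace a w" for w
  proof (rule finite_if_all_equal)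
    fix x y assume "x \<in> trace a u \<inter> trace a w" "y \<in> trace a u \<inter> trace a w"
    then have xy: "x \<in> trace a u" "x \<in> trace a w" "y \<in> trace a u" "y \<in> trace a w" by auto
    show "x = y"
    proof (rule ccontr)
      assume "x \<noteq> y"
      then have "trace a u \<subseteq> trace a w" "trace a w \<subseteq> trace a u"
        using regular[OF semi a(2) u(1) w(1) xy] regular[OF semi a(2) w(1) u(1) xy(2,1,4,3)] by blast+
      then show False using w(2) by blast
    qed
  qed
  have "{x \<in> trace a u. \<not> opp x} \<subseteq> trace a u \<inter> trace a (\<theta> \<cdot> a) \<union> trace a u \<inter> trace a ((- \<theta>) \<cdot> a)"
    using not_opp_trace[OF a(1)] unfolding trace_def by blast
  moreover have "finite (trace a u \<inter> trace a (\<theta> \<cdot> a))" "finite (trace a u \<inter> trace a ((- \<theta>) \<cdot> a))"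
    using one a(1) u(2) opp_minus unfolding bad_def opp_def by blast+
  ultimately show ?thesis using finite_subset by blast
qed

text \<open>On another line \<open>D'\<close> through \<open>a\<close> take the element
  \<open>c'\<close> of the trace. Its path to \<open>u\<close> does not arrive through
  \<open>B\<close>, so it continues over \<open>B\<close> to \<open>u'\<close> and makes
  \<open>c'\<close> opposite to \<open>u'\<close>.\<close>

lemma trace_eq_unique:
  assumes p: "path [a, D, c, C, b, B]" and u: "adj B u" "u \<noteq> b" "adj B u'" "u' \<noteq> b"
    and e: "trace a u = trace a u'"
  shows "u = u'"
proof (rule ccontr)
  assume ne: "u \<noteq> u'"
  have q: "path [a, D, c, C, b, B, u]" using p u by auto
  then have o: "dst 6 a u" using dst_6 by blast
  have "adj a D" using p by simp
  then obtain D' where D': "adj a D'" "D' \<noteq> D" using thick_adj by blast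
  obtain c' C' b' B' where q': "path [a, D', c', C', b', B', u]" using opposite_path[OF o D'(1)] by blast
  have "B' \<noteq> B"
  proof
    assume "B' = B"
    then have "path [a, D', c', C', b', B]" using q' by simp
    then have "[a, D', c', C', b', B] = [a, D, c, C, b, B]" using p by (rule path_unique) simp_all
    then show False using D' by simp
  qed
  then have "path [c', C', b', B', u, B, u']" using q' u ne adj_sym by simp
  then have "dst 6 c' u'" using dst_6 by blast
  moreover have "dst 4 c' u'" using path_trace[OF q'] e unfolding trace_def by simp
  ultimately show False using dst_unique[of 4 c' u' 6] by simp
qed

lemma bad_finite:
  assumes p: "path [a, D, c, C, b, B]"
  shows "finite {u. adj B u \<and> u \<noteq> b \<and> bad a u}"
proof -
  have "finite {u. adj B u \<and> u \<noteq> b \<and> trace a u = T}" for T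
    by (rule finite_if_all_equal) (use trace_eq_unique[OF p] in auto)
  moreover have "{u. adj B u \<and> u \<noteq> b \<and> bad a u} \<subseteq>
    {u. adj B u \<and> u \<noteq> b \<and> trace a u = trace a (\<theta> \<cdot> a)} \<union> {u. adj B u \<and> u \<noteq> b \<and> trace a u = trace a ((- \<theta>) \<cdot> a)}"
    unfolding bad_def by blast
  ultimately show ?thesis using finite_subset by blast
qed

text \<open>An element \<open>c\<close> of the trace has only one path to \<open>u\<close>, so
  finitely many such \<open>c\<close> account for finitely many \<open>N\<close>.\<close>

lemma line_finite_not_opp:
  assumes a: "opp a" "pt a \<longleftrightarrow> \<not> t" and u: "dst 6 a u" "\<not> bad a u"
  shows "finite {N. \<exists>D c C w. path [a, D, c, C, w, N, u] \<and> \<not> opp c}"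
proof -
  have "finite {N. \<exists>D C w. path [a, D, c, C, w, N, u]}" for c
  proof (rule finite_if_all_equal)
    fix N N' assume "N \<in> {N. \<exists>D C w. path [a, D, c, C, w, N, u]}" "N' \<in> {N. \<exists>D C w. path [a, D, c, C, w, N, u]}"
    then obtain D C w D' C' w' where "path [a, D, c, C, w, N, u]" "path [a, D', c, C', w', N', u]" by blast
    then have "path [c, C, w, N, u]" "path [c, C', w', N', u]" by simp_all
    then have "[c, C, w, N, u] = [c, C', w', N', u]" by (rule path_unique) simp_all
    then show "N = N'" by simp
  qed
  then have "finite (\<Union>c\<in>{x \<in> trace a u. \<not> opp x}. {N. \<exists>D C w. path [a, D, c, C, w, N, u]})"
    using trace_finite_not_opp[OF a u] by blast
  moreover have "{N. \<exists>D c C w. path [a, D, c, C, w, N, u] \<and> \<not> opp c} \<subseteq>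
      (\<Union>c\<in>{x \<in> trace a u. \<not> opp x}. {N. \<exists>D C w. path [a, D, c, C, w, N, u]})" (is "?L \<subseteq> ?R")
  proof
    fix N assume "N \<in> ?L"
    then obtain D c C w where N: "path [a, D, c, C, w, N, u]" "\<not> opp c" by blast
    then have "c \<in> {x \<in> trace a u. \<not> opp x}" using path_trace[OF N(1)] by blast
    moreover have "N \<in> {N. \<exists>D C w. path [a, D, c, C, w, N, u]}" using N(1) by blast
    ultimately show "N \<in> ?R" by (rule UN_I)
  qed
  ultimately show ?thesis by (rule finite_subset[rotated])
qed

section \<open>Choices in general position\<close>

lemma infinite_pick: "infinite A \<Longrightarrow> finite B \<Longrightarrow> \<exists>x\<in>A. x \<notin> B"
  by (meson finite_subset subsetI)

text \<open>Distance 1 would be a chamber mapped to an opposite one. Distance 5 is reduced: for a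
  generic \<open>u\<close> on \<open>l\<close> and a generic good \<open>N\<close> through
  \<open>u\<close>, the element \<open>c'\<close> on the path from \<open>p\<close> to
  \<open>N\<close> is good and has distance 3 from \<open>N\<close>.\<close>

lemma opp_at_distance_3:
  assumes p: "opp p" "pt p \<longleftrightarrow> \<not> t" "adj p p'" and l: "opp l" "pt l \<longleftrightarrow> t" "adj l l'"
  shows "\<exists>p C y N. path [p, C, y, N] \<and> opp p \<and> opp N \<and> (pt p \<longleftrightarrow> \<not> t)"
proof -
  obtain n where n: "n \<le> 6" "dst n p l" using dst_exists p l by blast
  have "odd n" using dst_pt[OF n(2)] p l by simp
  moreover have "n = 1 \<or> n = 3 \<or> n = 5 \<or> even n" using n(1) by presburger
  ultimately consider "n = 1" | "n = 3" | "n = 5" by blast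
  then show ?thesis
  proof cases
    case 1
    then have "adj p l" using n dst_1 by simp
    then show ?thesis using no_chamber p l unfolding opp_def by blast
  next
    case 2
    then show ?thesis using n dst_3 p l by blast
  next
    case 3
    then obtain D c C b where q: "path [p, D, c, C, b, l]" using n dst_5 by blast
    have "finite ({b} \<union> {u. adj l u \<and> u \<noteq> b \<and> bad p u})" using bad_finite[OF q] by simp
    from infinite_pick[OF inf_adj[OF l(3)] this] obtain u
      where u: "adj l u" "u \<noteq> b" "\<not> bad p u" by auto
    have "path [p, D, c, C, b, l, u]" using q u by auto
    then have o: "dst 6 p u" using dst_6 by blast
    have "finite ({x. adj u x \<and> \<not> opp x} \<union> {N. \<exists>D c C w. path [p, D, c, C, w, N, u] \<and> \<not> opp c})"
      using opp_line_finite[OF l(1) u(1)] line_finite_not_opp[OF p(1,2) o u(3)] by blast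
    from infinite_pick[OF inf_adj[OF adj_sym[OF u(1)]] this] obtain N
      where N: "adj u N" "opp N" "\<nexists>D c C w. path [p, D, c, C, w, N, u] \<and> \<not> opp c" by blast
    obtain w C' c' D' where "path [u, N, w, C', c', D', p]" using opposite_path[OF dst_sym[OF o] N(1)] by blast
    then have r: "path (rev [u, N, w, C', c', D', p])" unfolding path_rev .
    then have r: "path [p, D', c', C', w, N, u]" by simp
    then have "opp c'" "pt c' \<longleftrightarrow> \<not> t" using N p adj_pt[of p D'] adj_pt[of D' c'] by auto
    moreover have "path [c', C', w, N]" using r by simp
    ultimately show ?thesis using N by blast
  qed
qed

lemma trace_infinite:
  assumes o: "dst 6 p x" and p: "adj p p'"
  shows "infinite (trace p x)"
proof
  assume "finite (trace p x)"
  moreover have "finite {D. path [p, D, c]}" for c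
  proof (rule finite_if_all_equal)
    fix D D' assume "D \<in> {D. path [p, D, c]}" "D' \<in> {D. path [p, D, c]}"
    then have "path [p, D, c]" "path [p, D', c]" by blast+
    then have "[p, D, c] = [p, D', c]" by (rule path_unique) simp_all
    then show "D = D'" by simp
  qed
  ultimately have "finite (\<Union>c\<in>trace p x. {D. path [p, D, c]})" by blast
  moreover have "{n. adj p n} \<subseteq> (\<Union>c\<in>trace p x. {D. path [p, D, c]})"
  proof
    fix D assume "D \<in> {n. adj p n}"
    then obtain c C b B where e: "path [p, D, c, C, b, B, x]" using opposite_path[OF o] by blast
    then have "path [p, D, c]" by simp
    then show "D \<in> (\<Union>c\<in>trace p x. {D. path [p, D, c]})" using path_trace[OF e] by blast
  qed
  ultimately show False using inf_adj[OF p] finite_subset by blast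
qed

text \<open>An apartment through \<open>y\<close>, \<open>p\<close> and a good \<open>a\<close> on a
  second line through \<open>p\<close> has \<open>x = v 8\<close> opposite to
  \<open>p = v 2\<close>. Its trace contains \<open>y\<close> and \<open>a\<close>, and
  \<open>a\<close> guarantees that the trace is not exceptional.\<close>

lemma opp_trace_exists:
  assumes p: "opp p" "pt p \<longleftrightarrow> \<not> t" and C: "adj p C" "adj C y" "y \<noteq> p"
  shows "\<exists>x. dst 6 p x \<and> y \<in> trace p x \<and> infinite {a \<in> trace p x. opp a}"
proof -
  obtain D where D: "adj p D" "D \<noteq> C" using thick_adj[OF C(1)] by blast
  obtain a where a: "adj D a" "a \<noteq> p" "opp a"
    using infinite_pick[OF inf_adj[OF adj_sym[OF D(1)]], of "{p} \<union> {x. adj D x \<and> \<not> opp x}"]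
      opp_line_finite[OF p(1) D(1)] by auto
  have "path [y, C, p, D, a]" using a D C adj_sym by auto
  then obtain v where v: "apt v" "v 0 = y" "v 1 = C" "v 2 = p" "v 3 = D" "v 4 = a"
    using apt_exists_4 by blast
  have q1: "path [v 2, v 3, v 4, v 5, v 6, v 7, v 8]" by (simp add: apt_adj[OF v(1)])
  have "path [v 14, v 13, v 12, v 11, v 10, v 9, v 8]" by (simp add: apt_adj[OF v(1)])
  then have q2: "path [p, C, y, v 11, v 10, v 9, v 8]"
    using apt_period[OF v(1), of 14 2] apt_period[OF v(1), of 13 1] apt_period[OF v(1), of 12 0] v by simp
  have o: "dst 6 p (v 8)" using q2 dst_6 by blast
  have at: "a \<in> trace p (v 8)" using path_trace[OF q1] v by simp
  have "\<not> bad p (v 8)" using at a trace_not_opp[OF p(1)] unfolding bad_def by blast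
  then have "finite {x \<in> trace p (v 8). \<not> opp x}" using trace_finite_not_opp[OF p o] by blast
  moreover have "trace p (v 8) = {x \<in> trace p (v 8). \<not> opp x} \<union> {x \<in> trace p (v 8). opp x}" by blast
  ultimately have "infinite {x \<in> trace p (v 8). opp x}"
    using trace_infinite[OF o D(1)] by (metis finite_UnI)
  then show ?thesis using o path_trace[OF q2] by blast
qed

theorem no_opp_pair:
  assumes p: "opp p0" "pt p0 \<longleftrightarrow> \<not> t" "adj p0 p0'" and l: "opp l0" "pt l0 \<longleftrightarrow> t" "adj l0 l0'"
  shows False
proof -
  obtain p C y N where e: "path [p, C, y, N]" "opp p" "opp N" "pt p \<longleftrightarrow> \<not> t"
    using opp_at_distance_3[OF p l] by blast
  then have adj: "adj p C" "adj C y" "y \<noteq> p" "adj N y" "adj y N" using adj_sym by auto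
  have ny: "\<not> opp y" using no_chamber[OF adj(4)] e unfolding opp_def by blast
  obtain x where x: "dst 6 p x" "y \<in> trace p x" "infinite {a \<in> trace p x. opp a}"
    using opp_trace_exists[OF e(2,4) adj(1-3)] by blast
  obtain a1 where a1: "a1 \<in> trace p x" "opp a1" using infinite_pick[OF x(3), of "{}"] by auto
  obtain a2 where a2: "a2 \<in> trace p x" "opp a2" "a2 \<noteq> a1" using infinite_pick[OF x(3), of "{a1}"] by auto
  obtain a3 where a3: "a3 \<in> trace p x" "opp a3" "a3 \<noteq> a1" "a3 \<noteq> a2"
    using infinite_pick[OF x(3), of "{a1, a2}"] by auto
  define A where "A = {a1, a2, a3}"
  have A: "a \<in> trace p x" "opp a" "a \<noteq> y" if "a \<in> A" for a
    using that a1 a2 a3 ny unfolding A_def by auto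
  have pathA: "\<exists>D. path [a, D, p, C, y, N]" if a: "a \<in> A" for a
  proof -
    obtain D E b B where q: "path [p, D, a, E, b, B, x]" using trace_path[OF x(1) A(1)[OF a]] by blast
    obtain D' E' b' B' where q': "path [p, D', y, E', b', B', x]" using trace_path[OF x(1,2)] by blast
    have "[p, D', y] = [p, C, y]" by (rule path_unique) (use q' e in simp_all)
    then have "D \<noteq> C" using opposite_path_unique(1)[OF q] q' A(3)[OF a] by blast
    then show ?thesis using q e adj_sym by (intro exI[of _ D]) auto
  qed
  have ptA: "pt a \<longleftrightarrow> \<not> t" if a: "a \<in> A" for a
  proof -
    obtain D where "path [a, D, p, C, y, N]" using pathA[OF a] by blast
    then show ?thesis using e(4) adj_pt[of a D] adj_pt[of D p] by simp
  qed
  have finA: "finite A" unfolding A_def by simp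
  have "finite {u. adj N u \<and> u \<noteq> y \<and> bad a u}" if a: "a \<in> A" for a
  proof -
    obtain D where "path [a, D, p, C, y, N]" using pathA[OF a] by blast
    then show ?thesis by (rule bad_finite)
  qed
  then have "finite (\<Union>a\<in>A. {u. adj N u \<and> u \<noteq> y \<and> bad a u})" using finA by (rule finite_UN_I[rotated])
  then have "finite ({y} \<union> (\<Union>a\<in>A. {u. adj N u \<and> u \<noteq> y \<and> bad a u}))" by simp
  from infinite_pick[OF inf_adj[OF adj(4)] this] obtain u
    where u: "adj N u" "u \<noteq> y" "\<forall>a\<in>A. \<not> bad a u" by blast
  have oA: "dst 6 a u" if a: "a \<in> A" for a
  proof -
    obtain D where "path [a, D, p, C, y, N]" using pathA[OF a] by blast
    then have "path [a, D, p, C, y, N, u]" using u by auto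
    then show ?thesis using dst_6 by blast
  qed
  have "finite {M. \<exists>D c C w. path [a, D, c, C, w, M, u] \<and> \<not> opp c}" if a: "a \<in> A" for a
    using line_finite_not_opp[OF A(2)[OF a] ptA[OF a] oA[OF a]] u(3) a by blast
  then have "finite (\<Union>a\<in>A. {M. \<exists>D c C w. path [a, D, c, C, w, M, u] \<and> \<not> opp c})"
    using finA by (rule finite_UN_I[rotated])
  then have "finite ({N} \<union> {x. adj u x \<and> \<not> opp x} \<union>
        (\<Union>a\<in>A. {M. \<exists>D c C w. path [a, D, c, C, w, M, u] \<and> \<not> opp c}))"
    using opp_line_finite[OF e(3) u(1)] by simp
  from infinite_pick[OF inf_adj[OF adj_sym[OF u(1)]] this] obtain M
    where M0: "M \<in> {n. adj u n}" "M \<notin> {N} \<union> {x. adj u x \<and> \<not> opp x} \<union>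
        (\<Union>a\<in>A. {M. \<exists>D c C w. path [a, D, c, C, w, M, u] \<and> \<not> opp c})" by (rule bexE)
  then have M: "adj u M" "M \<noteq> N" "opp M" by simp_all
  have M4: "opp c" if a: "a \<in> A" and q: "path [a, D, c, C, w, M, u]" for a D c C w
  proof (rule ccontr)
    assume "\<not> opp c"
    then have "M \<in> {M. \<exists>D c C w. path [a, D, c, C, w, M, u] \<and> \<not> opp c}" using q by blast
    then show False using M0(2) a by blast
  qed
  have a1A: "a1 \<in> A" unfolding A_def by simp
  \<comment> \<open>\<open>w\<close> is the element of \<open>M\<close> at distance 4 from
    \<open>a1\<close>; regularity makes it serve \<open>a2\<close> and \<open>a3\<close>
    too.\<close>
  obtain w F c E where "path [u, M, w, F, c, E, a1]" using opposite_path[OF dst_sym[OF oA[OF a1A]] M(1)] by blast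
  then have "path (rev [u, M, w, F, c, E, a1])" unfolding path_rev .
  then have w1: "path [a1, E, c, F, w, M, u]" by simp
  have pw: "path [p, C, y, N, u, M, w]" using e u M w1 adj_sym by auto
  have o: "dst 6 p w" using pw dst_6 by blast
  have "path [y, N, u, M, w]" "path [a1, E, c, F, w]" using pw w1 by simp_all
  then have yw: "y \<in> trace p w" "a1 \<in> trace p w"
    using x(2) a1(1) unfolding trace_def dst_4 by blast+
  \<comment> \<open>The two traces share \<open>y\<close> and \<open>a1\<close>, and
    \<open>y\<close> is not \<open>a1\<close> because only \<open>a1\<close> is good.\<close>
  have "trace p x \<subseteq> trace p w"
    by (rule regular[OF semi e(4) x(1) o x(2) yw(1) a1(1) yw(2)]) (use A(3)[OF a1A] in blast)
  then have tw: "a \<in> trace p w" if "a \<in> A" for a using A(1)[OF that] by blast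
  have lines: "\<exists>D E c F. path [p, D, a, E, c, F, w] \<and> \<not> opp F" if a: "a \<in> A" for a
  proof -
    obtain D E c F where q: "path [p, D, a, E, c, F, w]" using trace_path[OF o tw[OF a]] by blast
    \<comment> \<open>There is only one path of five steps from \<open>p\<close> to
      \<open>M\<close>, and it passes through \<open>y\<close>, which is not in
      \<open>A\<close>.\<close>
    have "F \<noteq> M"
    proof
      assume "F = M"
      then have "[p, D, a, E, c, M] = [p, C, y, N, u, M]"
        by (intro path_unique) (use q pw in simp_all)
      then show False using A(3)[OF a] by simp
    qed
    then have "path [a, E, c, F, w, M, u]" using q w1 by simp
    then have "opp c" using M4[OF a] by blast
    then have "\<not> opp F" using no_chamber[of c F] q unfolding opp_def by simp
    then show ?thesis using q by blast
  qed
  have inj: "F \<noteq> F'" if "a \<noteq> a'" "path [p, D, a, E, c, F, w]" "path [p, D', a', E', c', F', w]"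
    for a a' D D' E E' c c' F F'
  proof
    assume "F = F'"
    then have "[p, D, a, E, c, F] = [p, D', a', E', c', F]"
      by (intro path_unique) (use that in simp_all)
    then show False using that by simp
  qed
  obtain D1 E1 c1 F1 where f1: "path [p, D1, a1, E1, c1, F1, w]" "\<not> opp F1" using lines[of a1] A_def by blast
  obtain D2 E2 c2 F2 where f2: "path [p, D2, a2, E2, c2, F2, w]" "\<not> opp F2" using lines[of a2] A_def by blast
  obtain D3 E3 c3 F3 where f3: "path [p, D3, a3, E3, c3, F3, w]" "\<not> opp F3" using lines[of a3] A_def by blast
  have "F1 \<noteq> F2" "F1 \<noteq> F3" "F2 \<noteq> F3"
    using inj[OF _ f1(1) f2(1)] inj[OF _ f1(1) f3(1)] inj[OF _ f2(1) f3(1)] a2 a3 by auto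
  moreover have "adj w F1" "adj w F2" "adj w F3" using f1 f2 f3 adj_sym by auto
  moreover have "adj M w" using w1 adj_sym by auto
  ultimately show False using opp_line_two[OF M(3)] f1(2) f2(2) f3(2) by metis
qed

end

section \<open>The incidence graph of a generalised hexagon\<close>

lemma walk_map_upt:
  "(\<And>k. k < d \<Longrightarrow> E (f k) (f (Suc k))) \<Longrightarrow> (\<And>k. Suc (Suc k) \<le> d \<Longrightarrow> f k \<noteq> f (Suc (Suc k))) \<Longrightarrow>
   walk E (map f [0..<Suc d])"
proof (induction d arbitrary: f)
  case (Suc d)
  have IH: "walk E (map (\<lambda>k. f (Suc k)) [0..<Suc d])" using Suc.prems by (intro Suc.IH) simp_all
  show ?case
  proof (cases d)
    case 0
    then show ?thesis using Suc.prems(1)[of 0] by simp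
  next
    case (Suc e)
    define r where "r = map (\<lambda>k. f (Suc (Suc (Suc k)))) [0..<e]"
    have "map f [0..<Suc (Suc d)] = f 0 # f (Suc 0) # f (Suc (Suc 0)) # r"
      "map (\<lambda>k. f (Suc k)) [0..<Suc d] = f (Suc 0) # f (Suc (Suc 0)) # r"
      unfolding Suc r_def by (simp_all only: map_upt_Suc)
    then show ?thesis using IH Suc.prems(1)[of 0] Suc.prems(2)[of 0] Suc by (simp del: upt_Suc)
  qed
qed simp

text \<open>A nontrivial closed walk with the fewest steps \<open>n\<close> has no repeated vertex
  and no chord, as either would shorten it. Bipartiteness makes \<open>n\<close> even, and the ban
  on backtracking excludes 2.\<close>

lemma closed_walk_gon:
  assumes G: "point_line_geometry G"
    and xs: "walk (inc G) xs" "hd xs = last xs" "2 \<le> length xs" "length xs \<le> 12"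
  shows "\<exists>k H. 2 \<le> k \<and> k < 6 \<and> ordinary_gon G k H"
proof -
  have sym: "inc G x y \<Longrightarrow> inc G y x" for x y using G unfolding point_line_geometry_def by blast
  have tps: "inc G x y \<Longrightarrow> (x \<in> points G \<longleftrightarrow> y \<notin> points G) \<and> x \<in> elements G" for x y
    using G unfolding point_line_geometry_def elements_def by blast
  define P where "P n \<longleftrightarrow> (\<exists>xs. walk (inc G) xs \<and> hd xs = last xs \<and> length xs = Suc n \<and> 1 \<le> n)" for n
  define n where "n = (LEAST n. P n)"
  have P1: "P (length xs - 1)" unfolding P_def using xs by (intro exI[of _ xs]) auto
  then have n11: "n \<le> 11" unfolding n_def using Least_le[of P "length xs - 1"] xs by linarith
  have "P n" unfolding n_def using P1 by (rule LeastI)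
  then obtain ys where ys: "walk (inc G) ys" "hd ys = last ys" "length ys = Suc n" "1 \<le> n"
    unfolding P_def by blast
  have min: "n \<le> length zs - 1" if "walk (inc G) zs" "hd zs = last zs" "2 \<le> length zs" for zs
  proof -
    have "P (length zs - 1)" unfolding P_def using that by (intro exI[of _ zs]) auto
    then show ?thesis unfolding n_def by (rule Least_le)
  qed
  define seg where "seg i j = take (Suc (j - i)) (drop i ys)" for i j
  have seg: "walk (inc G) (seg i j)" "hd (seg i j) = ys ! i" "last (seg i j) = ys ! j"
    "length (seg i j) = Suc (j - i)" if "i \<le> j" "j \<le> n" for i j
  proof -
    have "walk (inc G) (drop i ys)" using that ys by (intro walk_drop) auto
    then show "walk (inc G) (seg i j)" unfolding seg_def by (rule walk_take) simp
    show l: "length (seg i j) = Suc (j - i)" unfolding seg_def using that ys by simp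
    show "hd (seg i j) = ys ! i" using that ys l by (subst hd_conv_nth) (auto simp: seg_def)
    show "last (seg i j) = ys ! j" using that ys l by (subst last_conv_nth) (auto simp: seg_def)
  qed
  have ends: "ys ! 0 = ys ! n"
    using ys by (metis diff_Suc_1 hd_conv_nth last_conv_nth list.size(3) nat.distinct(1))
  have dist: "i = 0 \<and> j = n" if "i < j" "j \<le> n" "ys ! i = ys ! j" for i j
  proof -
    have "n \<le> j - i" using min[of "seg i j"] seg[of i j] that by auto
    then show ?thesis using that by arith
  qed
  have edge: "inc G (ys ! i) (ys ! Suc i)" if "i < n" for i
    using walk_nth[OF ys(1)] ys(3) that by simp
  \<comment> \<open>A chord closes the segment between its ends to a walk with
    \<open>j - i + 1\<close> steps. Minimality leaves only edges of the walk itself, including the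
    one from \<open>n - 1\<close> back to \<open>0\<close>.\<close>
  have chord: "j = Suc i \<or> (i = 0 \<and> j = n - 1)" if "i < j" "j < n" "inc G (ys ! i) (ys ! j)" for i j
  proof (rule ccontr)
    assume c: "\<not> (j = Suc i \<or> (i = 0 \<and> j = n - 1))"
    have "j = Suc (j - 1)" "i < j - 1" using that(1) c by arith+
    then obtain k where k: "j = Suc k" "i < k" by blast
    have s: "seg i j = seg i k @ [ys ! j]"
    proof -
      have "k - i < length (drop i ys)" "j - i = Suc (k - i)" using k ys that by auto
      then show ?thesis unfolding seg_def using k ys that
        by (simp add: take_Suc_conv_app_nth)
    qed
    have "ys ! k \<noteq> ys ! i" using dist[of i k] k that by auto
    then have "walk (inc G) (seg i k @ ys ! j # [ys ! i])"
      using seg[of i j] seg[of i k] s that k sym by (subst walk_append) auto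
    moreover have "seg i k \<noteq> []" using seg(4)[of i k] k that by auto
    ultimately have "n \<le> Suc (Suc (k - i))"
      using min[of "seg i k @ ys ! j # [ys ! i]"] seg[of i k] k that by simp
    then show False using k that c by arith
  qed
  have n1: "n \<noteq> 1" using edge[of 0] ends ys(4) tps by auto
  have n2: "n \<noteq> 2"
  proof
    assume "n = 2"
    then obtain a b c where "ys = [a, b, c]" using ys(3) by (auto simp: length_Suc_conv numeral_2_eq_2)
    then show False using ys by simp
  qed
  have "ys ! i \<in> points G \<longleftrightarrow> (ys ! 0 \<in> points G \<longleftrightarrow> even i)" if "i \<le> n" for i
    using that by (induction i) (use tps[OF edge] in auto)
  from this[of n] have "even n" using ends by auto
  then obtain k where k: "n = 2 * k" by blast
  have kk: "2 \<le> k" "k < 6" using k n1 n2 n11 ys(4) by auto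
  have "ordinary_gon G k ((!) ys ` {..<2 * k})"
    unfolding ordinary_gon_def
  proof (intro exI[of _ "(!) ys"] conjI allI impI)
    show "inj_on ((!) ys) {..<2 * k}"
    proof (rule linorder_inj_onI)
      fix i j assume "i < j" "i \<in> {..<2 * k}" "j \<in> {..<2 * k}"
      then show "ys ! i \<noteq> ys ! j" using dist[of i j] k by auto
    qed auto
    show "(!) ys ` {..<2 * k} \<subseteq> elements G" using edge tps k by auto
    fix i j assume ij: "i < 2 * k" "j < 2 * k"
    have wrap: "inc G (ys ! (n - 1)) (ys ! 0)" using edge[of "n - 1"] ends ys(4) by simp
    have dir: "inc G (ys ! i) (ys ! j)" if "j = (i + 1) mod n" "i < n" for i j
    proof (cases "i = n - 1")
      case True
      then show ?thesis using that wrap ys(4) by simp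
    next
      case False
      then show ?thesis using that edge[of i] by simp
    qed
    have lt: "j = (i + 1) mod n \<or> i = (j + 1) mod n" if "i < j" "j < n" "inc G (ys ! i) (ys ! j)" for i j
      using chord[OF that] that by (auto simp: mod_less)
    show "inc G (ys ! i) (ys ! j) \<longleftrightarrow> j = (i + 1) mod (2 * k) \<or> i = (j + 1) mod (2 * k)"
    proof
      assume a: "inc G (ys ! i) (ys ! j)"
      then have "i \<noteq> j" using tps by blast
      then show "j = (i + 1) mod (2 * k) \<or> i = (j + 1) mod (2 * k)"
        using lt[of i j] lt[of j i] a sym ij k by (cases "i < j") auto
    next
      assume "j = (i + 1) mod (2 * k) \<or> i = (j + 1) mod (2 * k)"
      then show "inc G (ys ! i) (ys ! j)" using dir[of j i] dir[of i j] sym ij k by auto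
    qed
  qed simp
  then show ?thesis using kk by blast
qed

lemma ordinary_gon_6:
  assumes "ordinary_gon G 6 H"
  obtains c :: "nat \<Rightarrow> 'a" where "inj_on c {..<12}" "H = c ` {..<12}"
    "\<forall>i<12. \<forall>j<12. inc G (c i) (c j) \<longleftrightarrow> j = (i + 1) mod 12 \<or> i = (j + 1) mod 12"
proof -
  from assms obtain c :: "nat \<Rightarrow> 'a" where c: "inj_on c {..<2 * 6}" "H = c ` {..<2 * 6}"
    "\<forall>i<2 * 6. \<forall>j<2 * 6. inc G (c i) (c j) \<longleftrightarrow> j = (i + 1) mod (2 * 6) \<or> i = (j + 1) mod (2 * 6)"
    unfolding ordinary_gon_def by blast
  show ?thesis by (rule that[of c]) (use c in simp_all)
qed

lemma gon_walk:
  assumes H: "ordinary_gon G 6 H" and xy: "x \<in> H" "y \<in> H" and sym: "\<And>x y. inc G x y \<Longrightarrow> inc G y x"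
  shows "\<exists>xs. walk (inc G) xs \<and> hd xs = x \<and> last xs = y \<and> length xs \<le> 7"
proof -
  obtain c :: "nat \<Rightarrow> 'a" where c: "inj_on c {..<12}" "H = c ` {..<12}"
    "\<forall>i<12. \<forall>j<12. inc G (c i) (c j) \<longleftrightarrow> j = (i + 1) mod 12 \<or> i = (j + 1) mod 12"
    by (rule ordinary_gon_6[OF H])
  have arc: "\<exists>xs. walk (inc G) xs \<and> hd xs = c i \<and> last xs = c ((i + d) mod 12) \<and> length xs \<le> 7"
    if "d \<le> 6" "i < 12" for i d :: nat
  proof -
    define f where "f k = c ((i + k) mod 12)" for k
    have "walk (inc G) (map f [0..<Suc d])"
    proof (rule walk_map_upt)
      fix k
      show "inc G (f k) (f (Suc k))" unfolding f_def using c(3) by (simp add: mod_Suc_eq)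
      have "(i + Suc (Suc k)) mod 12 = ((i + k) mod 12 + 2) mod 12"
        unfolding mod_add_left_eq by simp
      moreover have "m \<noteq> (m + 2) mod 12" if "m < 12" for m :: nat
        using that by (auto simp: mod_if)
      ultimately have "(i + k) mod 12 \<noteq> (i + Suc (Suc k)) mod 12"
        by (metis mod_less_divisor zero_less_numeral)
      then show "f k \<noteq> f (Suc (Suc k))" unfolding f_def using c(1) by (auto dest: inj_onD)
    qed
    moreover have "hd (map f [0..<Suc d]) = c i" using that by (simp add: hd_map f_def del: upt_Suc)
    moreover have "last (map f [0..<Suc d]) = c ((i + d) mod 12)" by (simp add: f_def)
    ultimately show ?thesis using that by (intro exI[of _ "map f [0..<Suc d]"]) simp
  qed
  obtain i j where ij: "i < 12" "j < 12" "x = c i" "y = c j" using xy c by auto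
  have "(\<exists>d\<le>6. j = (i + d) mod 12) \<or> (\<exists>d\<le>6. i = (j + d) mod 12)"
  proof -
    \<comment> \<open>Number of steps from \<open>i\<close> forwards to \<open>j\<close> around the
      hexagon; one of the arcs of \<open>d\<close> and \<open>12 - d\<close> steps has at most
      six.\<close>
    define d where "d = (if i \<le> j then j - i else j + 12 - i)"
    have d: "i + d = j \<or> i + d = j + 12" "j + (12 - d) = i \<or> j + (12 - d) = i + 12"
      unfolding d_def using ij(1,2) by auto
    then have "j = (i + d) mod 12" "i = (j + (12 - d)) mod 12" using ij(1,2) by auto
    moreover have "d \<le> 6 \<or> 12 - d \<le> 6" by arith
    ultimately show ?thesis by blast
  qed
  then show ?thesis
  proof
    assume "\<exists>d\<le>6. j = (i + d) mod 12"
    then show ?thesis using arc[OF _ ij(1)] ij by blast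
  next
    assume "\<exists>d\<le>6. i = (j + d) mod 12"
    then obtain xs where xs: "walk (inc G) xs" "hd xs = y" "last xs = x" "length xs \<le> 7"
      using arc[OF _ ij(2)] ij by blast
    have "xs \<noteq> []" using xs by auto
    then show ?thesis using xs walk_rev[of "inc G" xs] sym
      by (intro exI[of _ "rev xs"]) (auto simp: hd_rev last_rev)
  qed
qed

lemma generalised_hexagon_adj:
  assumes "generalised_hexagon G" "x \<in> elements G"
  shows "\<exists>y. inc G x y"
proof -
  obtain H where H: "ordinary_gon G 6 H" "x \<in> H" using assms unfolding generalised_hexagon_def by blast
  obtain c :: "nat \<Rightarrow> 'a" where c: "H = c ` {..<12}"
    "\<forall>i<12. \<forall>j<12. inc G (c i) (c j) \<longleftrightarrow> j = (i + 1) mod 12 \<or> i = (j + 1) mod 12"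
    by (rule ordinary_gon_6[OF H(1)])
  then obtain i where "i < 12" "x = c i" using H by auto
  then have "inc G x (c ((i + 1) mod 12))" using c(2) by simp
  then show ?thesis by blast
qed

lemma hexagon_inc:
  assumes G: "generalised_hexagon G" "thick G"
  shows "hexagon (inc G) (\<lambda>x. x \<in> points G)"
proof
  have pl: "point_line_geometry G" using G unfolding generalised_hexagon_def by blast
  have sym: "\<And>x y. inc G x y \<Longrightarrow> inc G y x" using pl unfolding point_line_geometry_def by blast
  have tps: "inc G x y \<Longrightarrow> (x \<in> points G \<and> y \<in> lines G) \<or> (x \<in> lines G \<and> y \<in> points G)" for x y
    using pl unfolding point_line_geometry_def by blast
  show "inc G x y \<Longrightarrow> inc G y x" for x y by (rule sym)
  show "inc G x y \<Longrightarrow> x \<in> points G \<longleftrightarrow> y \<notin> points G" for x y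
    using tps pl unfolding point_line_geometry_def by blast
  show "length xs = 1" if "walk (inc G) xs" "hd xs = last xs" "length xs \<le> 12" for xs
  proof (rule ccontr)
    assume "length xs \<noteq> 1"
    moreover have "xs \<noteq> []" using that by auto
    ultimately have "2 \<le> length xs" by (cases xs; cases "tl xs") auto
    then show False using closed_walk_gon[OF pl that(1,2) _ that(3)] G unfolding generalised_hexagon_def by blast
  qed
  show "\<exists>xs. walk (inc G) xs \<and> hd xs = x \<and> last xs = y \<and> length xs \<le> 7" if "inc G x x'" "inc G y y'" for x x' y y'
  proof -
    have "x \<in> elements G" "y \<in> elements G" using tps that unfolding elements_def by blast+
    then obtain H where "ordinary_gon G 6 H" "x \<in> H" "y \<in> H" using G unfolding generalised_hexagon_def by blast
    from gon_walk[OF this sym] show ?thesis .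
  qed
  show "\<exists>z1 z2. inc G x z1 \<and> inc G x z2 \<and> z1 \<noteq> y \<and> z2 \<noteq> y \<and> z1 \<noteq> z2" if "inc G x y" for x y
  proof -
    have "\<exists>S. S \<subseteq> {z. inc G x z} \<and> card S = 3"
    proof (cases "x \<in> points G")
      case True
      then obtain S where "S \<subseteq> {l \<in> lines G. inc G x l}" "card S = 3" using G unfolding thick_def by blast
      then show ?thesis by blast
    next
      case False
      then have "x \<in> lines G" using tps[OF that] by blast
      then obtain S where "S \<subseteq> {p \<in> points G. inc G p x}" "card S = 3" using G unfolding thick_def by blast
      then show ?thesis using sym by blast
    qed
    then obtain a b c where "{a, b, c} \<subseteq> {z. inc G x z}" "a \<noteq> b" "a \<noteq> c" "b \<noteq> c"
      unfolding card_3_iff by blast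
    then have "inc G x a" "inc G x b" "inc G x c" by auto
    then show ?thesis using \<open>a \<noteq> b\<close> \<open>a \<noteq> c\<close> \<open>b \<noteq> c\<close> by (cases "y = a"; cases "y = b") blast+
  qed
qed

section \<open>Distance in the incidence graph and chords of apartments\<close>

context hexagon
begin

lemma dst_Suc: "dst (Suc n) x y \<Longrightarrow> \<exists>z. dst n x z \<and> adj z y"
proof -
  assume "dst (Suc n) x y"
  then obtain xs where xs: "path xs" "length xs = Suc (Suc n)" "hd xs = x" "last xs = y"
    unfolding dst_def by blast
  have t: "path (take (Suc n) xs)" using walk_take[OF xs(1)] by simp
  have l: "last (take (Suc n) xs) = xs ! n" using xs(2) by (simp add: take_Suc_conv_app_nth)
  have ne: "xs \<noteq> []" using xs(2) by auto
  then have "hd (take (Suc n) xs) = x" using xs by (cases xs) auto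
  then have "dst n x (xs ! n)" unfolding dst_def using t l xs(2) by (intro exI[of _ "take (Suc n) xs"]) simp
  moreover have "adj (xs ! n) (xs ! Suc n)" using walk_nth[OF xs(1)] xs(2) by simp
  moreover have "xs ! Suc n = y" using xs ne by (simp add: last_conv_nth)
  ultimately show ?thesis by blast
qed

lemma dst_relpow: "dst n x y \<Longrightarrow> (adj ^^ n) x y"
proof (induction n arbitrary: y)
  case (Suc n)
  from dst_Suc[OF Suc.prems] obtain z where "dst n x z" "adj z y" by blast
  then show ?case using Suc.IH by (intro relpowp_Suc_I) simp_all
qed simp

text \<open>An edge that undoes the preceding one is cancelled together with it, which is why the
  number of steps may drop.\<close>

lemma relpow_dst: "(adj ^^ n) x y \<Longrightarrow> \<exists>m\<le>n. dst m x y"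
proof (induction n arbitrary: y)
  case (Suc n)
  then obtain z where z: "(adj ^^ n) x z" "adj z y" by auto
  then obtain m where m: "m \<le> n" "dst m x z" using Suc by blast
  then obtain xs where xs: "path xs" "length xs = Suc m" "hd xs = x" "last xs = z"
    unfolding dst_def by blast
  then have "xs \<noteq> []" by auto
  then obtain us where us: "xs = us @ [z]" using xs by (metis append_butlast_last_id)
  show ?case
  proof (cases "us \<noteq> [] \<and> last us = y")
    case True
    then have "path (take (length us) xs)" using walk_take[OF xs(1), of "length us"] by simp
    then have "path us" using us by simp
    then have "dst (m - 1) x y" unfolding dst_def using True us xs
      by (intro exI[of _ us]) (cases us; auto)
    then show ?thesis using m by (intro exI[of _ "m - 1"]) auto
  next
    case False
    then have "path (us @ z # [y])" using xs us z by (subst walk_append) auto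
    then have "dst (Suc m) x y" unfolding dst_def using us xs
      by (intro exI[of _ "us @ [z, y]"]) (cases us; auto)
    then show ?thesis using m by (intro exI[of _ "Suc m"]) auto
  qed
qed (intro exI[of _ 0], auto)

text \<open>The infimum of the empty set is infinite, so the value 6 is attained by a walk; after
  cancellation it still has six steps. Conversely uniqueness excludes shorter walks.\<close>

lemma dst_6_iff: "(INF n \<in> {n. (adj ^^ n) x y}. enat n) = 6 \<longleftrightarrow> dst 6 x y"
proof
  assume d: "dst 6 x y"
  have "6 \<le> n" if "(adj ^^ n) x y" for n
  proof -
    obtain m where "m \<le> n" "dst m x y" using relpow_dst \<open>(adj ^^ n) x y\<close> by blast
    then show ?thesis using dst_unique[OF _ d, of m] by linarith
  qed
  then have "(6::enat) \<le> (INF n \<in> {n. (adj ^^ n) x y}. enat n)"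
    by (intro INF_greatest) (simp add: numeral_eq_enat)
  moreover have "(INF n \<in> {n. (adj ^^ n) x y}. enat n) \<le> enat 6"
    using dst_relpow[OF d] by (intro INF_lower) simp
  ultimately show "(INF n \<in> {n. (adj ^^ n) x y}. enat n) = 6"
    by (simp add: numeral_eq_enat antisym)
next
  assume i: "(INF n \<in> {n. (adj ^^ n) x y}. enat n) = 6"
  then have ne: "{n. (adj ^^ n) x y} \<noteq> {}" by (intro notI) (simp add: top_enat_def numeral_eq_enat)
  then obtain k where "(adj ^^ k) x y" by blast
  then have "(INF n \<in> {n. (adj ^^ n) x y}. enat n) \<in> enat ` {n. (adj ^^ n) x y}"
    by (intro wellorder_InfI[of "enat k"]) simp
  then obtain n where n: "(adj ^^ n) x y" "(6::enat) = enat n" unfolding i by blast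
  then have "n = 6" by (simp add: numeral_eq_enat)
  then have "(adj ^^ 6) x y" using n by blast
  then obtain m where m: "m \<le> 6" "dst m x y" using relpow_dst by blast
  then have "(INF n \<in> {n. (adj ^^ n) x y}. enat n) \<le> enat m"
    using dst_relpow by (intro INF_lower) simp
  then have "m = 6" unfolding i using m by (simp add: numeral_eq_enat)
  then show "dst 6 x y" using m by simp
qed

lemma apt_walk:
  assumes "apt v" shows "path (map (\<lambda>k. v (m + int k)) [0..<Suc d])"
  by (rule walk_map_upt) (simp_all add: apt_adj[OF assms] add.commute)

lemma apt_inj:
  assumes v: "apt v" and d: "1 \<le> d" "d \<le> 11" shows "v (m + int d) \<noteq> v m"
proof
  assume e: "v (m + int d) = v m"
  have "length (map (\<lambda>k. v (m + int k)) [0..<Suc d]) = 1"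
    by (rule girth[OF apt_walk[OF v]]) (use e d in \<open>simp_all add: hd_map del: upt_Suc\<close>, simp)
  then show False using d by simp
qed

text \<open>The bound 10 is sharp: for \<open>d = 11\<close> the edge is the one that closes the
  apartment.\<close>

lemma apt_chord:
  assumes v: "apt v" and d: "1 \<le> d" "d \<le> 10" and a: "adj (v m) (v (m + int d))" shows "d = 1"
proof -
  have "dst d (v m) (v (m + int d))" unfolding dst_def
    by (rule exI[of _ "map (\<lambda>k. v (m + int k)) [0..<Suc d]"])
      (use apt_walk[OF v] in \<open>simp add: hd_map del: upt_Suc\<close>, simp)
  then show ?thesis using dst_unique[of d _ _ 1] a d dst_1 by simp
qed

end

text \<open>The identity outside the geometry turns a collineation into a bijection of the type and
  meets the last clause of \<open>aut\<close>.\<close>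

definition extend :: "'a geometry \<Rightarrow> ('a \<Rightarrow> 'a) \<Rightarrow> 'a bijection" where
  "extend G g = Bijection (\<lambda>x. if x \<in> elements G then g x else x)"

lemma extend_ap:
  assumes "bij_betw g (elements G) (elements G)"
  shows "extend G g \<cdot> x = (if x \<in> elements G then g x else x)"
proof -
  let ?f = "\<lambda>x. if x \<in> elements G then g x else x"
  have "bij_betw ?f (elements G) (elements G)" using assms by (subst bij_betw_cong[of _ _ g]) simp_all
  moreover have "bij_betw ?f (- elements G) (- elements G)"
    by (subst bij_betw_cong[of _ _ id]) simp_all
  ultimately have "bij_betw ?f (elements G \<union> - elements G) (elements G \<union> - elements G)"
    by (rule bij_betw_combine) simp
  then show ?thesis unfolding extend_def by (simp add: Bijection_inverse)
qed

lemma extend_aut: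
  assumes G: "generalised_hexagon G" "thick G" and g: "collineation G g"
  shows "extend G g \<in> hexagon.aut (inc G) (\<lambda>x. x \<in> points G)"
proof -
  interpret hexagon "inc G" "\<lambda>x. x \<in> points G" by (rule hexagon_inc[OF G])
  have bij: "bij_betw g (elements G) (elements G)"
    and pres: "\<And>x y. x \<in> elements G \<Longrightarrow> y \<in> elements G \<Longrightarrow> inc G (g x) (g y) \<longleftrightarrow> inc G x y"
    and im: "g ` points G = points G" "g ` lines G = lines G"
    using g unfolding collineation_def preserves_incidence_def by auto
  have pl: "point_line_geometry G" using G unfolding generalised_hexagon_def by blast
  have el: "inc G x y \<Longrightarrow> x \<in> elements G \<and> y \<in> elements G" for x y
    using pl unfolding point_line_geometry_def elements_def by blast
  have gel: "x \<in> elements G \<Longrightarrow> g x \<in> elements G" for x using bij by (rule bij_betwE[rule_format])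
  show ?thesis
  proof (rule autI)
    fix x y
    show "inc G (extend G g \<cdot> x) (extend G g \<cdot> y) \<longleftrightarrow> inc G x y"
      unfolding extend_ap[OF bij] using pres[of x y] el[of x y] el[of "g x" y] el[of x "g y"] by auto
    assume "inc G x y"
    then have x: "x \<in> points G \<or> x \<in> lines G" using pl unfolding point_line_geometry_def by blast
    then have "g x \<in> points G \<longleftrightarrow> x \<in> points G"
      using im pl unfolding point_line_geometry_def by blast
    then show "extend G g \<cdot> x \<in> points G \<longleftrightarrow> x \<in> points G" unfolding extend_ap[OF bij] by simp
  next
    fix x assume "\<forall>y. \<not> inc G x y"
    then have "x \<notin> elements G" using generalised_hexagon_adj[OF G(1)] by blast
    then show "extend G g \<cdot> x = x" unfolding extend_ap[OF bij] by simp
  qed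
qed

lemma apt_gon:
  assumes G: "generalised_hexagon G" "thick G" and v: "hexagon.apt (inc G) v"
  shows "ordinary_gon G 6 ((\<lambda>k. v (int k)) ` {..<12})"
proof -
  interpret hexagon "inc G" "\<lambda>x. x \<in> points G" by (rule hexagon_inc[OF G])
  have pl: "point_line_geometry G" using G unfolding generalised_hexagon_def by blast
  have el: "inc G x y \<Longrightarrow> x \<in> elements G" for x y
    using pl unfolding point_line_geometry_def elements_def by blast
  have inj: "v (int i) \<noteq> v (int j)" if "i < j" "j < 12" for i j
  proof -
    have "1 \<le> j - i" "j - i \<le> 11" using that by arith+
    then show ?thesis using apt_inj[OF v, of "j - i" "int i"] that by simp
  qed
  have dir: "inc G (v (int i)) (v (int j))" if "j = (i + 1) mod 12" "i < 12" for i j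
  proof (cases "i = 11")
    case True
    then show ?thesis using that apt_adj(1)[OF v, of 12 11] apt_period[OF v, of 12 0] by simp
  next
    case False
    then show ?thesis using that apt_adj(1)[OF v, of "int j" "int i"] by simp
  qed
  have lt: "j = (i + 1) mod 12 \<or> i = (j + 1) mod 12" if "i < j" "j < 12" "inc G (v (int i)) (v (int j))" for i j
  proof (cases "j - i \<le> 10")
    case True
    have "j - i = 1" by (rule apt_chord[OF v, of _ "int i"]) (use that True in simp_all)
    then have "j = i + 1" using that by arith
    then show ?thesis using that by simp
  next
    case False
    then have "i = 0" "j = 11" using that by arith+
    then show ?thesis by simp
  qed
  have "inc G (v (int i)) (v (int j)) \<longleftrightarrow> j = (i + 1) mod 12 \<or> i = (j + 1) mod 12"
    if ij: "i < 12" "j < 12" for i j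
  proof
    assume a: "inc G (v (int i)) (v (int j))"
    then have "i \<noteq> j" using adj_neq by blast
    then consider "i < j" | "j < i" by arith
    then show "j = (i + 1) mod 12 \<or> i = (j + 1) mod 12"
      using lt[of i j] lt[of j i] a adj_sym[OF a] ij by cases auto
  next
    assume "j = (i + 1) mod 12 \<or> i = (j + 1) mod 12"
    then show "inc G (v (int i)) (v (int j))" using dir[of j i] dir[of i j] adj_sym ij by blast
  qed
  moreover have "inj_on (\<lambda>k. v (int k)) {..<12}"
  proof (rule linorder_inj_onI)
    fix i j :: nat assume "i < j" "i \<in> {..<12}" "j \<in> {..<12}"
    then show "v (int i) \<noteq> v (int j)" using inj[of i j] by auto
  qed auto
  moreover have "(\<lambda>k. v (int k)) ` {..<12} \<subseteq> elements G"
    using el apt_adj(1)[OF v] by blast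
  ultimately show ?thesis unfolding ordinary_gon_def
    by (intro exI[of _ "\<lambda>k. v (int k)"]) simp
qed

lemma Moufang_hexagon_inc:
  assumes M: "Moufang_hexagon G"
  shows "moufang_hexagon (inc G) (\<lambda>x. x \<in> points G)"
proof -
  have G: "generalised_hexagon G" "thick G" "Moufang_condition G"
    using M unfolding Moufang_hexagon_def by auto
  interpret hexagon "inc G" "\<lambda>x. x \<in> points G" by (rule hexagon_inc[OF G(1,2)])
  have pl: "point_line_geometry G" using G unfolding generalised_hexagon_def by blast
  have el: "inc G x y \<Longrightarrow> x \<in> elements G \<and> y \<in> elements G" for x y
    using pl unfolding point_line_geometry_def elements_def by blast
  show ?thesis
  proof
    fix x0 x1 x2 x3 x4 x5 x6 n n'
    assume p: "path [x0, x1, x2, x3, x4, x5, x6]"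
      and n: "inc G x6 n" "inc G x6 n'" "n \<noteq> x5" "n' \<noteq> x5"
    define x where "x k = [x0, x1, x2, x3, x4, x5, x6] ! k" for k
    have xs: "x 0 = x0" "x 1 = x1" "x 2 = x2" "x 3 = x3" "x 4 = x4" "x 5 = x5" "x 6 = x6"
      by (simp_all add: x_def)
    have "dst 6 x0 x6" using p dst_6 by blast
    then have "incidence_dist G (x 0) (x 6) = enat 6"
      unfolding incidence_dist_def xs using dst_6_iff[of x0 x6] by (simp add: numeral_eq_enat)
    moreover have "\<forall>i<6. inc G (x i) (x (Suc i))"
      using walk_nth[OF p] unfolding x_def by simp
    ultimately have geo: "geodesic_path G 6 x" unfolding geodesic_path_def by blast
    have p7: "path [x0, x1, x2, x3, x4, x5, x6, n]" "path [x0, x1, x2, x3, x4, x5, x6, n']"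
      using p n by auto
    obtain v where v: "apt v" "v 0 = x0" "v 1 = x1" "v 2 = x2" "v 3 = x3" "v 4 = x4" "v 5 = x5"
      "v 6 = x6" "v 7 = n" using apt_exists_7[OF p7(1)] by blast
    obtain w where w: "apt w" "w 0 = x0" "w 1 = x1" "w 2 = x2" "w 3 = x3" "w 4 = x4" "w 5 = x5"
      "w 6 = x6" "w 7 = n'" using apt_exists_7[OF p7(2)] by blast
    define H where "H u = (\<lambda>k. u (int k)) ` {..<12}" for u :: "int \<Rightarrow> 'a"
    have sub: "x ` {..6} \<subseteq> H u" if "u 0 = x0" "u 1 = x1" "u 2 = x2" "u 3 = x3" "u 4 = x4" "u 5 = x5"
      "u 6 = x6" for u
    proof
      fix y assume "y \<in> x ` {..6}"
      then obtain k where k: "k \<le> 6" "y = x k" by blast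
      then have "k = 0 \<or> k = 1 \<or> k = 2 \<or> k = 3 \<or> k = 4 \<or> k = 5 \<or> k = 6" by arith
      then have "y = u (int k)" using k that xs by auto
      then show "y \<in> H u" unfolding H_def using k by auto
    qed
    have gon: "ordinary_gon G 6 (H v)" "ordinary_gon G 6 (H w)"
      unfolding H_def using apt_gon[OF G(1,2)] v(1) w(1) by blast+
    have "x ` {..6} \<subseteq> H v" "x ` {..6} \<subseteq> H w"
      by (rule sub; use v w in simp)+
    then have "\<exists>g\<in>root_elations G x. g ` H v = H w"
      using gon by (intro G(3)[unfolded Moufang_condition_def, rule_format, OF geo] conjI)
    then obtain g where g: "g \<in> root_elations G x" "g ` H v = H w" by (rule bexE)
    have col: "collineation G g"
      and fixed': "\<And>y. y \<in> elements G \<Longrightarrow> \<exists>i\<in>{1..5}. inc G y (x i) \<Longrightarrow> g y = y"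
      using g(1) unfolding root_elations_def by blast+
    have fixed: "g y = y" if "inc G y (x i)" "1 \<le> i" "i \<le> 5" for y i
      by (rule fixed') (use that el in auto)
    have bij: "bij_betw g (elements G) (elements G)"
      using col unfolding collineation_def preserves_incidence_def by blast
    have aut: "extend G g \<in> aut" by (rule extend_aut[OF G(1,2) col])
    have e: "extend G g \<cdot> y = y" if "inc G y (x i)" "1 \<le> i" "i \<le> 5" for y i
      unfolding extend_ap[OF bij] using fixed[OF that] by simp
    have adj: "inc G (x i) (x (Suc i))" if "i < 6" for i using geo that unfolding geodesic_path_def by blast
    have K: "extend G g \<in> K (x i)" if i: "1 \<le> i" "i \<le> 5" for i
    proof -
      have "extend G g \<cdot> x i = x i"
      proof (cases "i = 5")
        case True
        have "inc G (x 5) (x 4)" using adj[of 4] adj_sym by simp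
        then show ?thesis using e[of "x 5" 4] True by simp
      next
        case False
        have "inc G (x i) (x (Suc i))" using adj i by simp
        then show ?thesis by (rule e) (use i False in simp_all)
      qed
      moreover have "extend G g \<cdot> y = y" if "inc G (x i) y" for y
        by (rule e[OF adj_sym[OF that] i])
      ultimately show ?thesis unfolding K_def using aut by blast
    qed
    \<comment> \<open>The Moufang condition maps hexagons to each other only as sets. As
      \<open>x5\<close> and \<open>x6\<close> are fixed, the image of \<open>n\<close> is a
      neighbour of \<open>w 6\<close> in the second hexagon other than \<open>w 5\<close>, which
      leaves \<open>w 7\<close>.\<close>
    have "extend G g \<cdot> n = n'"
    proof -
      have "n \<in> H v" unfolding H_def using v(9) by (intro image_eqI[of _ _ 7]) auto
      then have "g n \<in> H w" using g by blast
      moreover have gn: "extend G g \<cdot> n = g n" unfolding extend_ap[OF bij] using n el by simp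
      ultimately obtain k where k: "k < 12" "extend G g \<cdot> n = w (int k)" unfolding H_def by auto
      have "extend G g \<cdot> x6 = x6" "extend G g \<cdot> x5 = x5"
        using K_adj[OF K[of 5]] K_fix[OF K[of 5]] adj[of 5] xs by simp_all
      then have a: "inc G (w (int k)) (w 6)" "w (int k) \<noteq> x5"
        using aut_adj[OF aut, of x6 n] n(1,3) k adj_sym w by (metis, metis ap_eq_iff)
      have "k = 5 \<or> k = 7"
      proof (cases "k < 6")
        case True
        have "6 - k = 1"
          by (rule apt_chord[OF w(1), of _ "int k"]) (use a True in simp_all)
        then show ?thesis by arith
      next
        case False
        then have "k \<noteq> 6" using a adj_irrefl[of "w 6"] by auto
        then have "k - 6 = 1"
          using apt_chord[OF w(1), of "k - 6" 6] adj_sym[OF a(1)] False k by (simp add: of_nat_diff)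
        then show ?thesis by arith
      qed
      then show ?thesis using k a w by auto
    qed
    then show "\<exists>g. g \<in> K x1 \<and> g \<in> K x2 \<and> g \<in> K x3 \<and> g \<in> K x4 \<and> g \<in> K x5 \<and> g \<cdot> n = n'"
      using K[of 1] K[of 2] K[of 3] K[of 4] K[of 5] xs by auto
  qed
qed

section \<open>Transfer from the geometry to its incidence graph\<close>

context hexagon
begin

lemma finite_if_locally_finite:
  assumes "\<And>y. finite {n. adj y n}"
  shows "finite {y. dst n x y}"
proof (induction n)
  case (Suc n)
  have "{y. dst (Suc n) x y} \<subseteq> (\<Union>z\<in>{z. dst n x z}. {y. adj z y})" using dst_Suc by blast
  then show ?case using Suc assms finite_subset by blast
qed simp

end

theorem theorem2p14:
  fixes G :: "'a geometry"
  assumes "Moufang_hexagon G"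
    and "infinite (elements G)"
  shows "\<not> (\<exists>\<theta>. exceptional_domestic G \<theta>)"
proof
  assume "\<exists>\<theta>. exceptional_domestic G \<theta>"
  then obtain \<theta> where \<theta>: "exceptional_domestic G \<theta>" by blast
  have G: "generalised_hexagon G" "thick G" using assms(1) unfolding Moufang_hexagon_def by auto
  have pl: "point_line_geometry G" using G unfolding generalised_hexagon_def by blast
  interpret moufang_hexagon "inc G" "\<lambda>x. x \<in> points G" by (rule Moufang_hexagon_inc[OF assms(1)])
  have opposite: "opposite G x y \<longleftrightarrow> dst 6 x y" for x y
    unfolding opposite_def incidence_dist_def by (rule dst_6_iff)
  obtain p l where p: "p \<in> points G" "\<theta> p \<in> points G" "dst 6 p (\<theta> p)"
    and l: "l \<in> lines G" "\<theta> l \<in> lines G" "dst 6 l (\<theta> l)"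
    using \<theta> opposite unfolding exceptional_domestic_def by blast
  have dom: "domestic G \<theta>" using \<theta> unfolding exceptional_domestic_def by blast
  have disj: "points G \<inter> lines G = {}" using pl unfolding point_line_geometry_def by blast
  have "\<not> duality G \<theta>" using p disj unfolding duality_def by blast
  then have col: "collineation G \<theta>" using dom unfolding domestic_def automorphism_def by blast
  then have bij: "bij_betw \<theta> (elements G) (elements G)"
    and im: "\<theta> ` points G = points G" "\<theta> ` lines G = lines G"
    unfolding collineation_def preserves_incidence_def by auto
  have ap: "extend G \<theta> \<cdot> x = \<theta> x" if "x \<in> elements G" for x
    unfolding extend_ap[OF bij] using that by simp
  obtain p' l' where adj: "inc G p p'" "inc G l l'"
    using generalised_hexagon_adj[OF G(1)] p l unfolding elements_def by blast
  obtain t where t: "semicentral t" using semicentral_exists[OF adj(1)] by blast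
  \<comment> \<open>All elements are within distance 6 of \<open>p\<close>, so finite neighbourhoods
    throughout would make the hexagon finite.\<close>
  have "\<exists>y. infinite {n. inc G y n}"
  proof (rule ccontr)
    assume "\<nexists>y. infinite {n. inc G y n}"
    then have "finite (\<Union>n\<in>{..6}. {y. dst n p y})" using finite_if_locally_finite by blast
    moreover have "elements G \<subseteq> (\<Union>n\<in>{..6}. {y. dst n p y})"
      using dst_exists[OF adj(1)] generalised_hexagon_adj[OF G(1)] by fastforce
    ultimately show False using assms(2) finite_subset by blast
  qed
  then obtain y where y: "infinite {n. inc G y n}" by blast
  then obtain y' where "inc G y y'" by (metis Collect_empty_eq finite.emptyI)
  have inf: "infinite {n. inc G x n}" if "inc G x x'" for x x'
    by (rule infinite_adj_all[OF \<open>inc G y y'\<close> y that])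
  have chamber: "\<not> dst 6 y (\<theta> y)" if xy: "inc G x y" "dst 6 x (\<theta> x)" for x y
  proof
    assume d: "dst 6 y (\<theta> y)"
    have no: False if ab: "a \<in> points G" "b \<in> lines G" "inc G a b" "dst 6 a (\<theta> a)" "dst 6 b (\<theta> b)" for a b
    proof -
      have el: "a \<in> elements G" "b \<in> elements G" using ab unfolding elements_def by auto
      have "inc G (\<theta> a) (\<theta> b)"
        using col el ab(3) unfolding collineation_def preserves_incidence_def by blast
      moreover have "\<theta> a \<in> points G" "\<theta> b \<in> lines G" using im ab by auto
      ultimately have "opposite_chambers G {a, b} (\<theta> ` {a, b})"
        unfolding opposite_chambers_def chamber_def opposite using ab by auto
      moreover have "chamber G {a, b}" unfolding chamber_def using ab by blast
      ultimately show False using dom unfolding domestic_def by blast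
    qed
    have "(x \<in> points G \<and> y \<in> lines G) \<or> (x \<in> lines G \<and> y \<in> points G)"
      using pl xy unfolding point_line_geometry_def by blast
    then show False using no[of x y] no[of y x] xy d adj_sym[OF xy(1)] by blast
  qed
  have el: "inc G x y \<Longrightarrow> x \<in> elements G \<and> y \<in> elements G" for x y
    using pl unfolding point_line_geometry_def elements_def by blast
  interpret E: exceptional_situation "inc G" "\<lambda>x. x \<in> points G" t "extend G \<theta>"
  proof
    show "extend G \<theta> \<in> aut" by (rule extend_aut[OF G col])
    show "\<not> dst 6 y (extend G \<theta> \<cdot> y)" if "inc G x y" "dst 6 x (extend G \<theta> \<cdot> x)" for x y
      using chamber[of x y] that ap el[OF that(1)] by simp
  qed (use t inf in blast)+
  have opp: "E.opp p" "E.opp l"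
    unfolding E.opp_def using p l ap unfolding elements_def by simp_all
  have lp: "l \<notin> points G" using l disj by blast
  show False
  \<comment> \<open>If \<open>t\<close> holds, the central elations belong to roots with a point in
    the middle, and the lines take the part of points.\<close>
  proof (cases t)
    case True
    show False by (rule E.no_opp_pair[OF opp(2) _ adj(2) opp(1) _ adj(1)]) (use True lp p in simp_all)
  next
    case False
    show False by (rule E.no_opp_pair[OF opp(1) _ adj(1) opp(2) _ adj(2)]) (use False lp p in simp_all)
  qed
qed

end
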